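(* Let $u\in\mathfrak{su}(n+1)$, and let $T\mathbb CP^n$ be endowed with the Calabi metric $G$. Then the map $(f_1,f_2,f_3):T\mathbb CP^n\to\mathbb R^3$ given, at any $(A,X)\in T\mathbb CP^n$ (with $A\in\mathbb CP^n$, $X\in T_A\mathbb CP^n$), by $$f_1(A,X)=g(\mathrm i u,JX),$$ $$f_2(A,X)=a\,g(A,\mathrm i u)-\frac{2}{a+1}\,g(X^2,\mathrm i u),$$ $$f_3(A,X)=g(\mathrm i u,X),$$ where $a=\sqrt{1+4|X|^2}$ and $g$ is the Fubini–Study metric, is a harmonic morphism.
   Context: Let $\mathrm{HM}(n+1)$ be the vector space of Hermitian $(n+1)\times(n+1)$ complex matrices, with the metric $g(A,B)=2\,\mathrm{trace}(AB)$. Regard $\mathbb CP^n$ as the submanifold $\{A\in\mathrm{HM}(n+1)\mid A^2=A,\ \mathrm{trace}\,A=1\}$. The induced metric, also denoted $g$, is the Fubini–Study metric with holomorphic sectional curvature $1$, and the complex structure is $JX=\mathrm i(I-2A)X$ for $X\in T_A\mathbb CP^n$. Thus tangent vectors are Hermitian matrices, $X^2$ is the matrix square, $|X|^2=g(X,X)$, and for $u\in\mathfrak{su}(n+1)$ (traceless skew-Hermitian) $\mathrm i u$ is Hermitian, so the expressions $g(\cdot,\mathrm i u)$ are computed in $\mathrm{HM}(n+1)$. For $Y\in T_A\mathbb CP^n$ and $(A,X)\in T\mathbb CP^n$, let $Y^v\in T_{(A,X)}T\mathbb CP^n$ be the vertical lift, and $Y^h\in T_{(A,X)}T\mathbb CP^n$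 the horizontal lift with respect to the Levi-Civita connection of $g$. In $\mathrm{HM}(n+1)\times\mathrm{HM}(n+1)$ these are $Y^v=(0,Y)$ and $Y^h=(Y,\mathrm i[X,JY])$. Calabi's hyper-Kähler metric $G$ on $T\mathbb CP^n$ is given at $(A,X)$, with $a=\sqrt{1+4|X|^2}$ and $U,V\in T_A\mathbb CP^n$, by $$G(U^h,V^h)=\tfrac{a+1}{2}g(U,V)+\tfrac{a-1}{2|X|^2}\bigl[g(U,X)g(V,X)+g(U,JX)g(V,JX)\bigr],$$ $$G(U^h,V^v)=0,$$ $$G(U^v,V^v)=\tfrac{2}{a+1}g(U,V)-\tfrac{a-1}{2a(a+1)|X|^2}\bigl[g(U,X)g(V,X)+g(U,JX)g(V,JX)\bigr].$$ A harmonic morphism is a smooth map $\phi:(M,G)\to(N,h)$ between Riemannian manifolds such that $f\circ\phi$ is harmonic on $\phi^{-1}(U)$ for every harmonic function $f$ on an open set $U\subseteq N$ with $\phi^{-1}(U)\neq\emptyset$. Equivalently, $\phi$ is a harmonic map which is horizontally weakly conformal, i.e. at each point $x$ either $d\phi_x=0$ or $d\phi_x$ restricted to $(\ker d\phi_x)^\perp$ is a conformal linear isomorphism onto $T_{\phi(x)}N$. Here $\mathbb R^3$ carries its Euclidean metric.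
   Formalization: The constants as given make the claim false (already for n=1), so g(A,B)=½ trace(AB) (holomorphic sectional curvature 4) replaces 2 trace(AB), and the bracket coefficient in G(U^v,V^v) is (a−1)/(a(a+1)|X|²) instead of (a−1)/(2a(a+1)|X|²). *)

theory Defs
  imports "HOL-Analysis.Analysis" "HOL-Library.Numeral_Type"
begin

section \<open>Riemannian submanifolds of Euclidean spaces\<close>

fun Ck_on :: "nat \<Rightarrow> 'a::euclidean_space set \<Rightarrow> ('a \<Rightarrow> 'b::real_normed_vector) \<Rightarrow> bool" where
  "Ck_on 0 S f \<longleftrightarrow> continuous_on S f"
| "Ck_on (Suc k) S f \<longleftrightarrow>
     f differentiable_on S \<and> (\<forall>v. Ck_on k S (\<lambda>x. frechet_derivative f (at x) v))"

definition smooth_on :: "'a::euclidean_space set \<Rightarrow> ('a \<Rightarrow> 'b::real_normed_vector) \<Rightarrow> bool" where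
  "smooth_on S f \<longleftrightarrow> open S \<and> (\<forall>k. Ck_on k S f)"

text \<open>A local parametrization of \<open>M\<close>: an immersion of an open set \<open>W\<close> which is a
  homeomorphism onto an open subset of \<open>M\<close> (the inverse of a chart).  The type \<open>'m\<close>
  fixes the dimension of \<open>M\<close>.\<close>

definition local_param ::
  "'a::euclidean_space set \<Rightarrow> (real^'m::finite) set \<Rightarrow> (real^'m \<Rightarrow> 'a) \<Rightarrow> bool" where
  "local_param M W \<psi> \<longleftrightarrow>
     smooth_on W \<psi> \<and> (\<forall>x\<in>W. inj (frechet_derivative \<psi> (at x))) \<and>
     openin (top_of_set M) (\<psi> ` W) \<and> (\<exists>\<psi>'. homeomorphism W (\<psi> ` W) \<psi> \<psi>')"

definition submanifold :: "'m::finite itself \<Rightarrow> 'a::euclidean_space set \<Rightarrow> bool" where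
  "submanifold TYPE('m) M \<longleftrightarrow>
     (\<forall>p\<in>M. \<exists>(W :: (real^'m) set) \<psi>. local_param M W \<psi> \<and> p \<in> \<psi> ` W)"

definition tangent_space :: "'a::euclidean_space set \<Rightarrow> 'a \<Rightarrow> 'a set" where
  "tangent_space M p =
     {v. \<exists>\<gamma> \<epsilon>. \<epsilon> > 0 \<and> smooth_on {-\<epsilon><..<\<epsilon>} \<gamma> \<and> \<gamma> ` {-\<epsilon><..<\<epsilon>} \<subseteq> M \<and> \<gamma> 0 = p \<and>
            (\<gamma> has_vector_derivative v) (at (0::real))}"

text \<open>A metric is a function \<open>G p v w\<close> of a point and two tangent vectors; its values on
  vectors that are not tangent to \<open>M\<close> are irrelevant.\<close>

type_synonym 'a metric = "'a \<Rightarrow> 'a \<Rightarrow> 'a \<Rightarrow> real"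

definition pd :: "'m::finite \<Rightarrow> (real^'m \<Rightarrow> 'b::real_normed_vector) \<Rightarrow> real^'m \<Rightarrow> 'b" where
  "pd i f x = frechet_derivative f (at x) (axis i 1)"

definition gram :: "'a::euclidean_space metric \<Rightarrow> (real^'m::finite \<Rightarrow> 'a) \<Rightarrow> real^'m \<Rightarrow> real^'m^'m" where
  "gram G \<psi> x = (\<chi> i j. G (\<psi> x) (pd i \<psi> x) (pd j \<psi> x))"

definition riemannian_manifold ::
  "'m::finite itself \<Rightarrow> 'a::euclidean_space set \<Rightarrow> 'a metric \<Rightarrow> bool" where
  "riemannian_manifold TYPE('m) M G \<longleftrightarrow>
     submanifold TYPE('m) M \<and>
     (\<forall>p\<in>M. \<forall>u\<in>tangent_space M p. \<forall>v\<in>tangent_space M p. \<forall>w\<in>tangent_space M p. \<forall>c.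
        G p (c *\<^sub>R u + v) w = c * G p u w + G p v w \<and>
        G p u v = G p v u \<and>
        (u \<noteq> 0 \<longrightarrow> G p u u > 0)) \<and>
     (\<forall>(W :: (real^'m) set) \<psi>. local_param M W \<psi> \<longrightarrow>
        (\<forall>i j. smooth_on W (\<lambda>x. gram G \<psi> x $ i $ j)))"

definition christoffel ::
  "'a::euclidean_space metric \<Rightarrow> (real^'m::finite \<Rightarrow> 'a) \<Rightarrow> 'm \<Rightarrow> 'm \<Rightarrow> 'm \<Rightarrow> real^'m \<Rightarrow> real" where
  "christoffel G \<psi> k i j x =
     1/2 * (\<Sum>l\<in>UNIV. matrix_inv (gram G \<psi> x) $ k $ l *
       (pd i (\<lambda>y. gram G \<psi> y $ j $ l) x + pd j (\<lambda>y. gram G \<psi> y $ i $ l) x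
        - pd l (\<lambda>y. gram G \<psi> y $ i $ j) x))"

text \<open>The Laplace-Beltrami operator, i.e. the \<open>G\<close>-trace of the Hessian
  \<open>\<nabla>df\<close>, in the coordinates given by \<open>\<psi>\<close>.\<close>

definition laplacian ::
  "'a::euclidean_space metric \<Rightarrow> (real^'m::finite \<Rightarrow> 'a) \<Rightarrow> ('a \<Rightarrow> real) \<Rightarrow> real^'m \<Rightarrow> real" where
  "laplacian G \<psi> f x =
     (\<Sum>i\<in>UNIV. \<Sum>j\<in>UNIV. matrix_inv (gram G \<psi> x) $ i $ j *
       (pd i (pd j (f \<circ> \<psi>)) x - (\<Sum>k\<in>UNIV. christoffel G \<psi> k i j x * pd k (f \<circ> \<psi>) x)))"

definition smooth_on_manifold ::
  "'m::finite itself \<Rightarrow> 'a::euclidean_space set \<Rightarrow> 'a set \<Rightarrow> ('a \<Rightarrow> 'b::real_normed_vector) \<Rightarrow> bool" where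
  "smooth_on_manifold TYPE('m) M V f \<longleftrightarrow>
     (\<forall>(W :: (real^'m) set) \<psi>. local_param M W \<psi> \<and> \<psi> ` W \<subseteq> V \<longrightarrow> smooth_on W (f \<circ> \<psi>))"

definition harmonic_on ::
  "'m::finite itself \<Rightarrow> 'a::euclidean_space set \<Rightarrow> 'a metric \<Rightarrow> 'a set \<Rightarrow> ('a \<Rightarrow> real) \<Rightarrow> bool" where
  "harmonic_on TYPE('m) M G V f \<longleftrightarrow>
     smooth_on_manifold TYPE('m) M V f \<and>
     (\<forall>(W :: (real^'m) set) \<psi>. local_param M W \<psi> \<and> \<psi> ` W \<subseteq> V \<longrightarrow>
        (\<forall>x\<in>W. laplacian G \<psi> f x = 0))"

definition harmonic_morphism ::
  "'m::finite itself \<Rightarrow> 'a::euclidean_space set \<Rightarrow> 'a metric \<Rightarrow>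
   'k::finite itself \<Rightarrow> 'b::euclidean_space set \<Rightarrow> 'b metric \<Rightarrow> ('a \<Rightarrow> 'b) \<Rightarrow> bool" where
  "harmonic_morphism TYPE('m) M G TYPE('k) N h \<phi> \<longleftrightarrow>
     riemannian_manifold TYPE('m) M G \<and> riemannian_manifold TYPE('k) N h \<and>
     \<phi> ` M \<subseteq> N \<and> smooth_on_manifold TYPE('m) M M \<phi> \<and>
     (\<forall>U f. openin (top_of_set N) U \<and> M \<inter> \<phi> -` U \<noteq> {} \<and> harmonic_on TYPE('k) N h U f \<longrightarrow>
        harmonic_on TYPE('m) M G (M \<inter> \<phi> -` U) (f \<circ> \<phi>))"

section \<open>Complex projective space as a space of projectors\<close>

text \<open>With \<open>n = CARD('n)\<close>, the \<open>n + 1\<close> homogeneous coordinates are indexed by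
  \<open>'n option\<close>.\<close>

type_synonym 'n cmat = "complex^('n option)^('n option)"

definition cscale :: "complex \<Rightarrow> complex^'n^'m \<Rightarrow> complex^'n^'m" (infixr "*\<^sub>M" 75) where
  "c *\<^sub>M A = (\<chi> i j. c * A $ i $ j)"

definition hermitian :: "complex^'n^'n \<Rightarrow> bool" where
  "hermitian A \<longleftrightarrow> (\<forall>i j. A $ i $ j = cnj (A $ j $ i))"

definition su :: "(complex^'n^'n) set" where
  "su = {u. (\<forall>i j. u $ i $ j = - cnj (u $ j $ i)) \<and> trace u = 0}"

text \<open>The Fubini-Study metric, \<open>1/2 trace (A B)\<close>, extended to all Hermitian matrices
  (on which the trace is real).  The factor \<open>1/2\<close> gives holomorphic sectional
  curvature 4 (for \<open>2 trace (A B)\<close> it would be 1); this is the normalization for which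
  Calabi's metric has \<open>a = sqrt (1 + 4 |X|^2)\<close>.\<close>

definition fs :: "complex^'n^'n \<Rightarrow> complex^'n^'n \<Rightarrow> real" where
  "fs A B = 1/2 * Re (trace (A ** B))"

definition CP :: "(('n::finite) cmat) set" where
  "CP = {A. hermitian A \<and> A ** A = A \<and> trace A = 1}"

definition Jc :: "complex^'n^'n \<Rightarrow> complex^'n^'n \<Rightarrow> complex^'n^'n" where
  "Jc A X = \<i> *\<^sub>M ((mat 1 - 2 *\<^sub>R A) ** X)"

definition TCP :: "(('n::finite) cmat \<times> 'n cmat) set" where
  "TCP = {(A, X). A \<in> CP \<and> X \<in> tangent_space CP A}"

definition vlift :: "('n::finite) cmat \<times> 'n cmat \<Rightarrow> 'n cmat \<Rightarrow> 'n cmat \<times> 'n cmat" where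
  "vlift p Y = (0, Y)"

definition hlift :: "('n::finite) cmat \<times> 'n cmat \<Rightarrow> 'n cmat \<Rightarrow> 'n cmat \<times> 'n cmat" where
  "hlift p Y = (case p of (A, X) \<Rightarrow> (Y, \<i> *\<^sub>M (X ** Jc A Y - Jc A Y ** X)))"

section \<open>The Calabi metric\<close>

definition acoef :: "('n::finite) cmat \<Rightarrow> real" where
  "acoef X = sqrt (1 + 4 * fs X X)"

definition fibre_form :: "('n::finite) cmat \<times> 'n cmat \<Rightarrow> 'n cmat \<Rightarrow> 'n cmat \<Rightarrow> real" where
  "fibre_form p U V = (case p of (A, X) \<Rightarrow>
     fs U X * fs V X + fs U (Jc A X) * fs V (Jc A X))"

text \<open>On the zero section \<open>X = 0\<close> the quotients below are \<open>0\<close> by convention; they multiply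
  \<open>fibre_form\<close>, which vanishes there, and since \<open>a^2 - 1 = 4 |X|^2\<close> the products extend
  smoothly by \<open>0\<close>.

  Restricted to the span of \<open>X\<close> and \<open>J X\<close>, \<open>calabi_h\<close> is \<open>a\<close> times and \<open>calabi_v\<close> is
  \<open>1/a\<close> times \<open>fs\<close>; on its orthogonal complement they are \<open>(a + 1)/2\<close> and \<open>2/(a + 1)\<close>
  times \<open>fs\<close>.  That these factors are mutually inverse is what being hyper-Kaehler
  demands, and it forces the coefficient \<open>(a - 1)/(a (a + 1) |X|^2)\<close> in \<open>calabi_v\<close>;
  the variant with an additional \<open>2\<close> in this denominator is not Calabi's metric.\<close>

definition calabi_h :: "('n::finite) cmat \<times> 'n cmat \<Rightarrow> 'n cmat \<Rightarrow> 'n cmat \<Rightarrow> real" where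
  "calabi_h p U V = (let X = snd p; a = acoef X in
     (a + 1) / 2 * fs U V + (a - 1) / (2 * fs X X) * fibre_form p U V)"

definition calabi_v :: "('n::finite) cmat \<times> 'n cmat \<Rightarrow> 'n cmat \<Rightarrow> 'n cmat \<Rightarrow> real" where
  "calabi_v p U V = (let X = snd p; a = acoef X in
     2 / (a + 1) * fs U V - (a - 1) / (a * (a + 1) * fs X X) * fibre_form p U V)"

text \<open>A tangent vector \<open>\<xi>\<close> at \<open>p\<close> is the sum of the horizontal lift of \<open>fst \<xi>\<close> and the
  vertical lift of \<open>vpart p \<xi>\<close>.\<close>

definition vpart :: "('n::finite) cmat \<times> 'n cmat \<Rightarrow> 'n cmat \<times> 'n cmat \<Rightarrow> 'n cmat" where
  "vpart p \<xi> = snd \<xi> - snd (hlift p (fst \<xi>))"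

definition calabi :: "(('n::finite) cmat \<times> 'n cmat) metric" where
  "calabi p \<xi> \<eta> = calabi_h p (fst \<xi>) (fst \<eta>) + calabi_v p (vpart p \<xi>) (vpart p \<eta>)"

lemma lift_decomposition: "\<xi> = hlift p (fst \<xi>) + vlift p (vpart p \<xi>)"
  by (cases \<xi>) (simp add: hlift_def vlift_def vpart_def split: prod.splits)

lemma Jc_zero [simp]: "Jc A 0 = 0"
  by (simp add: Jc_def cscale_def vec_eq_iff)

lemma fs_zero [simp]: "fs 0 B = 0" "fs B 0 = 0"
  by (simp_all add: fs_def trace_def)

lemma vpart_lifts [simp]: "vpart p (hlift p U) = 0" "vpart p (vlift p U) = U"
  by (simp_all add: vpart_def hlift_def vlift_def cscale_def vec_eq_iff split: prod.splits)

lemma fst_lifts [simp]: "fst (hlift p U) = U" "fst (vlift p U) = 0"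
  by (simp_all add: hlift_def vlift_def split: prod.splits)

lemma calabi_lifts:
  "calabi p (hlift p U) (hlift p V) = calabi_h p U V"
  "calabi p (hlift p U) (vlift p V) = 0"
  "calabi p (vlift p U) (vlift p V) = calabi_v p U V"
  by (simp_all add: calabi_def calabi_h_def calabi_v_def fibre_form_def Let_def
      split: prod.splits)

end

theory Submission
  imports Defs
begin

text \<open>The three functions are the components of the hyper-Kaehler moment map of the Killing field
  generated by \<open>u\<close>, so their gradients are the images of one vector field under three
  anticommuting orthogonal complex structures; in particular the gradients are orthogonal and of
  equal length.  Two of these structures, \<open>cstr1\<close> and \<open>cstr2\<close>, suffice: they satisfy
  \<open>df\<^sub>2 = df\<^sub>3 \<circ> cstr1\<close> and \<open>df\<^sub>2 = df\<^sub>1 \<circ> cstr2\<close>, and their fundamental forms are the exterior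
  derivatives of the (negative) Liouville forms \<open>- g(X, dA)\<close> and \<open>- g(J X, dA)\<close>.  Hence \<open>f\<^sub>2, f\<^sub>3\<close> and
  \<open>f\<^sub>2, f\<^sub>1\<close> are the two components of holomorphic functions on almost Kaehler manifolds, which
  are harmonic: closedness of the fundamental form makes it coclosed.  All this can be checked in
  an arbitrary local parametrization, so no change of coordinates is needed.\<close>

section \<open>Calculus of smooth maps\<close>

text \<open>The tangent space at (A, X) is a sum of two copies of \<open>tang A\<close>, horizontal
  and vertical, on which the metric is given by operators P = \<open>Pop A X\<close> and Q =
  \<open>Qop A X\<close>. Everything rests on Q being the inverse of P and on both commuting with J:
  swaps of the two copies built from P and -Q square to -1, and in the fundamental forms P and Q
  cancel, so that \<open>a\<close> disappears from them. It returns in the second component, whose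
  coefficients are such that the horizontal derivative is given by P. Two obstacles shape the proof.
  The metric is written with divisions by |X|^2; since 4 |X|^2 = a^2 - 1, they become divisions by
  \<open>a\<close> and \<open>a + 1\<close>, smooth across the zero section. And fibre components of
  tangent vectors are ambient matrices with a part normal to \<open>CP\<close>: it pairs to zero
  with tangent vectors, but not with the fixed matrix defining the map, which calls for identities
  on products of two and three tangent matrices. Affine charts show that \<open>TCP\<close> is a
  submanifold and bound the dimension of its tangent spaces, so that every coordinate frame spans
  them.\<close>

lemma Ck_on_cong:
  assumes "open S" "\<And>x. x \<in> S \<Longrightarrow> f x = g x"
  shows "Ck_on k S f \<longleftrightarrow> Ck_on k S g"
  using assms(2)
proof (induction k arbitrary: f g)
  case 0
  then show ?case by (auto intro: continuous_on_cong)
next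
  case (Suc k)
  have D: "f differentiable (at x) \<longleftrightarrow> g differentiable (at x)" if "x \<in> S" for x
    unfolding differentiable_def
    using has_derivative_transform_within_open[OF _ \<open>open S\<close> that] Suc.prems by metis
  \<comment> \<open>\<open>frechet_derivative\<close> is a choice among the derivatives, and
    \<open>f\<close> and \<open>g\<close> have the same derivatives at points of the open set; so
    the choices agree even where no derivative exists.\<close>
  have F: "frechet_derivative f (at x) = frechet_derivative g (at x)"
    if "x \<in> S" for x
    unfolding frechet_derivative_def
    using has_derivative_transform_within_open[OF _ \<open>open S\<close> that] Suc.prems by metis
  have "Ck_on k S (\<lambda>x. frechet_derivative f (at x) v)
          \<longleftrightarrow> Ck_on k S (\<lambda>x. frechet_derivative g (at x) v)" for v
    by (rule Suc.IH) (simp add: F)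
  with D show ?case
    by (simp add: differentiable_on_eq_differentiable_at[OF \<open>open S\<close>])
qed

lemma Ck_on_SucI:
  assumes "open S" "\<And>x. x \<in> S \<Longrightarrow> (f has_derivative f' x) (at x)"
    "\<And>v. Ck_on k S (\<lambda>x. f' x v)"
  shows "Ck_on (Suc k) S f"
proof -
  have "frechet_derivative f (at x) = f' x" if "x \<in> S" for x
    using frechet_derivative_at[OF assms(2)[OF that]] by simp
  then have "Ck_on k S (\<lambda>x. frechet_derivative f (at x) v)" for v
    using assms(3)[of v] Ck_on_cong[OF assms(1), of "\<lambda>x. frechet_derivative f (at x) v" "\<lambda>x. f' x v"]
    by simp
  moreover have "f differentiable_on S"
    using assms by (auto simp: differentiable_on_eq_differentiable_at differentiable_def)
  ultimately show ?thesis by simp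
qed

lemma Ck_on_Suc_has_derivative:
  assumes "Ck_on (Suc k) S f" "open S" "x \<in> S"
  shows "(f has_derivative frechet_derivative f (at x)) (at x)"
  using assms by (simp add: differentiable_on_eq_differentiable_at frechet_derivative_works[symmetric])

lemma Ck_on_SucD: "Ck_on (Suc k) S f \<Longrightarrow> Ck_on k S f"
proof (induction k arbitrary: f)
  case 0
  then show ?case by (simp add: differentiable_imp_continuous_on)
next
  case (Suc k)
  then show ?case by (metis Ck_on.simps(2))
qed

lemma Ck_on_const: "open S \<Longrightarrow> Ck_on k S (\<lambda>x. c)"
proof (induction k arbitrary: c)
  case (Suc k)
  then show ?case by (intro Ck_on_SucI[where f' = "\<lambda>x v. 0"]) auto
qed auto

lemma Ck_on_bounded_linear:
  assumes "bounded_linear L" "open S" "Ck_on k S f"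
  shows "Ck_on k S (\<lambda>x. L (f x))"
  using assms(3)
proof (induction k arbitrary: f)
  case 0
  then show ?case using bounded_linear.continuous_on[OF assms(1)] by simp
next
  case (Suc k)
  show ?case
    by (rule Ck_on_SucI[OF \<open>open S\<close> bounded_linear.has_derivative[OF assms(1)
          Ck_on_Suc_has_derivative[OF Suc.prems \<open>open S\<close>]]])
      (use Suc in auto)
qed

lemma Ck_on_ident: "open S \<Longrightarrow> Ck_on k S (\<lambda>x. x)"
proof (induction k)
  case (Suc k)
  then show ?case by (intro Ck_on_SucI[where f' = "\<lambda>x v. v"]) (auto intro: Ck_on_const)
qed auto

lemma Ck_on_add:
  assumes "open S" "Ck_on k S f" "Ck_on k S g"
  shows "Ck_on k S (\<lambda>x. f x + g x)"
  using assms(2,3)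
proof (induction k arbitrary: f g)
  case 0
  then show ?case by (simp add: continuous_on_add)
next
  case (Suc k)
  show ?case
    by (rule Ck_on_SucI[OF \<open>open S\<close> has_derivative_add[OF
          Ck_on_Suc_has_derivative[OF Suc.prems(1) \<open>open S\<close>]
          Ck_on_Suc_has_derivative[OF Suc.prems(2) \<open>open S\<close>]]])
      (use Suc in auto)
qed

lemma Ck_on_sum:
  assumes "open S" "\<And>i. i \<in> I \<Longrightarrow> Ck_on k S (f i)"
  shows "Ck_on k S (\<lambda>x. \<Sum>i\<in>I. f i x)"
  using assms(2)
  by (induction I rule: infinite_finite_induct) (auto intro: Ck_on_add Ck_on_const assms(1))

lemma Ck_on_bilinear:
  assumes B: "bounded_bilinear B" and "open S" "Ck_on k S f" "Ck_on k S g"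
  shows "Ck_on k S (\<lambda>x. B (f x) (g x))"
  using assms(3,4)
proof (induction k arbitrary: f g)
  case 0
  then show ?case using bounded_bilinear.continuous_on[OF B] by simp
next
  case (Suc k)
  show ?case
    by (rule Ck_on_SucI[OF \<open>open S\<close> bounded_bilinear.FDERIV[OF B
          Ck_on_Suc_has_derivative[OF Suc.prems(1) \<open>open S\<close>]
          Ck_on_Suc_has_derivative[OF Suc.prems(2) \<open>open S\<close>]]])
      (use Suc Ck_on_SucD[OF Suc.prems(1)] Ck_on_SucD[OF Suc.prems(2)] in
        \<open>auto intro!: Ck_on_add \<open>open S\<close>\<close>)
qed

text \<open>In the chain rule the direction fed to the derivative of \<open>g\<close> varies with
  \<open>x\<close>, whereas \<open>Ck_on\<close> speaks of fixed directions. Expanding in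
  \<open>Basis\<close> moves the variation into scalar coefficients.\<close>

lemma Ck_on_compose:
  fixes f :: "'a::euclidean_space \<Rightarrow> 'b::euclidean_space"
  assumes "open S" "open T" "f ` S \<subseteq> T" "Ck_on k T g" "Ck_on k S f"
  shows "Ck_on k S (\<lambda>x. g (f x))"
  using assms(4,5)
proof (induction k arbitrary: g)
  case 0
  then show ?case using assms(3) continuous_on_compose2 by (metis Ck_on.simps(1))
next
  case (Suc k)
  have Dg: "(g has_derivative frechet_derivative g (at (f x))) (at (f x))" if "x \<in> S" for x
    using Ck_on_Suc_has_derivative[OF Suc.prems(1) \<open>open T\<close>] that assms(3) by blast
  have Df: "(f has_derivative frechet_derivative f (at x)) (at x)" if "x \<in> S" for x
    using Ck_on_Suc_has_derivative[OF Suc.prems(2) \<open>open S\<close> that] .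
  have eq: "frechet_derivative g (at (f x)) (frechet_derivative f (at x) v) =
      (\<Sum>b\<in>Basis. (frechet_derivative f (at x) v \<bullet> b) *\<^sub>R frechet_derivative g (at (f x)) b)"
    if "x \<in> S" for x v
    by (subst euclidean_representation[of "frechet_derivative f (at x) v", symmetric],
        subst linear_sum[OF has_derivative_linear[OF Dg[OF that]]])
      (simp add: linear_cmul[OF has_derivative_linear[OF Dg[OF that]]])
  have "Ck_on k S (\<lambda>x. \<Sum>b\<in>Basis. (frechet_derivative f (at x) v \<bullet> b) *\<^sub>R
      frechet_derivative g (at (f x)) b)" for v
    by (intro Ck_on_sum \<open>open S\<close> Ck_on_bilinear[OF bounded_bilinear_scaleR]
        Ck_on_bounded_linear[OF bounded_linear_inner_left] Suc.IH)
      (use Suc.prems Ck_on_SucD in auto)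
  then have "Ck_on k S (\<lambda>x. frechet_derivative g (at (f x)) (frechet_derivative f (at x) v))" for v
    using Ck_on_cong[OF \<open>open S\<close> eq] by simp
  then show ?case
    by (intro Ck_on_SucI[OF \<open>open S\<close>]) (auto intro!: has_derivative_compose[OF Df Dg])
qed

text \<open>Real powers are closed under differentiation up to constants, so one induction serves
  both the inverse (exponent -1) and the square root (exponent 1/2).\<close>

lemma Ck_on_powr: "Ck_on k {0<..} (\<lambda>x::real. x powr r)"
proof (induction k arbitrary: r)
  case 0
  then show ?case by (auto intro!: continuous_intros)
next
  case (Suc k)
  show ?case
    by (rule Ck_on_SucI[where f' = "\<lambda>x. (*) (r * x powr (r - 1))"])
      (auto intro!: has_field_derivative_imp_has_derivative has_real_derivative_powr
        Ck_on_bounded_linear[OF bounded_linear_mult_left]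
        Ck_on_bounded_linear[OF bounded_linear_mult_right] Suc)
qed

section \<open>Closure rules for smooth maps\<close>

lemma smooth_on_open: "smooth_on S f \<Longrightarrow> open S"
  by (simp add: smooth_on_def)

lemma smooth_on_Ck: "smooth_on S f \<Longrightarrow> Ck_on k S f"
  by (simp add: smooth_on_def)

lemma smooth_on_cong:
  assumes "smooth_on S g" "\<And>x. x \<in> S \<Longrightarrow> f x = g x"
  shows "smooth_on S f"
  using assms Ck_on_cong[of S f g] by (auto simp: smooth_on_def)

lemma smooth_on_has_derivative:
  "smooth_on S f \<Longrightarrow> x \<in> S \<Longrightarrow> (f has_derivative frechet_derivative f (at x)) (at x)"
  using Ck_on_Suc_has_derivative smooth_on_def by blast

lemma smooth_on_frechet:
  "smooth_on S f \<Longrightarrow> smooth_on S (\<lambda>x. frechet_derivative f (at x) v)"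
  unfolding smooth_on_def using Ck_on.simps(2) by metis

lemma smooth_on_const: "open S \<Longrightarrow> smooth_on S (\<lambda>x. c)"
  by (simp add: smooth_on_def Ck_on_const)

lemma smooth_on_ident: "open S \<Longrightarrow> smooth_on S (\<lambda>x. x)"
  by (simp add: smooth_on_def Ck_on_ident)

lemma smooth_on_bounded_linear:
  "bounded_linear L \<Longrightarrow> smooth_on S f \<Longrightarrow> smooth_on S (\<lambda>x. L (f x))"
  by (simp add: smooth_on_def Ck_on_bounded_linear)

lemma smooth_on_bilinear:
  "bounded_bilinear B \<Longrightarrow> smooth_on S f \<Longrightarrow> smooth_on S g \<Longrightarrow> smooth_on S (\<lambda>x. B (f x) (g x))"
  by (simp add: smooth_on_def Ck_on_bilinear)

lemma smooth_on_add: "smooth_on S f \<Longrightarrow> smooth_on S g \<Longrightarrow> smooth_on S (\<lambda>x. f x + g x)"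
  by (simp add: smooth_on_def Ck_on_add)

lemma smooth_on_minus: "smooth_on S f \<Longrightarrow> smooth_on S (\<lambda>x. - f x)"
  by (rule smooth_on_bounded_linear[OF bounded_linear_minus[OF bounded_linear_ident]])

lemma smooth_on_diff: "smooth_on S f \<Longrightarrow> smooth_on S g \<Longrightarrow> smooth_on S (\<lambda>x. f x - g x)"
  using smooth_on_add[OF _ smooth_on_minus, of S f g] by simp

lemma smooth_on_sum:
  "open S \<Longrightarrow> (\<And>i. i \<in> I \<Longrightarrow> smooth_on S (f i)) \<Longrightarrow> smooth_on S (\<lambda>x. \<Sum>i\<in>I. f i x)"
  by (simp add: smooth_on_def Ck_on_sum)

lemma smooth_on_compose:
  fixes f :: "'a::euclidean_space \<Rightarrow> 'b::euclidean_space"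
  assumes "smooth_on T g" "smooth_on S f" "f ` S \<subseteq> T"
  shows "smooth_on S (\<lambda>x. g (f x))"
  using assms by (auto simp: smooth_on_def intro: Ck_on_compose)

lemma smooth_on_powr:
  fixes f :: "'a::euclidean_space \<Rightarrow> real"
  assumes "smooth_on S f" "\<And>x. x \<in> S \<Longrightarrow> f x > 0"
  shows "smooth_on S (\<lambda>x. f x powr r)"
  by (rule smooth_on_compose[where T = "{0<..}"]) (use assms Ck_on_powr in \<open>auto simp: smooth_on_def\<close>)

lemma smooth_on_inverse:
  fixes f :: "'a::euclidean_space \<Rightarrow> real"
  assumes "smooth_on S f" "\<And>x. x \<in> S \<Longrightarrow> f x > 0"
  shows "smooth_on S (\<lambda>x. inverse (f x))"
  by (rule smooth_on_cong[OF smooth_on_powr[OF assms, of "-1"]])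
    (use assms(2) in \<open>auto simp: powr_minus less_imp_le\<close>)

lemma smooth_on_sqrt:
  fixes f :: "'a::euclidean_space \<Rightarrow> real"
  assumes "smooth_on S f" "\<And>x. x \<in> S \<Longrightarrow> f x > 0"
  shows "smooth_on S (\<lambda>x. sqrt (f x))"
  by (rule smooth_on_cong[OF smooth_on_powr[OF assms, of "1/2"]])
    (use assms(2) in \<open>auto simp: powr_half_sqrt less_imp_le\<close>)

lemma smooth_on_vec:
  fixes f :: "'a::euclidean_space \<Rightarrow> 'b::real_normed_vector^'n"
  assumes "open S" "\<And>i. smooth_on S (\<lambda>x. f x $ i)"
  shows "smooth_on S f"
proof -
  have "bounded_linear (axis i :: 'b \<Rightarrow> 'b^'n)" for i
    by (rule bounded_linear_intro[where K = 1]) (auto simp: axis_def vec_eq_iff norm_vec_def L2_set_def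
          if_distrib[of norm] if_distrib[of "\<lambda>x. x\<^sup>2"] cong: if_cong)
  then have "smooth_on S (\<lambda>x. \<Sum>i\<in>UNIV. axis i (f x $ i))"
    using assms by (intro smooth_on_sum) (auto intro: smooth_on_bounded_linear)
  moreover have "f = (\<lambda>x. \<Sum>i\<in>UNIV. axis i (f x $ i))"
    by (auto simp: vec_eq_iff axis_def if_distrib cong: if_cong)
  ultimately show ?thesis by simp
qed

lemma smooth_on_Pair:
  assumes "smooth_on S f" "smooth_on S g"
  shows "smooth_on S (\<lambda>x. (f x, g x))"
proof -
  have "smooth_on S (\<lambda>x. (f x, 0) + (0, g x))"
    using assms by (intro smooth_on_add smooth_on_bounded_linear[where L = "\<lambda>y. (y, 0)"]
       smooth_on_bounded_linear[where L = "\<lambda>y. (0, y)"])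
      (auto intro!: bounded_linear_Pair)
  then show ?thesis by simp
qed

lemmas smooth_on_mult = smooth_on_bilinear[OF bounded_bilinear_mult]
lemmas smooth_on_scaleR = smooth_on_bilinear[OF bounded_bilinear_scaleR]
lemmas smooth_on_nth = smooth_on_bounded_linear[OF bounded_linear_vec_nth]
lemmas smooth_on_fst = smooth_on_bounded_linear[OF bounded_linear_fst]
lemmas smooth_on_snd = smooth_on_bounded_linear[OF bounded_linear_snd]

section \<open>Partial derivatives and inverse matrices\<close>

text \<open>Mean value theorem for the increment in direction \<open>v\<close>, regarded as a
  function of the step along \<open>u\<close>, followed by linearization of the
  \<open>u\<close>-derivative at \<open>x\<close>. The quotient is symmetric in \<open>u\<close> and
  \<open>v\<close>, so uniqueness of limits yields the symmetry of second derivatives.\<close>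

lemma second_difference_tendsto:
  fixes f g :: "'a::real_normed_vector \<Rightarrow> real"
  assumes "open W" "x \<in> W" and f: "\<And>y. y \<in> W \<Longrightarrow> (f has_derivative f' y) (at y)"
    and g: "((\<lambda>y. f' y u) has_derivative g') (at x)"
  shows "((\<lambda>h. (f (x + h *\<^sub>R u + h *\<^sub>R v) - f (x + h *\<^sub>R u) - f (x + h *\<^sub>R v) + f x) / h\<^sup>2)
           \<longlongrightarrow> g' v) (at_right 0)"
proof (rule tendstoI)
  fix e :: real assume "e > 0"
  obtain r where r: "r > 0" "ball x r \<subseteq> W"
    using assms(1,2) openE by blast
  define K where "K = norm u + norm v + 1"
  have K: "K > 0" by (simp add: K_def add_nonneg_pos)
  \<comment> \<open>The linearization error is met at two points, each time at most
    \<open>e' * (h * K)\<close>; division by \<open>h\<close> leaves \<open>2 * e' * K\<close>,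
    which is half of \<open>e\<close>.\<close>
  define e' where "e' = e / (4 * K)"
  have e': "e' > 0" using \<open>e > 0\<close> K by (simp add: e'_def)
  have lin: "bounded_linear g'" using g has_derivative_bounded_linear by blast
  obtain d where d: "d > 0" "\<And>y. norm (y - x) < d \<Longrightarrow>
      norm (f' y u - f' x u - g' (y - x)) \<le> e' * norm (y - x)"
    using g e' unfolding has_derivative_at_alt by blast
  have "\<forall>\<^sub>F h in at_right 0. h < min d r / K"
    using d(1) r(1) K by (intro eventually_at_right_less eventually_at_rightI[where b = "min d r / K"]) auto
  moreover have "\<forall>\<^sub>F h :: real in at_right 0. 0 < h"
    by (simp add: eventually_at_right_less)
  ultimately show "\<forall>\<^sub>F h in at_right 0. dist ((f (x + h *\<^sub>R u + h *\<^sub>R v) - f (x + h *\<^sub>R u)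
      - f (x + h *\<^sub>R v) + f x) / h\<^sup>2) (g' v) < e"
  proof eventually_elim
    case (elim h)
    have hK: "h * K < min d r" using elim K by (simp add: field_simps)
    have near: "norm (t *\<^sub>R u + s *\<^sub>R v) < min d r" "norm (t *\<^sub>R u + s *\<^sub>R v) \<le> h * K"
      if "0 \<le> t" "t \<le> h" "0 \<le> s" "s \<le> h" for t s
    proof -
      have "norm (t *\<^sub>R u + s *\<^sub>R v) \<le> t * norm u + s * norm v"
        using that norm_triangle_ineq[of "t *\<^sub>R u" "s *\<^sub>R v"] by simp
      also have "\<dots> \<le> h * norm u + h * norm v"
        using that by (intro add_mono mult_right_mono) auto
      also have "\<dots> \<le> h * K" using elim by (simp add: K_def algebra_simps)
      finally show "norm (t *\<^sub>R u + s *\<^sub>R v) \<le> h * K" .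
      then show "norm (t *\<^sub>R u + s *\<^sub>R v) < min d r" using hK by simp
    qed
    have inW: "x + t *\<^sub>R u + s *\<^sub>R v \<in> W" if "0 \<le> t" "t \<le> h" "0 \<le> s" "s \<le> h" for t s
    proof -
      have "dist (x + (t *\<^sub>R u + s *\<^sub>R v)) x < r"
        using near(1)[OF that] by (simp add: dist_norm)
      then show ?thesis using r(2) by (auto simp: add.assoc dist_commute)
    qed
    \<comment> \<open>The summand \<open>0 *\<^sub>R v\<close> is kept so that both terms are
      instances, with s = h and s = 0, of the derivative computed below.\<close>
    define p where "p t = f (x + t *\<^sub>R u + h *\<^sub>R v) - f (x + t *\<^sub>R u + 0 *\<^sub>R v)" for t
    have der: "(p has_real_derivative f' (x + t *\<^sub>R u + h *\<^sub>R v) u - f' (x + t *\<^sub>R u + 0 *\<^sub>R v) u) (at t)"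
      if "0 \<le> t" "t \<le> h" for t
    proof -
      have 1: "((\<lambda>t. f (x + t *\<^sub>R u + s *\<^sub>R v)) has_derivative (\<lambda>k. f' (x + t *\<^sub>R u + s *\<^sub>R v) (k *\<^sub>R u))) (at t)"
        if s: "0 \<le> s" "s \<le> h" for s
        by (rule has_derivative_compose[of "\<lambda>t. x + t *\<^sub>R u + s *\<^sub>R v", OF _ f])
          (use inW \<open>0 \<le> t\<close> \<open>t \<le> h\<close> s in \<open>auto intro!: derivative_eq_intros\<close>)
      have 2: "f' (x + t *\<^sub>R u + s *\<^sub>R v) (k *\<^sub>R u) = k * f' (x + t *\<^sub>R u + s *\<^sub>R v) u"
        if s: "0 \<le> s" "s \<le> h" for s k
        using linear_cmul[OF has_derivative_linear[OF f[OF inW[OF \<open>0 \<le> t\<close> \<open>t \<le> h\<close> s]]]] by simp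
      have "0 \<le> h" using elim by simp
      show ?thesis
        unfolding p_def has_field_derivative_def
        by (rule has_derivative_eq_rhs[OF has_derivative_diff[OF 1[OF \<open>0 \<le> h\<close> order_refl]
                1[OF order_refl \<open>0 \<le> h\<close>]]])
          (rule ext, simp only: left_diff_distrib 2[OF \<open>0 \<le> h\<close> order_refl] 2[OF order_refl \<open>0 \<le> h\<close>] right_diff_distrib mult.commute)
    qed
    have "\<exists>z>0. z < h \<and> p h - p 0 = (h - 0) * (f' (x + z *\<^sub>R u + h *\<^sub>R v) u - f' (x + z *\<^sub>R u + 0 *\<^sub>R v) u)"
      by (rule MVT2) (use der elim in auto)
    then obtain z where z: "0 < z" "z < h"
      "p h - p 0 = h * (f' (x + z *\<^sub>R u + h *\<^sub>R v) u - f' (x + z *\<^sub>R u + 0 *\<^sub>R v) u)" by auto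
    define R where "R s = f' (x + z *\<^sub>R u + s *\<^sub>R v) u - f' x u - g' (z *\<^sub>R u + s *\<^sub>R v)" for s
    have R: "\<bar>R s\<bar> \<le> e' * (h * K)" if "0 \<le> s" "s \<le> h" for s
    proof -
      have "\<bar>R s\<bar> \<le> e' * norm (z *\<^sub>R u + s *\<^sub>R v)"
        using d(2)[of "x + z *\<^sub>R u + s *\<^sub>R v"] near(1)[of z s] z that
        by (simp add: R_def add.assoc)
      also have "\<dots> \<le> e' * (h * K)"
        using near(2)[of z s] z that e' by (intro mult_left_mono) auto
      finally show ?thesis .
    qed
    have gz: "g' (z *\<^sub>R u + h *\<^sub>R v) - g' (z *\<^sub>R u + 0 *\<^sub>R v) = h * g' v"
      using linear_add[OF bounded_linear.linear[OF lin]] linear_cmul[OF bounded_linear.linear[OF lin]] by simp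
    have "f (x + h *\<^sub>R u + h *\<^sub>R v) - f (x + h *\<^sub>R u) - f (x + h *\<^sub>R v) + f x = p h - p 0"
      by (simp add: p_def)
    also have "\<dots> = h * (h * g' v + (R h - R 0))"
      using z(3) gz by (simp add: R_def algebra_simps)
    finally have eq: "f (x + h *\<^sub>R u + h *\<^sub>R v) - f (x + h *\<^sub>R u) - f (x + h *\<^sub>R v) + f x
      = h * (h * g' v + (R h - R 0))" .
    have "(f (x + h *\<^sub>R u + h *\<^sub>R v) - f (x + h *\<^sub>R u) - f (x + h *\<^sub>R v) + f x) / h\<^sup>2 - g' v
        = (R h - R 0) / h"
      unfolding eq using elim by (simp add: field_simps power2_eq_square)
    also have "\<bar>\<dots>\<bar> \<le> 2 * e' * K"
      using R[of h] R[of 0] elim by (simp add: field_simps abs_le_iff)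
    also have "\<dots> < e" using \<open>e > 0\<close> K by (simp add: e'_def)
    finally show ?case by (simp add: dist_real_def)
  qed
qed

lemma frechet_derivative_commute:
  fixes f :: "'a::euclidean_space \<Rightarrow> real"
  assumes "smooth_on W f" "x \<in> W"
  shows "frechet_derivative (\<lambda>y. frechet_derivative f (at y) u) (at x) v =
         frechet_derivative (\<lambda>y. frechet_derivative f (at y) v) (at x) u"
proof -
  note W = smooth_on_open[OF assms(1)]
  note lim = second_difference_tendsto[OF W assms(2) smooth_on_has_derivative[OF assms(1)]
      smooth_on_has_derivative[OF smooth_on_frechet[OF assms(1)] assms(2)]]
  have "f (x + h *\<^sub>R v + h *\<^sub>R u) = f (x + h *\<^sub>R u + h *\<^sub>R v)" for h
    by (simp add: add_ac)
  then have "(f (x + h *\<^sub>R v + h *\<^sub>R u) - f (x + h *\<^sub>R v) - f (x + h *\<^sub>R u) + f x) / h\<^sup>2 =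
      (f (x + h *\<^sub>R u + h *\<^sub>R v) - f (x + h *\<^sub>R u) - f (x + h *\<^sub>R v) + f x) / h\<^sup>2" for h
    by (intro arg_cong2[where f = "(/)"]) (auto simp: algebra_simps)
  then have L: "((\<lambda>h. (f (x + h *\<^sub>R u + h *\<^sub>R v) - f (x + h *\<^sub>R u) - f (x + h *\<^sub>R v) + f x) / h\<^sup>2)
      \<longlongrightarrow> frechet_derivative (\<lambda>y. frechet_derivative f (at y) v) (at x) u) (at_right 0)"
    by (intro Lim_transform_eventually[OF lim[of v u]] always_eventually allI)
  show ?thesis
    by (rule tendsto_unique[OF trivial_limit_at_right_real lim[of u v] L])
qed

section \<open>Rules for partial derivatives\<close>

lemma pd_eqI: "(f has_derivative D) (at x) \<Longrightarrow> pd i f x = D (axis i 1)"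
  using frechet_derivative_at by (fastforce simp: pd_def)

lemma smooth_on_pd: "smooth_on W f \<Longrightarrow> smooth_on W (pd i f)"
  unfolding pd_def[abs_def] by (rule smooth_on_frechet)

lemma pd_commute:
  fixes f :: "real^'m \<Rightarrow> real"
  shows "smooth_on W f \<Longrightarrow> x \<in> W \<Longrightarrow> pd i (pd j f) x = pd j (pd i f) x"
  using frechet_derivative_commute[of W f x "axis j 1" "axis i 1"] by (simp add: pd_def[abs_def])

lemma pd_cong:
  assumes "open W" "x \<in> W" "\<And>y. y \<in> W \<Longrightarrow> f y = g y"
  shows "pd i f x = pd i g x"
proof -
  have "frechet_derivative f (at x) = frechet_derivative g (at x)"
    unfolding frechet_derivative_def
    using has_derivative_transform_within_open[OF _ assms(1,2)] assms(3) by metis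
  then show ?thesis by (simp add: pd_def)
qed

lemma pd_const [simp]: "pd i (\<lambda>y. c) x = 0"
  by (simp add: pd_def)

lemma pd_add:
  "smooth_on W f \<Longrightarrow> smooth_on W g \<Longrightarrow> x \<in> W \<Longrightarrow> pd i (\<lambda>y. f y + g y) x = pd i f x + pd i g x"
  by (subst pd_eqI[OF has_derivative_add]) (auto intro: smooth_on_has_derivative simp: pd_def)

lemma pd_diff:
  "smooth_on W f \<Longrightarrow> smooth_on W g \<Longrightarrow> x \<in> W \<Longrightarrow> pd i (\<lambda>y. f y - g y) x = pd i f x - pd i g x"
  by (subst pd_eqI[OF has_derivative_diff]) (auto intro: smooth_on_has_derivative simp: pd_def)

lemma pd_uminus:
  "smooth_on W f \<Longrightarrow> x \<in> W \<Longrightarrow> pd i (\<lambda>y. - f y) x = - pd i f x"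
  by (subst pd_eqI[OF has_derivative_minus]) (auto intro: smooth_on_has_derivative simp: pd_def)

lemma pd_sum:
  "(\<And>k. k \<in> I \<Longrightarrow> smooth_on W (f k)) \<Longrightarrow> x \<in> W \<Longrightarrow> pd i (\<lambda>y. \<Sum>k\<in>I. f k y) x = (\<Sum>k\<in>I. pd i (f k) x)"
  by (subst pd_eqI[OF has_derivative_sum[OF smooth_on_has_derivative]]) (auto simp: pd_def)

lemma pd_bilinear:
  assumes "bounded_bilinear B" "smooth_on W f" "smooth_on W g" "x \<in> W"
  shows "pd i (\<lambda>y. B (f y) (g y)) x = B (pd i f x) (g x) + B (f x) (pd i g x)"
  by (subst pd_eqI[OF bounded_bilinear.FDERIV[OF assms(1)]])
    (auto intro: smooth_on_has_derivative assms simp: pd_def add.commute)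

lemmas pd_mult = pd_bilinear[OF bounded_bilinear_mult]

lemma pd_bounded_linear:
  "bounded_linear L \<Longrightarrow> smooth_on W f \<Longrightarrow> x \<in> W \<Longrightarrow> pd i (\<lambda>y. L (f y)) x = L (pd i f x)"
  by (subst pd_eqI[OF bounded_linear.has_derivative]) (auto intro: smooth_on_has_derivative simp: pd_def)

section \<open>Smooth dependence of determinants and inverse matrices\<close>

lemma smooth_on_prod:
  fixes f :: "'i \<Rightarrow> 'a::euclidean_space \<Rightarrow> real"
  shows "open S \<Longrightarrow> (\<And>i. i \<in> I \<Longrightarrow> smooth_on S (f i)) \<Longrightarrow> smooth_on S (\<lambda>x. \<Prod>i\<in>I. f i x)"
  by (induction I rule: infinite_finite_induct) (auto intro: smooth_on_mult smooth_on_const)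

lemma smooth_on_det:
  fixes F :: "'a::euclidean_space \<Rightarrow> real^'m^'m"
  assumes "open S" "\<And>i j. smooth_on S (\<lambda>x. F x $ i $ j)"
  shows "smooth_on S (\<lambda>x. det (F x))"
  unfolding det_def
  by (intro smooth_on_sum smooth_on_mult smooth_on_const smooth_on_prod assms)

lemma matrix_inv_inverse:
  assumes "invertible A"
  shows "A ** matrix_inv A = mat 1" "matrix_inv A ** A = mat 1"
  using someI_ex[OF assms[unfolded invertible_def]] unfolding matrix_inv_def by blast+

text \<open>Cramer's rule, wanted because it displays the entries of the inverse as quotients of
  polynomials in the entries of \<open>A\<close>.\<close>

lemma matrix_inv_entry:
  fixes A :: "real^'m^'m"
  assumes "invertible A"
  shows "matrix_inv A $ k $ l = det (\<chi> i j. if j = k then axis l 1 $ i else A $ i $ j) / det A"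
proof -
  have *: "A *v (matrix_inv A *v axis l 1) = axis l 1"
    using assms by (simp add: matrix_vector_mul_assoc matrix_inv_inverse)
  have "matrix_inv A *v axis l 1 =
      (\<chi> k. det (\<chi> i j. if j = k then axis l 1 $ i else A $ i $ j) / det A)"
    by (rule iffD1[OF cramer *]) (use assms in \<open>simp add: invertible_det_nz\<close>)
  moreover have "(matrix_inv A *v axis l 1) $ k = matrix_inv A $ k $ l"
    by (simp add: matrix_vector_mult_basis column_def)
  ultimately show ?thesis by simp
qed

lemma smooth_on_matrix_inv:
  fixes F :: "'a::euclidean_space \<Rightarrow> real^'m^'m"
  assumes "open S" and F: "\<And>i j. smooth_on S (\<lambda>x. F x $ i $ j)" and inv: "\<And>x. x \<in> S \<Longrightarrow> invertible (F x)"
  shows "smooth_on S (\<lambda>x. matrix_inv (F x) $ k $ l)"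
proof -
  have nz: "det (F x) \<noteq> 0" if "x \<in> S" for x using inv[OF that] by (simp add: invertible_det_nz)
  have d: "smooth_on S (\<lambda>x. det (F x))" by (rule smooth_on_det[OF assms(1) F])
  have n: "smooth_on S (\<lambda>x. det (\<chi> i j. if j = k then axis l 1 $ i else F x $ i $ j))"
  proof (rule smooth_on_det[OF assms(1)])
    show "smooth_on S (\<lambda>x. (\<chi> i j. if j = k then axis l 1 $ i else F x $ i $ j) $ i $ j)" for i j
      by (cases "j = k") (simp_all add: F smooth_on_const[OF assms(1)])
  qed
  \<comment> \<open>The determinant may be negative while \<open>smooth_on_inverse\<close> asks for
    positive values, so its reciprocal is written as determinant times inverse of the
    square.\<close>
  have "smooth_on S (\<lambda>x. det (\<chi> i j. if j = k then axis l 1 $ i else F x $ i $ j) *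
      (det (F x) * inverse (det (F x) * det (F x))))"
    by (intro smooth_on_mult n d smooth_on_inverse) (metis nz not_real_square_gt_zero)
  then show ?thesis
    by (rule smooth_on_cong) (use nz in \<open>simp add: matrix_inv_entry[OF inv] field_simps\<close>)
qed

section \<open>Almost Kaehler metrics in coordinates\<close>

definition pdm :: "'m::finite \<Rightarrow> (real^'m \<Rightarrow> real^'k^'l) \<Rightarrow> real^'m \<Rightarrow> real^'k^'l" where
  "pdm i F x = (\<chi> a b. pd i (\<lambda>y. F y $ a $ b) x)"

lemma pdm_nth [simp]: "pdm i F x $ a $ b = pd i (\<lambda>y. F y $ a $ b) x"
  by (simp add: pdm_def)

lemma pdm_matrix_mul:
  assumes "\<And>a b. smooth_on W (\<lambda>y. F y $ a $ b)" "\<And>a b. smooth_on W (\<lambda>y. H y $ a $ b)" "x \<in> W"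
  shows "pdm i (\<lambda>y. F y ** H y) x = pdm i F x ** H x + F x ** pdm i H x"
  by (simp add: vec_eq_iff matrix_matrix_mult_def pd_sum[where W = W] pd_mult[where W = W]
      smooth_on_mult assms sum.distrib)

lemma pdm_cong:
  assumes "open W" "x \<in> W" "\<And>y. y \<in> W \<Longrightarrow> F y = H y"
  shows "pdm i F x = pdm i H x"
  unfolding vec_eq_iff pdm_nth by (intro allI pd_cong[OF assms(1,2)]) (simp add: assms(3))

lemma smooth_on_matrix_mul:
  fixes F :: "'a::euclidean_space \<Rightarrow> real^'k^'l" and H :: "'a \<Rightarrow> real^'n^'k"
  assumes "open W" "\<And>a b. smooth_on W (\<lambda>y. F y $ a $ b)" "\<And>a b. smooth_on W (\<lambda>y. H y $ a $ b)"
  shows "smooth_on W (\<lambda>y. (F y ** H y) $ a $ b)"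
  by (simp add: matrix_matrix_mult_def smooth_on_sum smooth_on_mult assms)

lemma matrix_mul_minus_left: "(- A) ** B = - (A ** (B :: 'a::ring_1^'n^'m))"
  by (simp add: matrix_matrix_mult_def vec_eq_iff sum_negf)

lemma matrix_mul_minus_right: "A ** (- B) = - (A ** (B :: 'a::ring_1^'n^'m))"
  by (simp add: matrix_matrix_mult_def vec_eq_iff sum_negf)

lemma trace_uminus: "trace (- A) = - trace (A :: 'a::ring_1^'n^'n)"
  by (simp add: trace_def sum_negf)

lemma trace_mul_eq_sum: "trace (A ** B) = (\<Sum>i\<in>UNIV. \<Sum>j\<in>UNIV. A $ i $ j * B $ j $ i)"
  by (simp add: trace_def matrix_matrix_mult_def)

text \<open>Here \<open>g\<close> is a Gram matrix, row \<open>i\<close> of \<open>M\<close> holds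
  the image of the \<open>i\<close>-th frame vector under an almost complex structure, and
  \<open>w\<close> is the fundamental form, whose skewness expresses compatibility. The product
  \<open>B ** M\<close> is minus the inverse of \<open>w\<close>, a Poisson tensor up to sign; the
  last equation says that \<open>M\<close>, acting on covectors, preserves the dual metric
  \<open>B\<close>.\<close>

lemma almost_complex_algebra:
  fixes g w M :: "real^'m^'m"
  assumes inv: "invertible g" and w: "M ** g = w" and M: "M ** M = - mat 1"
    and gs: "transpose g = g" and ws: "transpose w = - w"
  defines "B \<equiv> matrix_inv g"
  shows "transpose B = B" "M = w ** B" "transpose (B ** M) = - (B ** M)"
    "(B ** M) ** w = - mat 1" "w ** (B ** M) = - mat 1" "g ** (B ** M) = M"
    "(B ** M) ** M = - B" "transpose M ** B = - (B ** M)" "transpose M ** B ** M = B"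
proof -
  have gB: "g ** B = mat 1" and Bg: "B ** g = mat 1"
    using matrix_inv_inverse[OF inv] by (simp_all add: B_def)
  have "transpose B ** g = mat 1"
    using arg_cong[OF gB, of transpose] gs by (simp add: matrix_transpose_mul)
  then show B: "transpose B = B"
    by (metis gB matrix_mul_assoc matrix_mul_lid matrix_mul_rid)
  show Mw: "M = w ** B"
    by (simp add: w[symmetric] matrix_mul_assoc[symmetric] gB)
  show Om: "transpose (B ** M) = - (B ** M)"
    by (simp add: Mw matrix_transpose_mul B ws matrix_mul_assoc matrix_mul_minus_left matrix_mul_minus_right)
  show "(B ** M) ** w = - mat 1"
    by (metis Bg M matrix_mul_assoc matrix_mul_lid matrix_mul_minus_left matrix_mul_minus_right w)
  show 3: "g ** (B ** M) = M" by (simp add: matrix_mul_assoc gB)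
  show "w ** (B ** M) = - mat 1"
    by (metis 3 M matrix_mul_assoc w)
  show 4: "(B ** M) ** M = - B"
    by (metis M matrix_mul_assoc matrix_mul_minus_right matrix_mul_rid)
  show 5: "transpose M ** B = - (B ** M)"
    using Om B by (simp add: matrix_transpose_mul)
  show "transpose M ** B ** M = B"
    by (simp add: 5 matrix_mul_minus_left 4)
qed

text \<open>The manifold is almost Kaehler near \<open>x\<close> with fundamental form the exterior derivative
  of \<open>\<alpha>\<close>, and \<open>f\<close> and \<open>h\<close> are the two components of a holomorphic function.\<close>

lemma almost_kaehler_laplacian_eq_0:
  fixes G :: "'a::euclidean_space metric" and \<psi> :: "real^'m \<Rightarrow> 'a"
    and M :: "real^'m \<Rightarrow> real^'m^'m" and \<alpha> :: "'m \<Rightarrow> real^'m \<Rightarrow> real"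
  assumes W: "open W" and g: "\<And>i j. smooth_on W (\<lambda>x. gram G \<psi> x $ i $ j)"
    and gs: "\<And>x. x \<in> W \<Longrightarrow> transpose (gram G \<psi> x) = gram G \<psi> x"
    and ginv: "\<And>x. x \<in> W \<Longrightarrow> invertible (gram G \<psi> x)"
    and \<alpha>: "\<And>j. smooth_on W (\<alpha> j)"
    and Mw: "\<And>x. x \<in> W \<Longrightarrow> M x ** gram G \<psi> x = (\<chi> i j. pd i (\<alpha> j) x - pd j (\<alpha> i) x)"
    and MM: "\<And>x. x \<in> W \<Longrightarrow> M x ** M x = - mat 1"
    and f: "smooth_on W (f \<circ> \<psi>)" and h: "smooth_on W (h \<circ> \<psi>)"
    and fh: "\<And>x i. x \<in> W \<Longrightarrow> pd i (f \<circ> \<psi>) x = (\<Sum>k\<in>UNIV. M x $ i $ k * pd k (h \<circ> \<psi>) x)"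
    and x: "x \<in> W"
  shows "laplacian G \<psi> f x = 0"
proof -
  define g where "g = gram G \<psi>"
  define u where "u k = pd k (f \<circ> \<psi>)" for k
  define v where "v k = pd k (h \<circ> \<psi>)" for k
  define B where "B y = matrix_inv (g y)" for y
  define w where "w y = (\<chi> i j. pd i (\<alpha> j) y - pd j (\<alpha> i) y)" for y
  define Om where "Om y = B y ** w y ** B y" for y
  \<comment> \<open>\<open>X\<close> is the gradient of \<open>f\<close> by \<open>ugX\<close> and
    \<open>BuX\<close>. Written through \<open>Om\<close>, it is up to sign the Hamiltonian vector
    field of \<open>h\<close>, so its divergence is controlled by closedness of
    \<open>w\<close>.\<close>
  define X where "X k y = (\<Sum>l\<in>UNIV. Om y $ k $ l * v l y)" for k y
  have gij: "smooth_on W (\<lambda>y. g y $ i $ j)" for i j using g by (simp add: g_def)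
  have Bij: "smooth_on W (\<lambda>y. B y $ i $ j)" for i j
    unfolding B_def by (rule smooth_on_matrix_inv[OF W gij]) (simp add: g_def ginv)
  have wij: "smooth_on W (\<lambda>y. w y $ i $ j)" for i j
    by (simp add: w_def smooth_on_diff smooth_on_pd \<alpha>)
  have Omij: "smooth_on W (\<lambda>y. Om y $ i $ j)" for i j
    unfolding Om_def by (intro smooth_on_matrix_mul W Bij wij)
  have us: "smooth_on W (u k)" for k unfolding u_def by (rule smooth_on_pd[OF f])
  have vs: "smooth_on W (v k)" for k unfolding v_def by (rule smooth_on_pd[OF h])
  have Xs: "smooth_on W (X k)" for k
    unfolding X_def[abs_def] by (intro smooth_on_sum smooth_on_mult W Omij vs)
  have ws: "transpose (w y) = - w y" for y
    by (simp add: w_def transpose_def vec_eq_iff)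
  have alg: "transpose (B y) = B y" "M y = w y ** B y" "Om y = B y ** M y"
    "transpose (Om y) = - Om y" "Om y ** w y = - mat 1" "w y ** Om y = - mat 1"
    "g y ** Om y = M y" "Om y ** M y = - B y" if "y \<in> W" for y
  proof -
    note a = almost_complex_algebra[of "g y" "M y" "w y", folded B_def]
    note a = a[OF _ _ MM[OF that] _ ws]
    have h: "invertible (g y)" "M y ** g y = w y" "transpose (g y) = g y"
      using that by (simp_all add: g_def ginv Mw gs w_def)
    show "transpose (B y) = B y" using a(1)[OF h] .
    show Mw: "M y = w y ** B y" using a(2)[OF h] .
    then show Om: "Om y = B y ** M y" by (simp add: Om_def matrix_mul_assoc)
    show "transpose (Om y) = - Om y" "Om y ** w y = - mat 1" "w y ** Om y = - mat 1"
      "g y ** Om y = M y" "Om y ** M y = - B y"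
      unfolding Om using a(3-7)[OF h] by auto
  qed
  have ugX: "u i y = (\<Sum>k\<in>UNIV. g y $ i $ k * X k y)" if "y \<in> W" for i y
  proof -
    have "u i y = (\<Sum>l\<in>UNIV. (g y ** Om y) $ i $ l * v l y)"
      using fh[OF that] alg(7)[OF that] by (simp add: u_def v_def)
    also have "\<dots> = (\<Sum>k\<in>UNIV. g y $ i $ k * X k y)"
      by (simp add: X_def matrix_matrix_mult_def sum_distrib_left sum_distrib_right mult.assoc)
        (rule sum.swap)
    finally show ?thesis .
  qed
  have BuX: "X k x = (\<Sum>l\<in>UNIV. B x $ k $ l * u l x)" for k
  proof -
    have "(\<Sum>l\<in>UNIV. B x $ k $ l * u l x) = (\<Sum>l\<in>UNIV. \<Sum>m\<in>UNIV. B x $ k $ l * g x $ l $ m * X m x)"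
      by (simp add: ugX[OF x] sum_distrib_left mult.assoc)
    also have "\<dots> = (\<Sum>m\<in>UNIV. (B x ** g x) $ k $ m * X m x)"
      by (subst sum.swap) (simp add: matrix_matrix_mult_def sum_distrib_right)
    also have "\<dots> = X k x"
      using matrix_inv_inverse(2)[OF ginv[OF x]]
      by (simp add: B_def g_def mat_def if_distrib[of "\<lambda>a. a * _"] cong: if_cong)
    finally show ?thesis by simp
  qed
  define dg where "dg i a b = pd i (\<lambda>y. g y $ a $ b) x" for i a b
  define dw where "dw i a b = pd i (\<lambda>y. w y $ a $ b) x" for i a b
  define dO where "dO i a b = pd i (\<lambda>y. Om y $ a $ b) x" for i a b
  define dX where "dX i k = pd i (X k) x" for i k
  \<comment> \<open>The logarithmic derivative of the determinant of \<open>g\<close>. The facts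
    \<open>hess\<close> and \<open>chr\<close> together give the usual formula: the Laplacian is the
    divergence of \<open>X\<close> plus half the contraction of \<open>T\<close> with
    \<open>X\<close>.\<close>
  define T where "T l = (\<Sum>i\<in>UNIV. \<Sum>j\<in>UNIV. B x $ i $ j * dg l i j)" for l
  have Bs: "B x $ i $ j = B x $ j $ i" for i j
    using arg_cong[OF alg(1)[OF x], of "\<lambda>A. A $ i $ j"] by (simp add: transpose_def)
  have Oms: "Om x $ i $ j = - Om x $ j $ i" for i j
    using arg_cong[OF alg(4)[OF x], of "\<lambda>A. A $ j $ i"] by (simp add: transpose_def)

  have pdu: "pd i (u j) x = (\<Sum>k\<in>UNIV. dg i j k * X k x + g x $ j $ k * dX i k)" for i j
  proof -
    have "pd i (u j) x = pd i (\<lambda>y. \<Sum>k\<in>UNIV. g y $ j $ k * X k y) x"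
      by (rule pd_cong[OF W x ugX])
    also have "\<dots> = (\<Sum>k\<in>UNIV. dg i j k * X k x + g x $ j $ k * dX i k)"
      by (simp add: pd_sum[where W = W] pd_mult[where W = W] smooth_on_mult gij Xs x dg_def dX_def)
    finally show ?thesis .
  qed
  have hess: "(\<Sum>i\<in>UNIV. \<Sum>j\<in>UNIV. B x $ i $ j * pd i (u j) x) =
     (\<Sum>i\<in>UNIV. \<Sum>j\<in>UNIV. \<Sum>k\<in>UNIV. B x $ i $ j * dg i j k * X k x) + (\<Sum>i\<in>UNIV. dX i i)"
  proof -
    have "(\<Sum>j\<in>UNIV. \<Sum>k\<in>UNIV. B x $ i $ j * (g x $ j $ k * dX i k)) = dX i i" for i
    proof -
      have "(\<Sum>j\<in>UNIV. \<Sum>k\<in>UNIV. B x $ i $ j * (g x $ j $ k * dX i k)) =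
        (\<Sum>k\<in>UNIV. (B x ** g x) $ i $ k * dX i k)"
        by (subst sum.swap) (simp add: matrix_matrix_mult_def sum_distrib_right mult.assoc)
      also have "\<dots> = dX i i"
        using matrix_inv_inverse(2)[OF ginv[OF x]]
        by (simp add: B_def g_def mat_def if_distrib[of "\<lambda>a. a * _"] cong: if_cong)
      finally show ?thesis .
    qed
    then show ?thesis
      by (simp add: pdu sum_distrib_left distrib_left sum.distrib mult.assoc)
  qed
  have chr: "(\<Sum>i\<in>UNIV. \<Sum>j\<in>UNIV. B x $ i $ j * (\<Sum>k\<in>UNIV. christoffel G \<psi> k i j x * u k x)) =
     (\<Sum>i\<in>UNIV. \<Sum>j\<in>UNIV. \<Sum>k\<in>UNIV. B x $ i $ j * dg i j k * X k x) - 1/2 * (\<Sum>l\<in>UNIV. T l * X l x)"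
  proof -
    have c: "(\<Sum>k\<in>UNIV. christoffel G \<psi> k i j x * u k x) =
        1/2 * (\<Sum>l\<in>UNIV. (dg i j l + dg j i l - dg l i j) * X l x)" for i j
    proof -
      have "(\<Sum>k\<in>UNIV. christoffel G \<psi> k i j x * u k x) =
        1/2 * (\<Sum>k\<in>UNIV. \<Sum>l\<in>UNIV. (dg i j l + dg j i l - dg l i j) * (B x $ l $ k * u k x))"
        by (simp add: christoffel_def g_def[symmetric] B_def[symmetric] dg_def sum_distrib_left
            sum_distrib_right Bs[of _ "_"] algebra_simps)
      also have "\<dots> = 1/2 * (\<Sum>l\<in>UNIV. (dg i j l + dg j i l - dg l i j) * X l x)"
        by (subst sum.swap) (simp add: BuX sum_distrib_left)
      finally show ?thesis .
    qed
    have s: "(\<Sum>i\<in>UNIV. \<Sum>j\<in>UNIV. \<Sum>l\<in>UNIV. B x $ i $ j * dg j i l * X l x) =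
          (\<Sum>i\<in>UNIV. \<Sum>j\<in>UNIV. \<Sum>l\<in>UNIV. B x $ i $ j * dg i j l * X l x)"
      by (subst sum.swap) (simp add: Bs)
    have t: "(\<Sum>i\<in>UNIV. \<Sum>j\<in>UNIV. \<Sum>l\<in>UNIV. B x $ i $ j * dg l i j * X l x) = (\<Sum>l\<in>UNIV. T l * X l x)"
    proof -
      have "(\<Sum>i\<in>UNIV. \<Sum>j\<in>UNIV. \<Sum>l\<in>UNIV. B x $ i $ j * dg l i j * X l x) =
         (\<Sum>i\<in>UNIV. \<Sum>l\<in>UNIV. \<Sum>j\<in>UNIV. B x $ i $ j * dg l i j * X l x)"
        by (intro sum.cong refl sum.swap)
      also have "\<dots> = (\<Sum>l\<in>UNIV. \<Sum>i\<in>UNIV. \<Sum>j\<in>UNIV. B x $ i $ j * dg l i j * X l x)"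
        by (rule sum.swap)
      finally show ?thesis by (simp add: T_def sum_distrib_right)
    qed
    have "(\<Sum>i\<in>UNIV. \<Sum>j\<in>UNIV. B x $ i $ j * (\<Sum>k\<in>UNIV. christoffel G \<psi> k i j x * u k x)) =
       1/2 * ((\<Sum>i\<in>UNIV. \<Sum>j\<in>UNIV. \<Sum>l\<in>UNIV. B x $ i $ j * dg i j l * X l x) +
         (\<Sum>i\<in>UNIV. \<Sum>j\<in>UNIV. \<Sum>l\<in>UNIV. B x $ i $ j * dg j i l * X l x) -
         (\<Sum>i\<in>UNIV. \<Sum>j\<in>UNIV. \<Sum>l\<in>UNIV. B x $ i $ j * dg l i j * X l x))"
      unfolding c
      by (simp add: sum_distrib_left sum.distrib[symmetric] sum_subtractf[symmetric] algebra_simps)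
    then show ?thesis unfolding s t by simp
  qed
  \<comment> \<open>The term with second derivatives of \<open>h\<close> vanishes: it contracts the
    skew matrix \<open>Om\<close> with a symmetric one.\<close>
  have divX: "(\<Sum>i\<in>UNIV. dX i i) = (\<Sum>i\<in>UNIV. \<Sum>l\<in>UNIV. dO i i l * v l x)"
  proof -
    have "dX i i = (\<Sum>l\<in>UNIV. dO i i l * v l x + Om x $ i $ l * pd i (v l) x)" for i
      by (simp add: dX_def X_def[abs_def] pd_sum[where W = W] pd_mult[where W = W] smooth_on_mult
          Omij vs x dO_def)
    moreover have "(\<Sum>i\<in>UNIV. \<Sum>l\<in>UNIV. Om x $ i $ l * pd i (v l) x) = 0" (is "?S = 0")
    proof -
      have "?S = (\<Sum>i\<in>UNIV. \<Sum>l\<in>UNIV. Om x $ l $ i * pd l (v i) x)"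
        by (rule sum.swap)
      also have "\<dots> = - ?S"
        unfolding v_def pd_commute[OF h x, of _ _] sum_negf[symmetric]
        by (intro sum.cong refl) (metis Oms pd_commute[OF h x] mult_minus_left)
      finally show ?thesis by simp
    qed
    ultimately show ?thesis by (simp add: sum.distrib)
  qed
  \<comment> \<open>Obtained by differentiating \<open>Om ** w = - mat 1\<close>.\<close>
  have dOm: "pdm i Om x = Om x ** pdm i w x ** Om x" for i
  proof -
    have "pdm i (\<lambda>y. Om y ** w y) x = pdm i (\<lambda>y. - mat 1) x"
      by (rule pdm_cong[OF W x]) (rule alg(5))
    also have "\<dots> = 0" by (simp add: pdm_def vec_eq_iff)
    finally have "pdm i Om x ** w x = - (Om x ** pdm i w x)"
      by (simp add: pdm_matrix_mul[OF Omij wij x] eq_neg_iff_add_eq_0)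
    then have "pdm i Om x ** (w x ** Om x) = - (Om x ** pdm i w x ** Om x)"
      by (simp add: matrix_mul_assoc matrix_mul_minus_left)
    then show ?thesis by (simp add: alg(6)[OF x] matrix_mul_minus_right)
  qed
  \<comment> \<open>Differentiating \<open>M ** M = - mat 1\<close> with \<open>M = g ** Om\<close>
    and taking the trace shows that the determinants of \<open>g\<close> and \<open>w\<close> have
    the same logarithmic derivative.\<close>
  have trT: "T c = (\<Sum>i\<in>UNIV. \<Sum>b\<in>UNIV. Om x $ i $ b * dw c i b)" for c
  proof -
    have Mij: "smooth_on W (\<lambda>y. (g y ** Om y) $ i $ j)" for i j
      by (intro smooth_on_matrix_mul W gij Omij)
    have "pdm c (\<lambda>y. (g y ** Om y) ** (g y ** Om y)) x = pdm c (\<lambda>y. - mat 1) x"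
      by (rule pdm_cong[OF W x]) (simp add: alg(7) MM)
    also have "\<dots> = 0" by (simp add: pdm_def vec_eq_iff)
    finally have "0 = trace (pdm c (\<lambda>y. g y ** Om y) x ** M x + M x ** pdm c (\<lambda>y. g y ** Om y) x)"
      by (simp add: pdm_matrix_mul[OF Mij Mij x] alg(7)[OF x] trace_def)
    then have "0 = trace (M x ** (pdm c g x ** Om x + g x ** pdm c Om x))"
      by (simp add: trace_add trace_mul_sym[of _ "M x"] pdm_matrix_mul[OF gij Omij x])
    also have "\<dots> = trace (Om x ** M x ** pdm c g x) + trace (M x ** g x ** pdm c Om x)"
      by (simp add: matrix_add_ldistrib trace_add matrix_mul_assoc)
        (metis matrix_mul_assoc trace_mul_sym)
    also have "M x ** g x = w x" using Mw[OF x] by (simp add: g_def w_def)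
    also have "trace (w x ** pdm c Om x) = trace ((Om x ** w x) ** Om x ** pdm c w x)"
      unfolding dOm by (metis matrix_mul_assoc trace_mul_sym)
    finally have tr: "trace (B x ** pdm c g x) = - trace (Om x ** pdm c w x)"
      by (simp add: alg(5,8)[OF x] matrix_mul_minus_left trace_uminus)
    have dws: "dw c i b = - dw c b i" for i b
    proof -
      have "dw c i b = pd c (\<lambda>y. - (w y $ b $ i)) x"
        unfolding dw_def by (rule arg_cong2[where f = "pd c"]) (auto simp: w_def fun_eq_iff)
      then show ?thesis by (simp add: dw_def pd_uminus[OF wij x])
    qed
    have dgs: "dg c i b = dg c b i" for i b
      unfolding dg_def
    proof (rule pd_cong[OF W x])
      fix y assume "y \<in> W"
      then show "g y $ i $ b = g y $ b $ i"
        using arg_cong[OF gs[of y], of "\<lambda>A. A $ b $ i"] by (simp add: g_def transpose_def)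
    qed
    have "T c = trace (B x ** pdm c g x)"
      unfolding T_def trace_mul_eq_sum pdm_nth dg_def[symmetric]
      by (intro sum.cong refl) (metis dgs)
    also have "\<dots> = (\<Sum>i\<in>UNIV. \<Sum>b\<in>UNIV. Om x $ i $ b * dw c i b)"
    proof -
      have "Om x $ i $ b * dw c i b = - (Om x $ i $ b * dw c b i)" for i b
        using dws[of i b] by simp
      then have "(\<Sum>i\<in>UNIV. \<Sum>b\<in>UNIV. Om x $ i $ b * dw c i b) = - trace (Om x ** pdm c w x)"
        by (simp only: trace_mul_eq_sum pdm_nth dw_def[symmetric] sum_negf)
      then show ?thesis by (simp only: tr)
    qed
    finally show ?thesis .
  qed
  have closed: "dw a b c + dw b c a + dw c a b = 0" for a b c
  proof -
    have "dw a b c = pd a (pd b (\<alpha> c)) x - pd a (pd c (\<alpha> b)) x" for a b c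
      by (simp add: dw_def w_def pd_diff[where W = W] smooth_on_pd \<alpha> x)
    moreover have "pd i (pd j (\<alpha> k)) x = pd j (pd i (\<alpha> k)) x" for i j k
      by (rule pd_commute[OF \<alpha> x])
    from this[of a b c] this[of a c b] this[of b c a]
    have "(pd a (pd b (\<alpha> c)) x - pd a (pd c (\<alpha> b)) x) + (pd b (pd c (\<alpha> a)) x - pd b (pd a (\<alpha> c)) x)
        + (pd c (pd a (\<alpha> b)) x - pd c (pd b (\<alpha> a)) x) = 0" by linarith
    ultimately show ?thesis by simp
  qed
  \<comment> \<open>Contract the closedness relation with \<open>Om\<close> in two slots: two of the
    three terms coincide by skewness and the third is \<open>T c\<close>. This cancels the half
    contraction of \<open>T\<close> in the Laplacian.\<close>
  have half: "(\<Sum>i\<in>UNIV. \<Sum>b\<in>UNIV. Om x $ i $ b * dw i b c) = - 1/2 * T c" for c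
  proof -
    let ?S = "\<Sum>i\<in>UNIV. \<Sum>b\<in>UNIV. Om x $ i $ b * dw i b c"
    have "?S = (\<Sum>i\<in>UNIV. \<Sum>b\<in>UNIV. Om x $ b $ i * dw b i c)" by (rule sum.swap)
    also have "\<dots> = (\<Sum>i\<in>UNIV. \<Sum>b\<in>UNIV. Om x $ i $ b * dw b c i)"
    proof (intro sum.cong refl)
      fix i b
      have "dw b i c = - dw b c i"
      proof -
        have "dw b i c = pd b (\<lambda>y. - (w y $ c $ i)) x"
          unfolding dw_def by (rule arg_cong2[where f = "pd b"]) (auto simp: w_def fun_eq_iff)
        then show ?thesis by (simp add: dw_def pd_uminus[OF wij x])
      qed
      then show "Om x $ b $ i * dw b i c = Om x $ i $ b * dw b c i"
        using Oms[of b i] by simp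
    qed
    finally have "2 * ?S = (\<Sum>i\<in>UNIV. \<Sum>b\<in>UNIV. Om x $ i $ b * (dw i b c + dw b c i))"
      by (simp add: distrib_left sum.distrib)
    also have "\<dots> = (\<Sum>i\<in>UNIV. \<Sum>b\<in>UNIV. - (Om x $ i $ b * dw c i b))"
      using closed by (intro sum.cong refl) (metis add_eq_0_iff mult_minus_right minus_equation_iff)
    also have "\<dots> = - T c" by (simp add: trT sum_negf)
    finally show ?thesis by simp
  qed
  have "(\<Sum>i\<in>UNIV. dX i i) = (\<Sum>i\<in>UNIV. \<Sum>l\<in>UNIV. (Om x ** pdm i w x ** Om x) $ i $ l * v l x)"
    unfolding divX by (simp add: dO_def dOm[symmetric])
  also have "\<dots> = (\<Sum>i\<in>UNIV. \<Sum>c\<in>UNIV. (Om x ** pdm i w x) $ i $ c * X c x)"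
  proof (rule sum.cong[OF refl])
    fix i
    have "(\<Sum>l\<in>UNIV. (Om x ** pdm i w x ** Om x) $ i $ l * v l x) =
        (\<Sum>l\<in>UNIV. \<Sum>c\<in>UNIV. (Om x ** pdm i w x) $ i $ c * (Om x $ c $ l * v l x))"
      by (subst matrix_matrix_mult_def) (simp add: sum_distrib_right mult.assoc)
    also have "\<dots> = (\<Sum>c\<in>UNIV. (Om x ** pdm i w x) $ i $ c * X c x)"
      by (subst sum.swap) (simp add: X_def sum_distrib_left)
    finally show "(\<Sum>l\<in>UNIV. (Om x ** pdm i w x ** Om x) $ i $ l * v l x) =
      (\<Sum>c\<in>UNIV. (Om x ** pdm i w x) $ i $ c * X c x)" .
  qed
  also have "\<dots> = (\<Sum>c\<in>UNIV. (\<Sum>i\<in>UNIV. \<Sum>b\<in>UNIV. Om x $ i $ b * dw i b c) * X c x)"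
    by (subst sum.swap) (simp add: matrix_matrix_mult_def sum_distrib_right dw_def)
  also have "\<dots> = - 1/2 * (\<Sum>c\<in>UNIV. T c * X c x)"
    by (simp add: half sum_distrib_left)
  finally have "(\<Sum>i\<in>UNIV. dX i i) = - 1/2 * (\<Sum>c\<in>UNIV. T c * X c x)" .
  moreover have "laplacian G \<psi> f x = (\<Sum>i\<in>UNIV. \<Sum>j\<in>UNIV. B x $ i $ j * pd i (u j) x) -
    (\<Sum>i\<in>UNIV. \<Sum>j\<in>UNIV. B x $ i $ j * (\<Sum>k\<in>UNIV. christoffel G \<psi> k i j x * u k x))"
    by (simp add: laplacian_def g_def[symmetric] B_def[symmetric] u_def[symmetric] right_diff_distrib
        sum_subtractf)
  ultimately show ?thesis by (simp add: hess chr)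
qed

section \<open>Composition with a horizontally conformal map\<close>

lemma pd_compose:
  fixes F :: "real^'k \<Rightarrow> real" and P :: "real^'m \<Rightarrow> real^'k"
  assumes F: "smooth_on U F" and P: "smooth_on W P" and PU: "P ` W \<subseteq> U" and y: "y \<in> W"
  shows "pd j (\<lambda>y. F (P y)) y = (\<Sum>a\<in>UNIV. pd a F (P y) * pd j (\<lambda>y. P y $ a) y)"
proof -
  let ?D = "frechet_derivative F (at (P y))"
  have DF: "(F has_derivative ?D) (at (P y))"
    using smooth_on_has_derivative[OF F] PU y by blast
  have "pd j (\<lambda>y. F (P y)) y = ?D (pd j P y)"
    by (subst pd_eqI[OF has_derivative_compose[OF smooth_on_has_derivative[OF P y] DF]])
      (simp add: pd_def)
  also have "pd j P y = (\<Sum>a\<in>UNIV. pd j P y $ a *\<^sub>R axis a 1)"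
    by (simp add: vec_eq_iff axis_def if_distrib cong: if_cong)
  also have "?D \<dots> = (\<Sum>a\<in>UNIV. pd j P y $ a * pd a F (P y))"
    by (simp add: linear_sum[OF has_derivative_linear[OF DF]]
        linear_cmul[OF has_derivative_linear[OF DF]] pd_def)
  finally show ?thesis
    by (simp add: pd_bounded_linear[OF bounded_linear_vec_nth P y] mult.commute)
qed

text \<open>The chain rule separates the two ingredients of a harmonic morphism: Laplacians of the
  components come with first derivatives of \<open>F\<close>, scalar products of their gradients
  with second derivatives.\<close>

lemma laplacian_compose:
  fixes G :: "'a::euclidean_space metric" and \<psi> :: "real^'m \<Rightarrow> 'a"
    and F :: "real^'k \<Rightarrow> real" and \<Phi> :: "'a \<Rightarrow> real^'k"
  assumes F: "smooth_on U F" and P: "smooth_on W (\<Phi> \<circ> \<psi>)" and PU: "(\<Phi> \<circ> \<psi>) ` W \<subseteq> U"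
    and x: "x \<in> W"
  shows "laplacian G \<psi> (F \<circ> \<Phi>) x =
    (\<Sum>a\<in>UNIV. pd a F (\<Phi> (\<psi> x)) * laplacian G \<psi> (\<lambda>p. \<Phi> p $ a) x) +
    (\<Sum>a\<in>UNIV. \<Sum>b\<in>UNIV. pd a (pd b F) (\<Phi> (\<psi> x)) *
       (\<Sum>i\<in>UNIV. \<Sum>j\<in>UNIV. matrix_inv (gram G \<psi> x) $ i $ j *
          (pd i ((\<lambda>p. \<Phi> p $ a) \<circ> \<psi>) x * pd j ((\<lambda>p. \<Phi> p $ b) \<circ> \<psi>) x)))"
proof -
  define P where "P = \<Phi> \<circ> \<psi>"
  note P = P[folded P_def] and PU = PU[folded P_def]
  define B where "B = matrix_inv (gram G \<psi> x)"
  define p where "p a = (\<lambda>p. \<Phi> p $ a) \<circ> \<psi>" for a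
  have p_alt: "p a = (\<lambda>y. P y $ a)" for a by (simp add: p_def P_def fun_eq_iff)
  have ps: "smooth_on W (p a)" for a unfolding p_alt by (rule smooth_on_nth[OF P])
  have d1: "pd j (F \<circ> \<Phi> \<circ> \<psi>) y = (\<Sum>b\<in>UNIV. pd b F (P y) * pd j (p b) y)" if "y \<in> W" for j y
    using pd_compose[OF F P PU that, of j] by (simp add: p_alt P_def comp_def)
  have FP: "smooth_on W (\<lambda>y. pd b F (P y))" for b
    by (rule smooth_on_compose[OF smooth_on_pd[OF F] P PU])
  have d2: "pd i (pd j (F \<circ> \<Phi> \<circ> \<psi>)) x =
     (\<Sum>b\<in>UNIV. pd b F (P x) * pd i (pd j (p b)) x) +
     (\<Sum>a\<in>UNIV. \<Sum>b\<in>UNIV. pd a (pd b F) (P x) * (pd i (p a) x * pd j (p b) x))" for i j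
  proof -
    have "pd i (pd j (F \<circ> \<Phi> \<circ> \<psi>)) x = pd i (\<lambda>y. \<Sum>b\<in>UNIV. pd b F (P y) * pd j (p b) y) x"
      by (rule pd_cong[OF smooth_on_open[OF P] x d1])
    also have "\<dots> = (\<Sum>b\<in>UNIV. pd i (\<lambda>y. pd b F (P y)) x * pd j (p b) x + pd b F (P x) * pd i (pd j (p b)) x)"
      by (subst pd_sum[where W = W])
        (auto intro!: sum.cong smooth_on_mult FP smooth_on_pd ps x simp: pd_mult[OF FP smooth_on_pd[OF ps] x])
    also have "\<dots> = (\<Sum>b\<in>UNIV. \<Sum>a\<in>UNIV. pd a (pd b F) (P x) * (pd i (p a) x * pd j (p b) x)) +
        (\<Sum>b\<in>UNIV. pd b F (P x) * pd i (pd j (p b)) x)"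
      by (simp add: sum.distrib pd_compose[OF smooth_on_pd[OF F] P PU x] sum_distrib_right p_alt mult.assoc)
    finally show ?thesis by (subst sum.swap) simp
  qed
  let ?c = "\<lambda>k i j. christoffel G \<psi> k i j x"
  have S: "(\<Sum>i\<in>UNIV. \<Sum>j\<in>UNIV. B $ i $ j * (\<Sum>b\<in>UNIV. h b i j)) =
     (\<Sum>b\<in>UNIV. \<Sum>i\<in>UNIV. \<Sum>j\<in>UNIV. B $ i $ j * h b i j)" for h :: "'k \<Rightarrow> 'm \<Rightarrow> 'm \<Rightarrow> real"
    by (simp only: sum_distrib_left sum.swap[of _ "UNIV :: 'k set" "UNIV :: 'm set"])
  have 1: "(\<Sum>i\<in>UNIV. \<Sum>j\<in>UNIV. B $ i $ j * (\<Sum>b\<in>UNIV. pd b F (P x) * h b i j)) =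
     (\<Sum>b\<in>UNIV. pd b F (P x) * (\<Sum>i\<in>UNIV. \<Sum>j\<in>UNIV. B $ i $ j * h b i j))" for h
    unfolding S by (simp add: sum_distrib_left mult.left_commute)
  have 2: "(\<Sum>i\<in>UNIV. \<Sum>j\<in>UNIV. B $ i $ j * (\<Sum>a\<in>UNIV. \<Sum>b\<in>UNIV. h a b * r i j a b)) =
     (\<Sum>a\<in>UNIV. \<Sum>b\<in>UNIV. h a b * (\<Sum>i\<in>UNIV. \<Sum>j\<in>UNIV. B $ i $ j * r i j a b))"
    for h :: "'k \<Rightarrow> 'k \<Rightarrow> real" and r
    unfolding S by (simp add: sum_distrib_left mult.left_commute)
  have 3: "(\<Sum>k\<in>UNIV. ?c k i j * (\<Sum>b\<in>UNIV. pd b F (P x) * pd k (p b) x)) =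
      (\<Sum>b\<in>UNIV. pd b F (P x) * (\<Sum>k\<in>UNIV. ?c k i j * pd k (p b) x))" for i j
    unfolding sum_distrib_left by (subst sum.swap) (simp add: mult.left_commute)
  have "pd i (pd j (F \<circ> \<Phi> \<circ> \<psi>)) x - (\<Sum>k\<in>UNIV. ?c k i j * pd k (F \<circ> \<Phi> \<circ> \<psi>) x) =
      (\<Sum>b\<in>UNIV. pd b F (P x) * (pd i (pd j (p b)) x - (\<Sum>k\<in>UNIV. ?c k i j * pd k (p b) x))) +
      (\<Sum>a\<in>UNIV. \<Sum>b\<in>UNIV. pd a (pd b F) (P x) * (pd i (p a) x * pd j (p b) x))" for i j
    unfolding d1[OF x] 3 d2 by (simp add: right_diff_distrib sum_subtractf)
  then have "laplacian G \<psi> (F \<circ> \<Phi>) x =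
    (\<Sum>i\<in>UNIV. \<Sum>j\<in>UNIV. B $ i $ j * (\<Sum>b\<in>UNIV. pd b F (P x) *
        (pd i (pd j (p b)) x - (\<Sum>k\<in>UNIV. ?c k i j * pd k (p b) x)))) +
    (\<Sum>i\<in>UNIV. \<Sum>j\<in>UNIV. B $ i $ j *
      (\<Sum>a\<in>UNIV. \<Sum>b\<in>UNIV. pd a (pd b F) (P x) * (pd i (p a) x * pd j (p b) x)))"
    by (simp only: laplacian_def B_def[symmetric] distrib_left sum.distrib)
  then show ?thesis
    unfolding 1 2 by (simp add: laplacian_def B_def p_def P_def)
qed

lemma matrix_vector_mult_minus_left: "(- A) *v x = - (A *v (x :: 'a::ring_1^'n))"
  by (simp add: matrix_vector_mult_def vec_eq_iff sum_negf)

lemma matrix_vector_mult_minus_right: "A *v (- x) = - (A *v (x :: 'a::ring_1^'n))"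
  by (simp add: matrix_vector_mult_def vec_eq_iff sum_negf)

text \<open>The vectors are coordinate differentials, paired by the dual metric. Lengths agree
  because \<open>M1\<close> and \<open>M2\<close> preserve this pairing. Orthogonality to
  \<open>u2\<close> comes from skewness of \<open>B ** M1\<close> and \<open>B ** M2\<close>. For
  \<open>u1\<close> and \<open>u3\<close>, which are minus the images of \<open>u2\<close> under
  \<open>M2\<close> and \<open>M1\<close>, it comes from skewness of \<open>B ** M1 ** M2\<close>,
  where anticommutation enters.\<close>

lemma quaternionic_gradients:
  fixes g :: "real^'m^'m"
  assumes inv: "invertible g" and gs: "transpose g = g"
    and M1: "M1 ** g = w1" "M1 ** M1 = - mat 1" "transpose w1 = - w1"
    and M2: "M2 ** g = w2" "M2 ** M2 = - mat 1" "transpose w2 = - w2"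
    and anti: "M1 ** M2 = - (M2 ** M1)"
    and u: "u2 = M1 *v u3" "u2 = M2 *v u1"
  defines "ip \<equiv> \<lambda>a b. a \<bullet> (matrix_inv g *v b)"
  shows "ip u1 u1 = ip u2 u2" "ip u3 u3 = ip u2 u2"
    "ip u1 u2 = 0" "ip u2 u1 = 0" "ip u2 u3 = 0" "ip u3 u2 = 0" "ip u1 u3 = 0" "ip u3 u1 = 0"
proof -
  define B where "B = matrix_inv g"
  note a1 = almost_complex_algebra[OF inv M1(1,2) gs M1(3), folded B_def]
  note a2 = almost_complex_algebra[OF inv M2(1,2) gs M2(3), folded B_def]
  have ip: "ip a b = a \<bullet> (B *v b)" for a b by (simp add: ip_def B_def)
  have sym: "ip a b = ip b a" for a b
    by (simp add: ip) (metis a1(1) dot_lmul_matrix inner_commute transpose_matrix_vector)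
  have skew0: "v \<bullet> (S *v v) = 0" if "transpose S = - S" for S :: "real^'m^'m" and v
  proof -
    have "v \<bullet> (S *v v) = (transpose S *v v) \<bullet> v"
      by (simp add: dot_lmul_matrix)
    also have "\<dots> = - (v \<bullet> (S *v v))"
      by (simp add: that inner_commute del: transpose_matrix_vector)
        (metis add.inverse_inverse inner_minus_right matrix_vector_mult_minus_left)
    finally show ?thesis by simp
  qed
  have move: "ip (M *v a) (N *v b) = a \<bullet> ((transpose M ** B ** N) *v b)" for M N :: "real^'m^'m" and a b
    by (simp add: ip matrix_vector_mul_assoc[symmetric] dot_lmul_matrix[symmetric]
        del: transpose_matrix_vector)
  show "ip u1 u1 = ip u2 u2" unfolding u(2) move a2(9) by (simp add: ip)
  show "ip u3 u3 = ip u2 u2" unfolding u(1) move a1(9) by (simp add: ip)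
  have i1: "ip (M1 *v a) a = 0" for a
    using move[of M1 a "mat 1" a] skew0[of "B ** M1" a] a1(3) by (simp add: a1(8) matrix_vector_mult_minus_left)
  have i2: "ip (M2 *v a) a = 0" for a
    using move[of M2 a "mat 1" a] skew0[of "B ** M2" a] a2(3) by (simp add: a2(8) matrix_vector_mult_minus_left)
  show 21: "ip u2 u1 = 0" by (subst u(2)) (rule i2)
  then show "ip u1 u2 = 0" by (simp add: sym)
  show 23: "ip u2 u3 = 0" by (subst u(1)) (rule i1)
  then show "ip u3 u2 = 0" by (simp add: sym)
  have u3: "u3 = - (M1 *v u2)" and u1: "u1 = - (M2 *v u2)"
    unfolding u(1) by (simp add: matrix_vector_mul_assoc M1 matrix_vector_mult_minus_left)
      (simp add: u(1)[symmetric], simp add: u(2) matrix_vector_mul_assoc M2 matrix_vector_mult_minus_left)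
  have "transpose (B ** M1 ** M2) = - (B ** M1 ** M2)"
    by (simp add: matrix_transpose_mul a1(1,8) a2(8) matrix_mul_assoc matrix_mul_minus_left
        matrix_mul_minus_right)
      (simp add: matrix_mul_assoc[symmetric] anti matrix_mul_minus_right)
  then have "u2 \<bullet> ((B ** M1 ** M2) *v u2) = 0" by (rule skew0)
  then have "ip (M1 *v u2) (M2 *v u2) = 0"
    unfolding move by (simp add: a1(8) matrix_mul_minus_left matrix_vector_mult_minus_left)
  then show "ip u3 u1 = 0"
    unfolding u3 u1 ip by (simp add: matrix_vector_mult_minus_right)
  then show "ip u1 u3 = 0" by (simp add: sym)
qed

lemma gram_inner_id: "gram (\<lambda>_. inner) id = (\<lambda>x :: real^'k. mat 1)"
  by (simp add: fun_eq_iff gram_def pd_def vec_eq_iff mat_def inner_axis_axis)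

lemma laplacian_inner_id:
  fixes F :: "real^'k \<Rightarrow> real"
  shows "laplacian (\<lambda>_. inner) id F x = (\<Sum>i\<in>UNIV. pd i (pd i F) x)"
proof -
  have inv: "matrix_inv (mat 1 :: real^'k^'k) = mat 1"
    using matrix_inv_inverse(1)[of "mat 1 :: real^'k^'k"] invertible_def
    by (metis matrix_mul_lid)
  have "christoffel (\<lambda>_. inner) id k i j x = 0" for k i j :: 'k
    by (simp add: christoffel_def gram_inner_id)
  then show ?thesis
    unfolding laplacian_def gram_inner_id inv
    by (simp add: mat_def if_distrib[of "\<lambda>a. a * _"] cong: if_cong)
qed

lemma hyperkaehler_laplacian_compose_eq_0:
  fixes G :: "'a::euclidean_space metric" and \<psi> :: "real^'m \<Rightarrow> 'a"
    and M1 M2 :: "real^'m \<Rightarrow> real^'m^'m" and \<alpha>1 \<alpha>2 :: "'m \<Rightarrow> real^'m \<Rightarrow> real"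
    and \<Phi> :: "'a \<Rightarrow> real^3" and F :: "real^3 \<Rightarrow> real"
  assumes W: "open W" and g: "\<And>i j. smooth_on W (\<lambda>x. gram G \<psi> x $ i $ j)"
    and gs: "\<And>x. x \<in> W \<Longrightarrow> transpose (gram G \<psi> x) = gram G \<psi> x"
    and ginv: "\<And>x. x \<in> W \<Longrightarrow> invertible (gram G \<psi> x)"
    and \<alpha>1: "\<And>j. smooth_on W (\<alpha>1 j)" and \<alpha>2: "\<And>j. smooth_on W (\<alpha>2 j)"
    and w1: "\<And>x. x \<in> W \<Longrightarrow> M1 x ** gram G \<psi> x = (\<chi> i j. pd i (\<alpha>1 j) x - pd j (\<alpha>1 i) x)"
    and w2: "\<And>x. x \<in> W \<Longrightarrow> M2 x ** gram G \<psi> x = (\<chi> i j. pd i (\<alpha>2 j) x - pd j (\<alpha>2 i) x)"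
    and M1: "\<And>x. x \<in> W \<Longrightarrow> M1 x ** M1 x = - mat 1"
    and M2: "\<And>x. x \<in> W \<Longrightarrow> M2 x ** M2 x = - mat 1"
    and anti: "\<And>x. x \<in> W \<Longrightarrow> M1 x ** M2 x = - (M2 x ** M1 x)"
    and P: "smooth_on W (\<Phi> \<circ> \<psi>)"
    and d23: "\<And>x i. x \<in> W \<Longrightarrow> pd i ((\<lambda>p. \<Phi> p $ 2) \<circ> \<psi>) x =
      (\<Sum>k\<in>UNIV. M1 x $ i $ k * pd k ((\<lambda>p. \<Phi> p $ 3) \<circ> \<psi>) x)"
    and d21: "\<And>x i. x \<in> W \<Longrightarrow> pd i ((\<lambda>p. \<Phi> p $ 2) \<circ> \<psi>) x =
      (\<Sum>k\<in>UNIV. M2 x $ i $ k * pd k ((\<lambda>p. \<Phi> p $ 1) \<circ> \<psi>) x)"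
    and F: "smooth_on U F" and PU: "(\<Phi> \<circ> \<psi>) ` W \<subseteq> U"
    and harm: "\<And>y. y \<in> U \<Longrightarrow> (\<Sum>i\<in>UNIV. pd i (pd i F) y) = 0"
    and x: "x \<in> W"
  shows "laplacian G \<psi> (F \<circ> \<Phi>) x = 0"
proof -
  define p where "p a = (\<lambda>p. \<Phi> p $ a) \<circ> \<psi>" for a
  have ps: "smooth_on W (p a)" for a
    using smooth_on_nth[OF P, of a] by (simp add: p_def comp_def)
  define u where "u a y = (\<chi> i. pd i (p a) y)" for a y
  have u2: "u 2 y = M1 y *v u 3 y" "u 2 y = M2 y *v u 1 y" if "y \<in> W" for y
    using d23[OF that] d21[OF that] by (simp_all add: u_def p_def vec_eq_iff matrix_vector_mult_def)
  have neg: "pd k ((\<lambda>p. - \<Phi> p $ 2) \<circ> \<psi>) y = - pd k (p 2) y" if "y \<in> W" for k y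
    using pd_uminus[OF ps that, of k 2] by (simp add: p_def comp_def)
  have negs: "smooth_on W ((\<lambda>p. - \<Phi> p $ 2) \<circ> \<psi>)"
    using smooth_on_minus[OF ps[of 2]] by (simp add: p_def comp_def)
  have L2: "laplacian G \<psi> (\<lambda>p. \<Phi> p $ 2) x = 0"
    by (rule almost_kaehler_laplacian_eq_0[OF W g gs ginv \<alpha>1 w1 M1 _ _ d23 x]) (use ps in \<open>auto simp: p_def\<close>)
  \<comment> \<open>As \<open>M1\<close> and \<open>M2\<close> square to -1, the relations with
    component 2 can be inverted at the price of a sign; components 3 and 1 are therefore paired with
    the negative of component 2.\<close>
  have "pd i (p 3) y = (\<Sum>k\<in>UNIV. M1 y $ i $ k * - pd k (p 2) y)"
    "pd i (p 1) y = (\<Sum>k\<in>UNIV. M2 y $ i $ k * - pd k (p 2) y)" if "y \<in> W" for y i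
  proof -
    have "M1 y *v - u 2 y = u 3 y"
      by (simp add: u2(1)[OF that] matrix_vector_mul_assoc M1[OF that] matrix_vector_mult_minus_right
          matrix_vector_mult_minus_left)
    then show "pd i (p 3) y = (\<Sum>k\<in>UNIV. M1 y $ i $ k * - pd k (p 2) y)"
      by (simp add: u_def vec_eq_iff matrix_vector_mult_def)
    have "M2 y *v - u 2 y = u 1 y"
      by (simp add: u2(2)[OF that] matrix_vector_mul_assoc M2[OF that] matrix_vector_mult_minus_right
          matrix_vector_mult_minus_left)
    then show "pd i (p 1) y = (\<Sum>k\<in>UNIV. M2 y $ i $ k * - pd k (p 2) y)"
      by (simp add: u_def vec_eq_iff matrix_vector_mult_def)
  qed
  note d = this
  have L3: "laplacian G \<psi> (\<lambda>p. \<Phi> p $ 3) x = 0"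
    by (rule almost_kaehler_laplacian_eq_0[OF W g gs ginv \<alpha>1 w1 M1 _ negs _ x])
      (use ps d(1) in \<open>auto simp: neg p_def\<close>)
  have L1: "laplacian G \<psi> (\<lambda>p. \<Phi> p $ 1) x = 0"
    by (rule almost_kaehler_laplacian_eq_0[OF W g gs ginv \<alpha>2 w2 M2 _ negs _ x])
      (use ps d(2) in \<open>auto simp: neg p_def\<close>)
  have skew: "transpose (\<chi> i j. h i j - h j i) = - (\<chi> i j. h i j - h j i)"
    for h :: "'m \<Rightarrow> 'm \<Rightarrow> real"
    by (simp add: transpose_def vec_eq_iff)
  note grads = quaternionic_gradients[OF ginv[OF x] gs[OF x] w1[OF x] M1[OF x] skew w2[OF x] M2[OF x]
      skew anti[OF x] u2[OF x]]
  define ip where "ip a b = u a x \<bullet> (matrix_inv (gram G \<psi> x) *v u b x)" for a b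
  have ip: "(\<Sum>i\<in>UNIV. \<Sum>j\<in>UNIV. matrix_inv (gram G \<psi> x) $ i $ j * (pd i (p a) x * pd j (p b) x)) = ip a b"
    for a b
    by (simp add: ip_def inner_vec_def matrix_vector_mult_def u_def sum_distrib_left algebra_simps)
  have gr: "ip 1 1 = ip 2 2" "ip 3 3 = ip 2 2" "ip 1 2 = 0" "ip 2 1 = 0" "ip 2 3 = 0" "ip 3 2 = 0"
    "ip 1 3 = 0" "ip 3 1 = 0"
    unfolding ip_def by (fact grads)+
  have ne: "(1::3) \<noteq> 2" "(1::3) \<noteq> 3" "(2::3) \<noteq> 3" by auto
  \<comment> \<open>The common squared length may be 0, so critical points of the map are covered by
    the same computation.\<close>
  define c where "c = ip 2 2"
  have "ip a b = (if a = b then c else 0)" for a b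
    unfolding c_def using exhaust_3[of a] exhaust_3[of b] by (elim disjE) (simp_all add: gr ne ne[symmetric])
  then have "(\<Sum>a\<in>UNIV. \<Sum>b\<in>UNIV. pd a (pd b F) (\<Phi> (\<psi> x)) * ip a b) =
      (\<Sum>a\<in>UNIV. pd a (pd a F) (\<Phi> (\<psi> x))) * c"
    by (simp add: if_distrib[of "\<lambda>a. _ * a"] sum_distrib_right cong: if_cong)
  also have "\<dots> = 0" using harm[of "\<Phi> (\<psi> x)"] PU x by (simp add: image_subset_iff)
  finally have "(\<Sum>a\<in>UNIV. \<Sum>b\<in>UNIV. pd a (pd b F) (\<Phi> (\<psi> x)) * ip a b) = 0" .
  then show ?thesis
    using L1 L2 L3
    by (subst laplacian_compose[OF F P PU x]) (simp add: ip p_def[symmetric] sum_3)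
qed

section \<open>Projectors of trace one and their tangent vectors\<close>

lemma cscale_nth [simp]: "(c *\<^sub>M A) $ i $ j = c * A $ i $ j"
  by (simp add: cscale_def)

lemma scaleR_eq_cscale: "r *\<^sub>R (A :: complex^'n^'m) = complex_of_real r *\<^sub>M A"
  by (simp add: vec_eq_iff scaleR_conv_of_real[symmetric])

lemma cscale_mult_left: "(c *\<^sub>M A) ** B = c *\<^sub>M (A ** B)"
  by (simp add: vec_eq_iff matrix_matrix_mult_def sum_distrib_left mult.assoc)

lemma cscale_mult_right: "A ** (c *\<^sub>M B) = c *\<^sub>M (A ** B)"
  by (simp add: vec_eq_iff matrix_matrix_mult_def sum_distrib_left mult.left_commute)

lemma cscale_cscale: "c *\<^sub>M d *\<^sub>M A = (c * d) *\<^sub>M A"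
  by (simp add: vec_eq_iff mult.assoc)

lemma cscale_add: "c *\<^sub>M (A + B) = c *\<^sub>M A + c *\<^sub>M B"
  by (simp add: vec_eq_iff distrib_left)

lemma cscale_diff: "c *\<^sub>M (A - B) = c *\<^sub>M A - c *\<^sub>M B"
  by (simp add: vec_eq_iff right_diff_distrib)

lemma cscale_minus: "c *\<^sub>M (- A) = - (c *\<^sub>M A)"
  by (simp add: vec_eq_iff)

lemma matrix_mul_add_left: "(A + B) ** C = A ** C + B ** (C :: 'a::semiring_1^'n^'m)"
  by (simp add: vec_eq_iff matrix_matrix_mult_def distrib_right sum.distrib)

lemma matrix_mul_diff_left: "(A - B) ** C = A ** C - B ** (C :: 'a::ring_1^'n^'m)"
  by (simp add: vec_eq_iff matrix_matrix_mult_def left_diff_distrib sum_subtractf)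

lemma matrix_mul_diff_right: "A ** (B - C) = A ** B - A ** (C :: 'a::ring_1^'n^'m)"
  by (simp add: vec_eq_iff matrix_matrix_mult_def right_diff_distrib sum_subtractf)

lemma trace_cscale: "trace (c *\<^sub>M A) = c * trace A"
  by (simp add: trace_def sum_distrib_left)

lemma trace_diff: "trace (A - B) = trace A - trace (B :: complex^'n^'n)"
  by (simp add: trace_def sum_subtractf)

text \<open>Normal form for matrix words: sums expanded, scalars complex and in front, products
  associated to the right. With \<open>CP_idem\<close> and \<open>tang_commute\<close>, which carry
  \<open>A\<close> to the left, identities between words in \<open>A\<close> and tangent vectors
  become linear arithmetic.\<close>

lemmas mat_expand = matrix_add_ldistrib matrix_mul_add_left matrix_mul_diff_left matrix_mul_diff_right
  matrix_mul_minus_left matrix_mul_minus_right cscale_mult_left cscale_mult_right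
  cscale_cscale cscale_add cscale_diff cscale_minus scaleR_eq_cscale matrix_mul_assoc[symmetric]

definition adj :: "complex^'n^'n \<Rightarrow> complex^'n^'n" where
  "adj A = (\<chi> i j. cnj (A $ j $ i))"

lemma hermitian_adj: "hermitian A \<longleftrightarrow> adj A = A"
  by (simp only: hermitian_def adj_def vec_eq_iff vec_lambda_beta eq_commute[of "cnj _"])

lemma hermitianD: "hermitian A \<Longrightarrow> A $ i $ j = cnj (A $ j $ i)"
  unfolding hermitian_def by blast

lemma adj_nth: "adj A $ i $ j = cnj (A $ j $ i)"
  by (simp add: adj_def)

lemma adj_mult: "adj (A ** B) = adj B ** adj A"
  by (simp add: vec_eq_iff adj_nth matrix_matrix_mult_def mult.commute)

lemma adj_simps:
  "adj (A + B) = adj A + adj B" "adj (A - B) = adj A - adj B" "adj (c *\<^sub>M A) = cnj c *\<^sub>M adj A"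
  "adj (mat 1) = mat 1" "adj 0 = 0" "adj (- A) = - adj A" "adj (adj A) = A"
  by (auto simp: vec_eq_iff adj_nth mat_def)

lemma trace_adj: "trace (adj A) = cnj (trace A)"
  by (simp add: trace_def adj_nth)

lemma fs_commute: "fs A B = fs B A"
  unfolding fs_def by (subst trace_mul_sym) (rule refl)

lemma fs_eq_sum: "fs A B = 1/2 * (\<Sum>i\<in>UNIV. \<Sum>j\<in>UNIV. Re (A $ i $ j * B $ j $ i))"
  by (simp add: fs_def trace_def matrix_matrix_mult_def)

lemma fs_hermitian_self: "hermitian A \<Longrightarrow> fs A A = 1/2 * (\<Sum>i\<in>UNIV. \<Sum>j\<in>UNIV. (cmod (A $ i $ j))\<^sup>2)"
proof -
  assume *: "hermitian A"
  have "Re (A $ i $ j * A $ j $ i) = (cmod (A $ i $ j))\<^sup>2" for i j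
  proof -
    have "A $ j $ i = cnj (A $ i $ j)" using * by (rule hermitianD)
    then have "Re (A $ i $ j * A $ j $ i) = Re (A $ i $ j * cnj (A $ i $ j))"
      by (rule arg_cong[where f = "\<lambda>z. Re (A $ i $ j * z)"])
    then show ?thesis by (simp only: complex_mult_cnj Re_complex_of_real cmod_power2)
  qed
  then show ?thesis by (simp add: fs_eq_sum)
qed

lemma fs_ge_0: "hermitian A \<Longrightarrow> fs A A \<ge> 0"
  by (simp add: fs_hermitian_self sum_nonneg)

lemma fs_eq_0_iff: "hermitian A \<Longrightarrow> fs A A = 0 \<longleftrightarrow> A = 0"
  by (auto simp: fs_hermitian_self sum_nonneg_eq_0_iff sum_nonneg vec_eq_iff)

lemma fs_gt_0: "hermitian A \<Longrightarrow> A \<noteq> 0 \<Longrightarrow> fs A A > 0"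
  using fs_ge_0[of A] fs_eq_0_iff[of A] by (auto simp: less_le)

lemma bounded_bilinear_fs: "bounded_bilinear (fs :: complex^'n^'n \<Rightarrow> _)"
proof -
  have "bilinear (fs :: complex^'n^'n \<Rightarrow> _)"
    unfolding bilinear_def
    by (auto intro!: linearI simp: fs_def matrix_mul_add_left matrix_add_ldistrib trace_add
        scaleR_eq_cscale cscale_mult_left cscale_mult_right trace_cscale)
  then show ?thesis by (simp add: bilinear_conv_bounded_bilinear)
qed

lemmas fs_add_left = bounded_bilinear.add_left[OF bounded_bilinear_fs]
  and fs_add_right = bounded_bilinear.add_right[OF bounded_bilinear_fs]
  and fs_diff_left = bounded_bilinear.diff_left[OF bounded_bilinear_fs]
  and fs_diff_right = bounded_bilinear.diff_right[OF bounded_bilinear_fs]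
  and fs_minus_left = bounded_bilinear.minus_left[OF bounded_bilinear_fs]
  and fs_minus_right = bounded_bilinear.minus_right[OF bounded_bilinear_fs]
  and fs_scaleR_left = bounded_bilinear.scaleR_left[OF bounded_bilinear_fs]
  and fs_scaleR_right = bounded_bilinear.scaleR_right[OF bounded_bilinear_fs]

lemmas fs_simps = fs_add_left fs_add_right fs_diff_left fs_diff_right fs_minus_left fs_minus_right
  fs_scaleR_left fs_scaleR_right

text \<open>The linearization of \<open>A ** A = A\<close>: for a projector, the Hermitian matrices
  that are off-diagonal with respect to its range and kernel. \<open>tangent_space_CP\<close>
  identifies this equational form with the tangent space defined by curves.\<close>

definition tang :: "complex^'n^'n \<Rightarrow> (complex^'n^'n) set" where
  "tang A = {Y. hermitian Y \<and> A ** Y + Y ** A = Y}"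

lemma tang_hermitian: "Y \<in> tang A \<Longrightarrow> hermitian Y"
  by (simp add: tang_def)

lemma subspace_tang: "subspace (tang A)"
proof (rule subspaceI)
  show "0 \<in> tang A" by (simp add: tang_def hermitian_adj adj_simps)
  fix Y Z assume Y: "Y \<in> tang A" and Z: "Z \<in> tang A"
  have "A ** (Y + Z) + (Y + Z) ** A = (A ** Y + Y ** A) + (A ** Z + Z ** A)"
    by (simp add: matrix_add_ldistrib matrix_mul_add_left)
  with Y Z show "Y + Z \<in> tang A" by (simp add: tang_def hermitian_adj adj_simps)
next
  fix Y and c :: real assume Y: "Y \<in> tang A"
  have "A ** (c *\<^sub>R Y) + (c *\<^sub>R Y) ** A = c *\<^sub>R (A ** Y + Y ** A)"
    by (simp only: scaleR_eq_cscale cscale_mult_left cscale_mult_right cscale_add)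
  with Y show "c *\<^sub>R Y \<in> tang A" by (simp add: tang_def hermitian_adj scaleR_eq_cscale adj_simps)
qed

section \<open>Algebra of a rank-one projector and its tangent vectors\<close>

context
  fixes A :: "('n::finite) cmat"
  assumes A: "A \<in> CP"
begin

lemma CP_idem: "A ** A = A" "A ** (A ** Z) = A ** Z"
  using A by (simp_all add: CP_def matrix_mul_assoc)

lemma CP_adj: "adj A = A" and CP_hermitian: "hermitian A" and CP_trace: "trace A = 1"
  using A by (simp_all add: CP_def hermitian_adj)

lemma tang_commute:
  assumes "Y \<in> tang A"
  shows "Y ** A = Y - A ** Y" "Y ** (A ** Z) = Y ** Z - A ** (Y ** Z)"
proof -
  show 1: "Y ** A = Y - A ** Y" using assms by (simp add: tang_def algebra_simps)
  show "Y ** (A ** Z) = Y ** Z - A ** (Y ** Z)"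
    using arg_cong[OF 1, of "\<lambda>B. B ** Z"] by (simp add: mat_expand)
qed

text \<open>Multiplying the hypothesis by \<open>A\<close> gives \<open>A ** W ** A = 0\<close>, and
  by cyclicity \<open>A ** W\<close> and \<open>W ** A\<close> both have the trace of this
  product.\<close>

lemma trace_off_diagonal:
  assumes "A ** W + W ** A = W"
  shows "trace W = 0"
proof -
  have "A ** W = A ** (A ** W + W ** A)" using assms by simp
  then have "A ** W ** A = 0" by (simp add: mat_expand CP_idem)
  then have "trace ((A ** W) ** A) = 0" by (simp add: trace_def)
  then have AW: "trace (A ** W) = 0"
    by (subst (asm) trace_mul_sym) (simp add: CP_idem)
  moreover have "trace (W ** A) = trace (A ** W)" by (rule trace_mul_sym)
  ultimately show ?thesis using arg_cong[OF assms, of trace] by (simp add: trace_add)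
qed

text \<open>Call matrices commuting with \<open>A\<close> even and off-diagonal ones odd. A product
  of an even and an odd matrix is odd, hence traceless; so even matrices are normal to
  \<open>CP\<close>.\<close>

lemma fs_even_odd:
  assumes "A ** E = E ** A" "Z \<in> tang A"
  shows "fs E Z = 0"
proof -
  have "A ** (E ** Z) = E ** (A ** Z)" using assms(1) by (simp add: matrix_mul_assoc)
  then have "trace (E ** Z) = 0"
    by (intro trace_off_diagonal) (simp add: mat_expand tang_commute[OF assms(2)])
  then show ?thesis by (simp add: fs_def)
qed

text \<open>A projector of trace one has rank one: its \<open>k\<close>-th column spans the range.\<close>

lemma CP_rank_one: "A $ i $ j * A $ k $ k = A $ i $ k * A $ k $ j"
proof (cases "A $ k $ k = 0")
  \<comment> \<open>By idempotence and Hermitian symmetry a diagonal entry is the squared norm of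
    its row, so here the whole row vanishes.\<close>
  case True
  have herm: "A $ i $ j = cnj (A $ j $ i)" for i j using CP_hermitian by (rule hermitianD)
  have "A $ k $ k = (\<Sum>j\<in>UNIV. A $ k $ j * A $ j $ k)"
    using arg_cong[OF CP_idem(1), of "\<lambda>B. B $ k $ k"] by (simp add: matrix_matrix_mult_def)
  also have "\<dots> = of_real (\<Sum>j\<in>UNIV. (cmod (A $ k $ j))\<^sup>2)"
    by (simp only: herm[of _ k] of_real_sum complex_norm_square)
  finally have "(\<Sum>j\<in>UNIV. (cmod (A $ k $ j))\<^sup>2) = 0" using True by (metis of_real_eq_0_iff)
  then have "A $ k $ j = 0" for j by (simp add: sum_nonneg_eq_0_iff)
  then show ?thesis using True by simp
next
  case False
  define c where "c = A $ k $ k"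
  \<comment> \<open>The orthogonal projector onto the line of the \<open>k\<close>-th column. Its
    difference from \<open>A\<close> is again Hermitian and idempotent, now of trace 0, and so has
    norm 0.\<close>
  define C where "C = (\<chi> i j. A $ i $ k * A $ k $ j / c)"
  have herm: "A $ i $ j = cnj (A $ j $ i)" for i j using CP_hermitian by (rule hermitianD)
  have cc: "cnj c = c" unfolding c_def using herm by metis
  have c: "c \<noteq> 0" using False by (simp add: c_def)
  have AA: "(\<Sum>l\<in>UNIV. A $ i $ l * A $ l $ j) = A $ i $ j" for i j
    using arg_cong[OF CP_idem(1), of "\<lambda>B. B $ i $ j"] by (simp add: matrix_matrix_mult_def)
  have AC: "A ** C = C" "C ** A = C" "C ** C = C"
  proof -
    show "A ** C = C"
      by (simp add: vec_eq_iff matrix_matrix_mult_def C_def sum_divide_distrib[symmetric]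
          sum_distrib_right[symmetric] mult.assoc[symmetric] AA)
    show "C ** A = C"
      by (simp add: vec_eq_iff matrix_matrix_mult_def C_def sum_divide_distrib[symmetric]
          sum_distrib_left[symmetric] mult.assoc AA)
    have "(\<Sum>l\<in>UNIV. A $ i $ k * A $ k $ l / c * (A $ l $ k * A $ k $ j / c)) =
        (\<Sum>l\<in>UNIV. A $ k $ l * A $ l $ k) * (A $ i $ k * A $ k $ j / (c * c))" for i j
      unfolding sum_distrib_right by (rule sum.cong[OF refl]) (simp add: field_simps)
    then show "C ** C = C"
      using c by (simp add: vec_eq_iff matrix_matrix_mult_def C_def AA c_def[symmetric])
  qed
  define B where "B = A - C"
  have "trace C = (\<Sum>i\<in>UNIV. A $ k $ i * A $ i $ k) / c"
    by (simp add: trace_def C_def sum_divide_distrib mult.commute)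
  then have "trace C = 1" using c AA c_def by simp
  then have trB: "trace B = 0" by (simp add: B_def trace_diff CP_trace)
  have BB: "B ** B = B" by (simp add: B_def mat_expand AC CP_idem)
  have hB: "hermitian B"
    unfolding hermitian_def
  proof (intro allI)
    show "B $ i $ j = cnj (B $ j $ i)" for i j
      using herm[of i j] herm[of i k] herm[of k j] cc by (simp add: B_def C_def mult.commute)
  qed
  have "fs B B = 0" by (simp add: fs_def BB trB)
  then have "B = 0" using fs_eq_0_iff[OF hB] by simp
  then have "A $ i $ j = C $ i $ j" by (simp add: B_def)
  then show ?thesis using c by (simp add: C_def c_def)
qed

text \<open>If \<open>A\<close> projects onto the line of a unit vector z, both sides are the value
  of the form of \<open>M\<close> at z, times \<open>A\<close>. Rank one enters as the vanishing of
  all two-by-two minors, fact \<open>r\<close>; \<open>CP_rank_one\<close> has only those through a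
  diagonal entry, and a nonzero one serves as pivot.\<close>

lemma CP_sandwich: "A ** (M ** A) = trace (A ** M) *\<^sub>M A"
proof -
  have r: "A $ i $ k * A $ l $ j = A $ i $ j * A $ l $ k" for i j k l
  proof -
    obtain m where m: "A $ m $ m \<noteq> 0"
    proof (rule ccontr)
      assume "\<not> thesis"
      with that have "A $ m $ m = 0" for m by blast
      then have "trace A = 0" by (simp add: trace_def)
      then show False by (simp add: CP_trace)
    qed
    have "(A $ i $ k * A $ l $ j) * (A $ m $ m * A $ m $ m) = (A $ i $ m * A $ m $ k) * (A $ l $ m * A $ m $ j)"
      using arg_cong2[OF CP_rank_one[of i k m] CP_rank_one[of l j m], of "(*)"] by (simp only: mult_ac)
    also have "\<dots> = (A $ i $ j * A $ l $ k) * (A $ m $ m * A $ m $ m)"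
      using arg_cong2[OF CP_rank_one[of i j m] CP_rank_one[of l k m], of "(*)"] by (simp only: mult_ac)
    finally show ?thesis using m by simp
  qed
  have "(\<Sum>l\<in>UNIV. A $ i $ l * (\<Sum>k\<in>UNIV. M $ l $ k * A $ k $ j)) =
      (\<Sum>k\<in>UNIV. \<Sum>l\<in>UNIV. A $ k $ l * M $ l $ k) * A $ i $ j" for i j
  proof -
    have "(\<Sum>l\<in>UNIV. A $ i $ l * (\<Sum>k\<in>UNIV. M $ l $ k * A $ k $ j)) =
       (\<Sum>l\<in>UNIV. \<Sum>k\<in>UNIV. M $ l $ k * (A $ i $ l * A $ k $ j))"
      by (simp add: sum_distrib_left mult.left_commute)
    also have "\<dots> = (\<Sum>l\<in>UNIV. \<Sum>k\<in>UNIV. M $ l $ k * (A $ i $ j * A $ k $ l))"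
      by (simp only: r[of i _ _ j])
    also have "\<dots> = (\<Sum>k\<in>UNIV. \<Sum>l\<in>UNIV. M $ l $ k * (A $ i $ j * A $ k $ l))"
      by (rule sum.swap)
    also have "\<dots> = (\<Sum>k\<in>UNIV. \<Sum>l\<in>UNIV. A $ k $ l * M $ l $ k) * A $ i $ j"
      unfolding sum_distrib_right by (intro sum.cong refl) (simp only: mult_ac)
    finally show ?thesis .
  qed
  then show ?thesis
    by (simp add: vec_eq_iff matrix_matrix_mult_def trace_def)
qed

lemma Jc_expand: "Jc A Y = \<i> *\<^sub>M Y - (2 * \<i>) *\<^sub>M (A ** Y)"
  by (simp add: Jc_def mat_expand mult.commute)

lemma Jc_tang:
  assumes Y: "Y \<in> tang A"
  shows "Jc A Y \<in> tang A"
proof -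
  have aY: "adj Y = Y" using tang_hermitian[OF Y] by (simp add: hermitian_adj)
  have "adj (Jc A Y) = Jc A Y"
    by (simp add: Jc_expand adj_simps adj_mult CP_adj aY tang_commute[OF Y] mat_expand vec_eq_iff
        algebra_simps)
  moreover have "A ** Jc A Y + Jc A Y ** A = Jc A Y"
    by (simp add: Jc_expand tang_commute[OF Y] mat_expand CP_idem)
      (simp add: vec_eq_iff algebra_simps)
  ultimately show ?thesis by (simp add: tang_def hermitian_adj)
qed

lemma Jc_Jc: "Jc A (Jc A Y) = - Y"
  by (simp add: Jc_expand mat_expand CP_idem vec_eq_iff algebra_simps)

lemma fs_Jc_left:
  assumes "Y \<in> tang A"
  shows "fs (Jc A Y) Z = - fs Y (Jc A Z)"
proof -
  have "trace (Jc A Y ** Z) = - trace (Y ** Jc A Z)"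
    by (simp add: Jc_expand mat_expand tang_commute[OF assms] trace_diff trace_add trace_cscale algebra_simps)
  then show ?thesis by (simp add: fs_def)
qed

lemma fs_Jc_Jc:
  assumes "Y \<in> tang A"
  shows "fs (Jc A Y) (Jc A Z) = fs Y Z"
  by (simp add: fs_Jc_left[OF assms] Jc_Jc fs_minus_right)

lemma fs_Jc_self:
  assumes "Y \<in> tang A"
  shows "fs Y (Jc A Y) = 0" "fs (Jc A Y) Y = 0"
  using fs_Jc_left[OF assms, of Y] by (simp_all add: fs_commute[of "Jc A Y"])

lemma Jc_linear: "Jc A (Y + Z) = Jc A Y + Jc A Z" "Jc A (Y - Z) = Jc A Y - Jc A Z"
  "Jc A (r *\<^sub>R Y) = r *\<^sub>R Jc A Y" "Jc A (- Y) = - Jc A Y"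
  by (simp_all add: Jc_expand mat_expand) (simp_all add: vec_eq_iff algebra_simps)

lemma hlift_snd:
  assumes X: "X \<in> tang A" and Y: "Y \<in> tang A"
  shows "snd (hlift (A, X) Y) = X ** Y + Y ** X - (2 *\<^sub>R A) ** (X ** Y + Y ** X)"
  by (simp add: hlift_def Jc_expand mat_expand tang_commute[OF X] tang_commute[OF Y])
    (simp add: vec_eq_iff algebra_simps)

lemma hlift_linear: "snd (hlift (A, X) (Y + Z)) = snd (hlift (A, X) Y) + snd (hlift (A, X) Z)"
  "snd (hlift (A, X) (Y - Z)) = snd (hlift (A, X) Y) - snd (hlift (A, X) Z)"
  "snd (hlift (A, X) (r *\<^sub>R Y)) = r *\<^sub>R snd (hlift (A, X) Y)"
  "snd (hlift (A, X) (- Y)) = - snd (hlift (A, X) Y)"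
  unfolding hlift_def prod.case snd_conv Jc_linear
  by (simp_all add: mat_expand) (simp_all add: vec_eq_iff algebra_simps)

text \<open>The fibre component of a horizontal lift is even, hence normal to \<open>CP\<close>: it
  is the second fundamental form at \<open>X\<close> and \<open>Y\<close>, all that the flat ambient
  space sees of the derivative of a parallel field.\<close>

lemma fs_hlift:
  assumes X: "X \<in> tang A" and Y: "Y \<in> tang A" and Z: "Z \<in> tang A"
  shows "fs (snd (hlift (A, X) Y)) Z = 0" "fs Z (snd (hlift (A, X) Y)) = 0"
proof -
  show "fs (snd (hlift (A, X) Y)) Z = 0"
    by (rule fs_even_odd[OF _ Z])
      (simp add: hlift_snd[OF X Y] mat_expand tang_commute[OF X] tang_commute[OF Y] CP_idem)
  then show "fs Z (snd (hlift (A, X) Y)) = 0" by (simp add: fs_commute)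
qed

text \<open>For \<open>X = z x\<^sup>* + x z\<^sup>*\<close> and \<open>Y = z y\<^sup>* + y z\<^sup>*\<close> with a unit vector \<open>z\<close> spanning the range
  of \<open>A\<close>, the number \<open>trace (A X Y)\<close> is the Hermitian product of \<open>x\<close> and \<open>y\<close>.\<close>

lemma CP_tang_tang:
  assumes X: "X \<in> tang A" and Y: "Y \<in> tang A"
  shows "A ** (X ** Y) = Complex (fs X Y) (fs Y (Jc A X)) *\<^sub>M A"
    "A ** (X ** (Y ** Z)) = Complex (fs X Y) (fs Y (Jc A X)) *\<^sub>M (A ** Z)"
proof -
  define t where "t = trace (A ** (X ** Y))"
  have 1: "A ** (X ** Y) = t *\<^sub>M A"
    using CP_sandwich[of "X ** Y"]
    by (simp add: mat_expand tang_commute[OF X] tang_commute[OF Y] CP_idem t_def)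
  have t2: "trace (Y ** (A ** X)) = t"
    by (subst trace_mul_sym) (simp add: t_def matrix_mul_assoc)
  have "adj (A ** (X ** Y)) = Y ** (X ** A)"
    using tang_hermitian[OF X] tang_hermitian[OF Y]
    by (simp add: adj_mult CP_adj hermitian_adj matrix_mul_assoc)
  then have "cnj t = trace (Y ** (X ** A))" by (metis t_def trace_adj)
  also have "\<dots> = trace (Y ** X) - t"
    by (simp add: tang_commute[OF X] matrix_mul_diff_right trace_diff t2)
  finally have c: "trace (Y ** X) = t + cnj t" by simp
  \<comment> \<open>The factor 1/2 in \<open>fs\<close> turns the trace \<open>t + cnj t\<close>
    into exactly the real part.\<close>
  have "fs X Y = Re t"
    by (simp add: fs_def trace_mul_sym[of X Y] c)
  moreover have "fs Y (Jc A X) = Im t"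
    by (simp add: fs_def Jc_expand mat_expand trace_diff trace_cscale c t2)
  ultimately have "t = Complex (fs X Y) (fs Y (Jc A X))" by (simp add: complex_eq_iff)
  with 1 show 2: "A ** (X ** Y) = Complex (fs X Y) (fs Y (Jc A X)) *\<^sub>M A" by simp
  show "A ** (X ** (Y ** Z)) = Complex (fs X Y) (fs Y (Jc A X)) *\<^sub>M (A ** Z)"
    using arg_cong[OF 2, of "\<lambda>B. B ** Z"] by (simp add: mat_expand)
qed

text \<open>Inserts a factor \<open>A\<close> into a word, so that \<open>CP_tang_tang\<close> can
  contract a pair of tangent vectors to a scalar.\<close>

lemma tang_split:
  assumes "Y \<in> tang A"
  shows "M ** Y = M ** (A ** Y) + M ** (Y ** A)"
  using assms by (simp add: tang_def matrix_add_ldistrib[symmetric])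

text \<open>After \<open>tang_split\<close>, a pair in each cubic word contracts to a Hermitian
  product; the real part of \<open>t\<close> yields the \<open>X\<close> term and its imaginary part
  the \<open>Jc A X\<close> term. Needed to differentiate \<open>X ** X\<close> along horizontal
  lifts.\<close>

lemma XXY_YXX:
  assumes X: "X \<in> tang A" and Y: "Y \<in> tang A"
  shows "X ** (X ** Y) + Y ** (X ** X) = fs X X *\<^sub>R Y + fs Y X *\<^sub>R X + fs Y (Jc A X) *\<^sub>R Jc A X"
    "X ** (Y ** X) = fs Y X *\<^sub>R X - fs Y (Jc A X) *\<^sub>R Jc A X"
proof -
  define t where "t = Complex (fs X Y) (fs Y (Jc A X))"
  have AXY: "A ** (X ** Y) = t *\<^sub>M A" "A ** (X ** (Y ** Z)) = t *\<^sub>M (A ** Z)" for Z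
    using CP_tang_tang[OF X Y] by (simp_all add: t_def)
  have AYX: "A ** (Y ** X) = cnj t *\<^sub>M A" "A ** (Y ** (X ** Z)) = cnj t *\<^sub>M (A ** Z)" for Z
  proof -
    have "Complex (fs Y X) (fs X (Jc A Y)) = cnj t"
      using fs_Jc_left[OF X, of Y] by (simp add: t_def complex_eq_iff fs_commute)
    then show "A ** (Y ** X) = cnj t *\<^sub>M A" "A ** (Y ** (X ** Z)) = cnj t *\<^sub>M (A ** Z)"
      using CP_tang_tang[OF Y X] by simp_all
  qed
  have AXX: "A ** (X ** X) = of_real (fs X X) *\<^sub>M A" "A ** (X ** (X ** Z)) = of_real (fs X X) *\<^sub>M (A ** Z)" for Z
    using CP_tang_tang[OF X X] by (simp_all add: fs_Jc_self[OF X] complex_of_real_def)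
  have XYA: "X ** (Y ** A) = t *\<^sub>M A" "Y ** (X ** A) = cnj t *\<^sub>M A" "X ** (X ** A) = of_real (fs X X) *\<^sub>M A"
    by (simp_all add: tang_commute[OF X] tang_commute[OF Y] matrix_mul_diff_right AXY AYX AXX)
  have 1: "X ** (X ** (A ** Y)) = of_real (fs X X) *\<^sub>M (A ** Y)"
    by (simp add: tang_commute[OF X] matrix_mul_diff_right AXX)
  have 2: "X ** (X ** (Y ** A)) = t *\<^sub>M (X ** A)"
    by (simp only: XYA cscale_mult_right)
  have 3: "Y ** (X ** (A ** X)) = cnj t *\<^sub>M (A ** X)"
    by (simp add: tang_commute[OF X] tang_commute[OF Y] matrix_mul_diff_right AYX)
  have 4: "Y ** (X ** (X ** A)) = of_real (fs X X) *\<^sub>M (Y ** A)"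
    by (simp only: XYA cscale_mult_right)
  have 5: "X ** (Y ** (A ** X)) = t *\<^sub>M (A ** X)"
    by (simp add: tang_commute[OF X] tang_commute[OF Y] matrix_mul_diff_right AXY)
  have 6: "X ** (Y ** (X ** A)) = cnj t *\<^sub>M (X ** A)"
    by (simp only: XYA cscale_mult_right)
  have t: "t = of_real (fs Y X) + \<i> * of_real (fs Y (Jc A X))"
    by (simp add: t_def complex_eq_iff fs_commute)
  have "X ** (X ** Y) = of_real (fs X X) *\<^sub>M (A ** Y) + t *\<^sub>M (X ** A)"
    by (simp only: tang_split[OF Y, of X] matrix_add_ldistrib 1 2)
  moreover have "Y ** (X ** X) = cnj t *\<^sub>M (A ** X) + of_real (fs X X) *\<^sub>M (Y ** A)"
    by (simp only: tang_split[OF X, of X] matrix_add_ldistrib 3 4)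
  ultimately have "X ** (X ** Y) + Y ** (X ** X) = of_real (fs X X) *\<^sub>M (A ** Y) + t *\<^sub>M (X ** A) +
    (cnj t *\<^sub>M (A ** X) + of_real (fs X X) *\<^sub>M (Y ** A))" by (simp only:)
  also have "\<dots> = fs X X *\<^sub>R Y + fs Y X *\<^sub>R X + fs Y (Jc A X) *\<^sub>R Jc A X"
    by (simp add: tang_commute(1)[OF X] tang_commute(1)[OF Y] Jc_expand t scaleR_eq_cscale)
      (simp add: vec_eq_iff algebra_simps)
  finally show "X ** (X ** Y) + Y ** (X ** X) = fs X X *\<^sub>R Y + fs Y X *\<^sub>R X + fs Y (Jc A X) *\<^sub>R Jc A X" .
  have "X ** (Y ** X) = t *\<^sub>M (A ** X) + cnj t *\<^sub>M (X ** A)"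
    by (simp only: tang_split[OF X, of Y] matrix_add_ldistrib 5 6)
  also have "\<dots> = fs Y X *\<^sub>R X - fs Y (Jc A X) *\<^sub>R Jc A X"
    by (simp add: tang_commute(1)[OF X] Jc_expand t scaleR_eq_cscale)
      (simp add: vec_eq_iff algebra_simps)
  finally show "X ** (Y ** X) = fs Y X *\<^sub>R X - fs Y (Jc A X) *\<^sub>R Jc A X" .
qed

end

section \<open>The complex structures of the Calabi metric\<close>

text \<open>\<open>fs X X\<close> times the orthogonal projection onto the span of \<open>X\<close>
  and \<open>Jc A X\<close>; leaving the factor in avoids a division at
  \<open>X = 0\<close>.\<close>

definition linep :: "('n::finite) cmat \<Rightarrow> 'n cmat \<Rightarrow> 'n cmat \<Rightarrow> 'n cmat" where
  "linep A X Y = fs Y X *\<^sub>R X + fs Y (Jc A X) *\<^sub>R Jc A X"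

text \<open>Represents \<open>calabi_h\<close> with respect to \<open>fs\<close>. As
  \<open>4 * fs X X = a^2 - 1\<close>, the coefficient \<open>(a - 1) / (2 * fs X X)\<close> has
  become \<open>2 / (a + 1)\<close>.\<close>

definition Pop :: "('n::finite) cmat \<Rightarrow> 'n cmat \<Rightarrow> 'n cmat \<Rightarrow> 'n cmat" where
  "Pop A X Y = ((acoef X + 1) / 2) *\<^sub>R Y + (2 / (acoef X + 1)) *\<^sub>R linep A X Y"

text \<open>Represents \<open>calabi_v\<close>, with \<open>fs X X\<close> eliminated from the
  coefficient in the same way; it is the inverse of \<open>Pop\<close>.\<close>

definition Qop :: "('n::finite) cmat \<Rightarrow> 'n cmat \<Rightarrow> 'n cmat \<Rightarrow> 'n cmat" where
  "Qop A X Y = (2 / (acoef X + 1)) *\<^sub>R Y - (4 / (acoef X * (acoef X + 1)\<^sup>2)) *\<^sub>R linep A X Y"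

text \<open>A linear model of the tangent space of \<open>TCP\<close>.
  \<open>tangent_space_TCP\<close> gives one inclusion; \<open>range_local_param\<close> shows that
  every local parametrization fills it.\<close>

definition tbundle :: "('n::finite) cmat \<times> 'n cmat \<Rightarrow> ('n cmat \<times> 'n cmat) set" where
  "tbundle p = {\<xi>. fst \<xi> \<in> tang (fst p) \<and> vpart p \<xi> \<in> tang (fst p)}"

text \<open>Two of the three complex structures of the hyper-Kaehler metric.\<close>

definition cstr1 :: "('n::finite) cmat \<times> 'n cmat \<Rightarrow> 'n cmat \<times> 'n cmat \<Rightarrow> 'n cmat \<times> 'n cmat" where
  "cstr1 p \<xi> = hlift p (- Qop (fst p) (snd p) (vpart p \<xi>)) + vlift p (Pop (fst p) (snd p) (fst \<xi>))"

definition cstr2 :: "('n::finite) cmat \<times> 'n cmat \<Rightarrow> 'n cmat \<times> 'n cmat \<Rightarrow> 'n cmat \<times> 'n cmat" where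
  "cstr2 p \<xi> = hlift p (- Qop (fst p) (snd p) (Jc (fst p) (vpart p \<xi>))) +
     vlift p (- Jc (fst p) (Pop (fst p) (snd p) (fst \<xi>)))"

text \<open>The derivative of \<open>(A, X) \<mapsto> J X\<close>.\<close>

definition dJ :: "('n::finite) cmat \<times> 'n cmat \<Rightarrow> 'n cmat \<times> 'n cmat \<Rightarrow> 'n cmat" where
  "dJ p \<xi> = Jc (fst p) (snd \<xi>) - (2 * \<i>) *\<^sub>M (fst \<xi> ** snd p)"

text \<open>The derivative of the second moment map.\<close>

definition dmoment :: "('n::finite) cmat \<Rightarrow> 'n cmat \<times> 'n cmat \<Rightarrow> 'n cmat \<times> 'n cmat \<Rightarrow> real" where
  "dmoment H p \<xi> = (let A = fst p; X = snd p; a = acoef X; a' = 4 * fs X (snd \<xi>) / a in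
     a' * fs A H + a * fs (fst \<xi>) H + 2 * a' / (a + 1)\<^sup>2 * fs (X ** X) H
       - 2 / (a + 1) * fs (X ** snd \<xi> + snd \<xi> ** X) H)"

section \<open>The metric operators, the complex structures and the derivative of the moment
  map\<close>

context
  fixes A X :: "('n::finite) cmat"
  assumes A: "A \<in> CP" and X: "X \<in> tang A"
begin

lemma JX_tang: "Jc A X \<in> tang A"
  by (rule Jc_tang[OF A X])

lemma acoef_ge_1: "acoef X \<ge> 1" and acoef_sq: "fs X X = ((acoef X)\<^sup>2 - 1) / 4"
  using fs_ge_0[OF tang_hermitian[OF X]] by (simp_all add: acoef_def)

lemma acoef_pos: "acoef X > 0" "acoef X \<noteq> 0" "acoef X + 1 \<noteq> 0" "1 + acoef X \<noteq> 0"
  using acoef_ge_1 by auto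

lemma linep_tang: "linep A X Y \<in> tang A"
  unfolding linep_def by (intro subspace_add[OF subspace_tang] subspace_scale[OF subspace_tang] X JX_tang)

lemma Pop_tang: "Y \<in> tang A \<Longrightarrow> Pop A X Y \<in> tang A"
  unfolding Pop_def by (intro subspace_add[OF subspace_tang] subspace_scale[OF subspace_tang] linep_tang)

lemma Qop_tang: "Y \<in> tang A \<Longrightarrow> Qop A X Y \<in> tang A"
  unfolding Qop_def by (intro subspace_diff[OF subspace_tang] subspace_scale[OF subspace_tang] linep_tang)

lemma linep_scale: "linep A X (r *\<^sub>R Y) = r *\<^sub>R linep A X Y"
  "linep A X (Y + Z) = linep A X Y + linep A X Z"
  "linep A X (Y - Z) = linep A X Y - linep A X Z"
  by (simp_all add: linep_def fs_simps algebra_simps)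

lemma linep_linep: "linep A X (linep A X Y) = fs X X *\<^sub>R linep A X Y"
  by (simp add: linep_def fs_simps fs_Jc_self[OF A X] fs_Jc_Jc[OF A X] algebra_simps)

lemma Pop_minus: "Pop A X (- Y) = - Pop A X Y" and Qop_minus: "Qop A X (- Y) = - Qop A X Y"
  by (simp_all add: Pop_def Qop_def linep_def fs_simps algebra_simps)

text \<open>Says that the composite of \<open>Pop\<close> and \<open>Qop\<close> has no
  \<open>linep\<close> term; on the span of \<open>X\<close> and \<open>Jc A X\<close> they act as
  \<open>a\<close> and \<open>1 / a\<close>.\<close>

lemma PQ_coef:
  "(acoef X + 1) / 2 * (4 / (acoef X * (acoef X + 1)\<^sup>2)) + 2 / (acoef X + 1) * (4 / (acoef X * (acoef X + 1)\<^sup>2) * fs X X)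
     = 2 / (acoef X + 1) * (2 / (acoef X + 1))"
proof -
  define a where "a = acoef X"
  have a: "a > 0" "a + 1 > 0" using acoef_pos acoef_ge_1 by (auto simp: a_def)
  have "(a + 1) / 2 * (4 / (a * (a + 1)\<^sup>2)) + 2 / (a + 1) * (4 / (a * (a + 1)\<^sup>2) * ((a\<^sup>2 - 1) / 4))
     = 2 / (a + 1) * (2 / (a + 1))"
    using a by (simp add: divide_simps power2_eq_square) (simp add: algebra_simps)
  then show ?thesis by (simp add: acoef_sq a_def)
qed

lemma Pop_Qop: "Pop A X (Qop A X Y) = Y" and Qop_Pop: "Qop A X (Pop A X Y) = Y"
proof -
  define p1 p2 q2 where "p1 = (acoef X + 1) / 2" and "p2 = 2 / (acoef X + 1)"
    and "q2 = 4 / (acoef X * (acoef X + 1)\<^sup>2)"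
  have c: "p1 * q2 + p2 * (q2 * fs X X) = p2 * p2" using PQ_coef by (simp add: p1_def p2_def q2_def)
  have p: "p1 * p2 = 1" using acoef_pos by (simp add: p1_def p2_def)
  have "Pop A X (Qop A X Y) = (p1 * p2) *\<^sub>R Y + (p2 * p2 - (p1 * q2 + p2 * (q2 * fs X X))) *\<^sub>R linep A X Y"
    unfolding Pop_def Qop_def p1_def[symmetric] p2_def[symmetric] q2_def[symmetric]
    by (simp add: linep_scale linep_linep algebra_simps)
  then show "Pop A X (Qop A X Y) = Y" using c p by simp
  have "Qop A X (Pop A X Y) = (p1 * p2) *\<^sub>R Y + (p2 * p2 - (p1 * q2 + p2 * (q2 * fs X X))) *\<^sub>R linep A X Y"
    unfolding Pop_def Qop_def p1_def[symmetric] p2_def[symmetric] q2_def[symmetric]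
    by (simp add: linep_scale linep_linep algebra_simps)
  then show "Qop A X (Pop A X Y) = Y" using c p by simp
qed

lemma fs_linep: "fs (linep A X Y) Z = fs Y X * fs Z X + fs Y (Jc A X) * fs Z (Jc A X)"
  by (simp add: linep_def fs_simps fs_commute)

lemma fs_Pop: "fs (Pop A X Y) Z = fs Y (Pop A X Z)"
  by (simp add: Pop_def fs_simps fs_linep fs_commute[of Y "linep A X Z"] mult.commute)

lemma fs_Pop_gt_0:
  assumes "Y \<in> tang A" "Y \<noteq> 0"
  shows "fs (Pop A X Y) Y > 0"
  unfolding Pop_def fs_simps fs_linep
  using fs_gt_0[OF tang_hermitian[OF assms(1)] assms(2)] acoef_ge_1
  by (intro add_pos_nonneg) auto

text \<open>The minus sign in \<open>Qop\<close> prevents a termwise estimate; writing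
  \<open>Y\<close> as \<open>Pop\<close> of \<open>Qop A X Y\<close> reduces the claim to
  \<open>Pop\<close>.\<close>

lemma fs_Qop_gt_0:
  assumes "Y \<in> tang A" "Y \<noteq> 0"
  shows "fs (Qop A X Y) Y > 0"
proof -
  have "Qop A X Y \<noteq> 0" using Pop_Qop[of Y] assms(2) by (auto simp: Pop_def linep_def)
  then have "fs (Pop A X (Qop A X Y)) (Qop A X Y) > 0" by (rule fs_Pop_gt_0[OF Qop_tang[OF assms(1)]])
  then show ?thesis by (simp add: Pop_Qop fs_commute)
qed

text \<open>The span of \<open>X\<close> and \<open>Jc A X\<close> is a complex line, so projection
  to it is complex linear; \<open>Pop\<close> and \<open>Qop\<close> inherit this.\<close>

lemma linep_Jc: "Y \<in> tang A \<Longrightarrow> linep A X (Jc A Y) = Jc A (linep A X Y)"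
  by (simp add: linep_def Jc_linear[OF A] Jc_Jc[OF A] fs_Jc_left[OF A] fs_simps)

lemma Pop_Jc: "Y \<in> tang A \<Longrightarrow> Pop A X (Jc A Y) = Jc A (Pop A X Y)"
  by (simp add: Pop_def Jc_linear[OF A] linep_Jc)

lemma Qop_Jc: "Y \<in> tang A \<Longrightarrow> Qop A X (Jc A Y) = Jc A (Qop A X Y)"
  by (simp add: Qop_def Jc_linear[OF A] linep_Jc)

lemma fibre_form_eq: "fibre_form (A, X) U V = fs (linep A X U) V"
  by (simp add: fibre_form_def fs_linep)

text \<open>Removes the division by \<open>fs X X\<close>: at \<open>X = 0\<close> both
  \<open>fibre_form\<close> and \<open>linep\<close> vanish, elsewhere a factor \<open>a - 1\<close>
  cancels. In this form the Gram matrix is visibly smooth across the zero section.\<close>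

lemma calabi_eq: "calabi (A, X) \<xi> \<eta> = fs (Pop A X (fst \<xi>)) (fst \<eta>) + fs (Qop A X (vpart (A, X) \<xi>)) (vpart (A, X) \<eta>)"
proof -
  define a where "a = acoef X"
  have a: "a > 0" "a + 1 > 0" using acoef_pos acoef_ge_1 by (auto simp: a_def)
  have "calabi_h (A, X) U V = fs (Pop A X U) V \<and> calabi_v (A, X) U V = fs (Qop A X U) V" for U V
  proof (cases "X = 0")
    case True
    then show ?thesis
      by (simp add: calabi_h_def calabi_v_def Pop_def Qop_def fs_simps linep_def fibre_form_def)
  next
    case False
    then have "fs X X \<noteq> 0" using fs_eq_0_iff tang_hermitian[OF X] by blast
    then have n: "a\<^sup>2 - 1 \<noteq> 0" by (simp add: acoef_sq a_def)
    have "a - 1 \<noteq> 0" using n by auto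
    have e: "(a - 1) / (2 * ((a\<^sup>2 - 1) / 4)) = 2 / (a + 1)"
      "(a - 1) / (a * (a + 1) * ((a\<^sup>2 - 1) / 4)) = 4 / (a * (a + 1)\<^sup>2)"
    proof -
      have f: "a\<^sup>2 - 1 = (a - 1) * (a + 1)" by (simp add: power2_eq_square algebra_simps)
      have r: "b / (2 * (b * c / 4)) = 2 / c" "b / (a * c * (b * c / 4)) = 4 / (a * c\<^sup>2)"
        if "b \<noteq> 0" "c > 0" for b c :: real
        using that a by (simp_all add: field_simps power2_eq_square)
      show "(a - 1) / (2 * ((a\<^sup>2 - 1) / 4)) = 2 / (a + 1)"
        unfolding f by (rule r(1)[OF \<open>a - 1 \<noteq> 0\<close> a(2)])
      show "(a - 1) / (a * (a + 1) * ((a\<^sup>2 - 1) / 4)) = 4 / (a * (a + 1)\<^sup>2)"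
        unfolding f by (rule r(2)[OF \<open>a - 1 \<noteq> 0\<close> a(2)])
    qed
    show ?thesis
      unfolding calabi_h_def calabi_v_def Let_def snd_conv fibre_form_eq Pop_def Qop_def fs_simps acoef_sq
        a_def[symmetric] e by simp
  qed
  then show ?thesis by (simp add: calabi_def)
qed

lemma vpart_lift_sum [simp]: "vpart p (hlift p U + vlift p V) = V" "fst (hlift p U + vlift p V) = U"
  by (simp_all add: vpart_def) (simp add: hlift_def vlift_def split: prod.splits)

lemma tbundle_eqI:
  "fst \<xi> = fst \<eta> \<Longrightarrow> vpart p \<xi> = vpart p \<eta> \<Longrightarrow> \<xi> = \<eta>"
  using lift_decomposition[of \<xi> p] lift_decomposition[of \<eta> p] by simp

lemma vpart_minus: "vpart (A, X) (- \<xi>) = - vpart (A, X) \<xi>"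
  by (simp add: vpart_def hlift_linear[OF A])

lemma cstr_parts [simp]:
  "fst (cstr1 (A, X) \<xi>) = - Qop A X (vpart (A, X) \<xi>)" "vpart (A, X) (cstr1 (A, X) \<xi>) = Pop A X (fst \<xi>)"
  "fst (cstr2 (A, X) \<xi>) = - Qop A X (Jc A (vpart (A, X) \<xi>))"
  "vpart (A, X) (cstr2 (A, X) \<xi>) = - Jc A (Pop A X (fst \<xi>))"
  unfolding cstr1_def cstr2_def by simp_all

lemma tang_minus: "Y \<in> tang A \<Longrightarrow> - Y \<in> tang A"
  by (rule subspace_neg[OF subspace_tang])

context
  fixes \<xi> assumes \<xi>: "\<xi> \<in> tbundle (A, X)"
begin

lemma tbundle_parts: "fst \<xi> \<in> tang A" "vpart (A, X) \<xi> \<in> tang A"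
  using \<xi> by (auto simp: tbundle_def)

lemma snd_decomp: "snd \<xi> = snd (hlift (A, X) (fst \<xi>)) + vpart (A, X) \<xi>"
  by (simp add: vpart_def)

lemma cstr_tbundle: "cstr1 (A, X) \<xi> \<in> tbundle (A, X)" "cstr2 (A, X) \<xi> \<in> tbundle (A, X)"
  unfolding tbundle_def
  by (simp_all add: tang_minus Qop_tang Pop_tang Jc_tang[OF A] tbundle_parts)

text \<open>On horizontal and vertical parts, \<open>cstr1\<close> maps (h, v) to (-Qv, Ph) and
  \<open>cstr2\<close> maps it to (-QJv, -JPh), with Q inverse to P and J commuting with
  both.\<close>

lemma cstr_sq: "cstr1 (A, X) (cstr1 (A, X) \<xi>) = - \<xi>" "cstr2 (A, X) (cstr2 (A, X) \<xi>) = - \<xi>"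
  by (rule tbundle_eqI[where p = "(A, X)"];
      simp add: vpart_minus Pop_minus Qop_minus Qop_Pop Pop_Qop Jc_Jc[OF A] Jc_linear[OF A]
        Qop_Jc Pop_Jc Qop_tang Pop_tang tbundle_parts tang_minus Jc_tang[OF A])+

text \<open>The composite on the left maps (h, v) to (Jh, -Jv), the third complex structure; the
  opposite order yields (-Jh, Jv).\<close>

lemma cstr_anti: "cstr1 (A, X) (cstr2 (A, X) \<xi>) = - cstr2 (A, X) (cstr1 (A, X) \<xi>)"
  by (rule tbundle_eqI[where p = "(A, X)"];
      simp add: vpart_minus Pop_minus Qop_minus Qop_Pop Pop_Qop Jc_Jc[OF A] Jc_linear[OF A]
        Qop_Jc Pop_Jc Qop_tang Pop_tang tbundle_parts tang_minus Jc_tang[OF A])+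

lemma dJ_eq: "dJ (A, X) \<xi> = Jc A (vpart (A, X) \<xi>) + \<i> *\<^sub>M (X ** fst \<xi> - fst \<xi> ** X)"
  unfolding dJ_def fst_conv snd_conv snd_decomp hlift_snd[OF A X tbundle_parts(1)]
  by (simp add: Jc_expand[OF A] mat_expand CP_idem[OF A]) (simp add: vec_eq_iff algebra_simps)

lemma fs_dJ:
  assumes "Y \<in> tang A"
  shows "fs (dJ (A, X) \<xi>) Y = fs (Jc A (vpart (A, X) \<xi>)) Y"
proof -
  have "fs (\<i> *\<^sub>M (X ** fst \<xi> - fst \<xi> ** X)) Y = 0"
    by (rule fs_even_odd[OF A _ assms])
      (simp add: mat_expand tang_commute[OF A X] tang_commute[OF A tbundle_parts(1)])
  then show ?thesis by (simp add: dJ_eq fs_simps)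
qed

lemma fs_snd:
  assumes "Y \<in> tang A"
  shows "fs (snd \<xi>) Y = fs (vpart (A, X) \<xi>) Y"
  unfolding snd_decomp fs_simps by (simp add: fs_hlift[OF A X tbundle_parts(1) assms])

end

text \<open>\<open>Pop\<close> and \<open>Qop\<close> cancel and the canonical symplectic form
  remains. By \<open>fs_snd\<close>, ambient fibre components may stand for vertical parts, which is
  the shape delivered by \<open>exterior_derivative\<close>.\<close>

lemma calabi_cstr1:
  assumes \<xi>: "\<xi> \<in> tbundle (A, X)" and \<eta>: "\<eta> \<in> tbundle (A, X)"
  shows "calabi (A, X) (cstr1 (A, X) \<xi>) \<eta> = fs (snd \<eta>) (fst \<xi>) - fs (snd \<xi>) (fst \<eta>)"
  unfolding fs_snd[OF \<xi> tbundle_parts(1)[OF \<eta>]] fs_snd[OF \<eta> tbundle_parts(1)[OF \<xi>]]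
  by (simp add: calabi_eq Pop_minus Pop_Qop Qop_Pop fs_simps fs_commute)

lemma calabi_cstr2:
  assumes \<xi>: "\<xi> \<in> tbundle (A, X)" and \<eta>: "\<eta> \<in> tbundle (A, X)"
  shows "calabi (A, X) (cstr2 (A, X) \<xi>) \<eta> = fs (dJ (A, X) \<eta>) (fst \<xi>) - fs (dJ (A, X) \<xi>) (fst \<eta>)"
  unfolding fs_dJ[OF \<xi> tbundle_parts(1)[OF \<eta>]] fs_dJ[OF \<eta> tbundle_parts(1)[OF \<xi>]]
  by (simp add: calabi_eq Pop_minus Qop_minus Pop_Qop Qop_Pop Qop_Jc Pop_Jc Pop_tang Qop_tang Jc_linear[OF A]
      fs_simps tbundle_parts[OF \<xi>] tbundle_parts[OF \<eta>] fs_Jc_left[OF A] fs_commute)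

lemma hlift_snd_linep:
  assumes Y: "Y \<in> tang A"
  shows "snd (hlift (A, X) Y) = X ** Y + Y ** X - (4 * fs X Y) *\<^sub>R A"
proof -
  have "A ** (X ** Y) + A ** (Y ** X) =
      Complex (fs X Y) (fs Y (Jc A X)) *\<^sub>M A + Complex (fs X Y) (- fs Y (Jc A X)) *\<^sub>M A"
    using fs_Jc_left[OF A X, of Y]
    by (simp only: CP_tang_tang(1)[OF A X Y] CP_tang_tang(1)[OF A Y X] fs_commute[of Y X]
        fs_commute[of Y "Jc A X"] minus_minus)
  also have "\<dots> = (2 * fs X Y) *\<^sub>R A"
    by (simp add: scaleR_eq_cscale vec_eq_iff Complex_eq algebra_simps)
  finally have *: "A ** (X ** Y) + A ** (Y ** X) = (2 * fs X Y) *\<^sub>R A" .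
  have "(2 *\<^sub>R A) ** (X ** Y + Y ** X) = 2 *\<^sub>R (A ** (X ** Y) + A ** (Y ** X))"
    by (simp only: scaleR_eq_cscale cscale_mult_left matrix_add_ldistrib cscale_add)
  then show ?thesis by (simp add: hlift_snd[OF A X Y] *)
qed

text \<open>The derivative of \<open>X ** X\<close> along the horizontal lift of \<open>Y\<close>,
  computed from the cubic identities.\<close>

lemma hlift_anticommutator:
  assumes Y: "Y \<in> tang A"
  shows "X ** snd (hlift (A, X) Y) + snd (hlift (A, X) Y) ** X = fs X X *\<^sub>R Y - linep A X Y"
proof -
  have *: "r *\<^sub>R Y + s *\<^sub>R X + t *\<^sub>R Z + 2 *\<^sub>R (s *\<^sub>R X - t *\<^sub>R Z) - (4 * s) *\<^sub>R X
      = r *\<^sub>R Y - (s *\<^sub>R X + t *\<^sub>R Z)" for r s t and Z :: "'n cmat"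
    by (simp add: vec_eq_iff scaleR_conv_of_real algebra_simps)
  have "X ** snd (hlift (A, X) Y) + snd (hlift (A, X) Y) ** X =
    (X ** (X ** Y) + Y ** (X ** X)) + 2 *\<^sub>R (X ** (Y ** X)) - (4 * fs X Y) *\<^sub>R (A ** X + X ** A)"
    by (simp add: hlift_snd_linep[OF Y] mat_expand) (simp add: vec_eq_iff algebra_simps)
  also have "A ** X + X ** A = X" using X by (simp add: tang_def)
  finally show ?thesis
    unfolding XXY_YXX[OF A X Y] linep_def fs_commute[of X Y] by (simp only: *)
qed

text \<open>The bracket is the derivative of \<open>a A - 2/(a+1) X^2\<close> along the vertical
  lift of \<open>V\<close>, where \<open>a\<close> changes by \<open>4 * fs X V / a\<close>. So
  vertically this derivative is the fibre component of the image under \<open>cstr1\<close>.\<close>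

lemma hlift_Qop:
  assumes V: "V \<in> tang A"
  shows "snd (hlift (A, X) (Qop A X V)) = - ((4 * fs X V / acoef X) *\<^sub>R A
     + (8 * fs X V / (acoef X * (acoef X + 1)\<^sup>2)) *\<^sub>R (X ** X)
     - (2 / (acoef X + 1)) *\<^sub>R (X ** V + V ** X))"
proof -
  define s where "s = fs X V"
  define q1 q2 where "q1 = 2 / (acoef X + 1)" and "q2 = 4 / (acoef X * (acoef X + 1)\<^sup>2)"
  have "X ** Jc A X + Jc A X ** X = 0"
    by (simp add: Jc_expand[OF A] mat_expand tang_commute[OF A X]) (simp add: vec_eq_iff algebra_simps)
  then have J0: "snd (hlift (A, X) (Jc A X)) = 0"
    by (simp add: hlift_snd_linep[OF JX_tang] fs_Jc_self[OF A X])
  have "snd (hlift (A, X) (Qop A X V)) =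
      q1 *\<^sub>R (X ** V + V ** X - (4 * s) *\<^sub>R A) - (q2 * s) *\<^sub>R (X ** X + X ** X - (4 * fs X X) *\<^sub>R A)"
    unfolding Qop_def linep_def q1_def[symmetric] q2_def[symmetric] hlift_linear[OF A] J0
    by (simp add: hlift_snd_linep[OF V] hlift_snd_linep[OF X] s_def fs_commute)
  also have "\<dots> = q1 *\<^sub>R (X ** V + V ** X) - (2 * q2 * s) *\<^sub>R (X ** X) - (4 * s * (q1 - q2 * fs X X)) *\<^sub>R A"
    by (simp add: algebra_simps flip: scaleR_2)
  \<comment> \<open>This is the factor by which \<open>Qop\<close> scales \<open>X\<close>; it
    matches the denominator in the derivative of \<open>a\<close>.\<close>
  also have "q1 - q2 * fs X X = 1 / acoef X"
  proof -
    define a where "a = acoef X"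
    have a: "a > 0" "a + 1 > 0" using acoef_pos acoef_ge_1 by (auto simp: a_def)
    have "2 / (a + 1) - 4 / (a * (a + 1)\<^sup>2) * ((a\<^sup>2 - 1) / 4) = 1 / a"
      using a by (simp add: divide_simps power2_eq_square) (simp add: algebra_simps)
    then show ?thesis by (simp add: q1_def q2_def acoef_sq a_def)
  qed
  finally show ?thesis by (simp add: s_def q1_def q2_def)
qed

text \<open>Along horizontal lifts \<open>a\<close> is constant, and
  \<open>hlift_anticommutator\<close> produces the coefficients of \<open>Pop\<close>, in particular
  \<open>a - 2/(a+1) |X|^2 = (a+1)/2\<close>. Vertical directions are \<open>hlift_Qop\<close>. Here
  the constants of the second component are matched to the metric.\<close>

lemma dmoment_eq:
  assumes \<xi>: "\<xi> \<in> tbundle (A, X)"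
  shows "dmoment H (A, X) \<xi> = fs (Pop A X (fst \<xi>)) H - fs (snd (hlift (A, X) (Qop A X (vpart (A, X) \<xi>)))) H"
proof -
  define h v N where "h = fst \<xi>" and "v = vpart (A, X) \<xi>" and "N = snd (hlift (A, X) h)"
  have hv: "h \<in> tang A" "v \<in> tang A" using tbundle_parts[OF \<xi>] by (auto simp: h_def v_def)
  have s: "snd \<xi> = N + v" using snd_decomp[of \<xi>] \<xi> by (simp add: N_def h_def v_def)
  have s1: "fs X (snd \<xi>) = fs X v"
    by (simp add: s fs_simps N_def fs_hlift[OF A X hv(1) X])
  have "X ** snd \<xi> + snd \<xi> ** X = (X ** N + N ** X) + (X ** v + v ** X)"
    by (simp add: s matrix_add_ldistrib matrix_mul_add_left)
  then have s2: "X ** snd \<xi> + snd \<xi> ** X = fs X X *\<^sub>R h - linep A X h + (X ** v + v ** X)"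
    by (simp add: N_def hlift_anticommutator[OF hv(1)])
  define a where "a = acoef X"
  have a: "a > 0" "a + 1 > 0" using acoef_pos acoef_ge_1 by (auto simp: a_def)
  define r where "r = (a\<^sup>2 - 1) / 4"
  have c: "a - 2 / (a + 1) * r = (a + 1) / 2"
    unfolding r_def
    using a by (simp add: divide_simps power2_eq_square) (simp add: algebra_simps)
  have "dmoment H (A, X) \<xi> = (a - 2 / (a + 1) * r) * fs h H + 2 / (a + 1) * fs (linep A X h) H
     + (4 * fs X v / a * fs A H + 8 * fs X v / (a * (a + 1)\<^sup>2) * fs (X ** X) H - 2 / (a + 1) * fs (X ** v + v ** X) H)"
    unfolding dmoment_def Let_def fst_conv snd_conv s1 s2
    unfolding fs_add_left fs_diff_left fs_scaleR_left acoef_sq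
      a_def[symmetric] h_def[symmetric] r_def[symmetric]
    by (simp add: algebra_simps)
  then show ?thesis
    unfolding c v_def[symmetric] h_def[symmetric] hlift_Qop[OF hv(2)] Pop_def
    by (simp add: fs_simps a_def)
qed

lemma dmoment_cstr1:
  assumes \<xi>: "\<xi> \<in> tbundle (A, X)"
  shows "dmoment H (A, X) \<xi> = fs H (snd (cstr1 (A, X) \<xi>))"
  unfolding dmoment_eq[OF \<xi>] snd_decomp[OF cstr_tbundle(1)[OF \<xi>]]
  by (simp add: hlift_linear[OF A] fs_simps fs_commute)

text \<open>The extra J in \<open>cstr2\<close> cancels against the one in \<open>dJ\<close>,
  leaving the same expression as for \<open>cstr1\<close>.\<close>

lemma dmoment_cstr2:
  assumes \<xi>: "\<xi> \<in> tbundle (A, X)"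
  shows "dmoment H (A, X) \<xi> = fs H (dJ (A, X) (cstr2 (A, X) \<xi>))"
proof -
  let ?v = "vpart (A, X) \<xi>"
  have "\<i> *\<^sub>M (X ** (- Jc A (Qop A X ?v)) - (- Jc A (Qop A X ?v)) ** X) = - snd (hlift (A, X) (Qop A X ?v))"
    by (simp add: hlift_def mat_expand)
  then show ?thesis
    unfolding dmoment_eq[OF \<xi>] dJ_eq[OF cstr_tbundle(2)[OF \<xi>]]
    by (simp add: Jc_linear[OF A] Jc_Jc[OF A] Qop_Jc tbundle_parts[OF \<xi>] fs_simps fs_commute)
qed

end

section \<open>Affine charts\<close>

lemmas scaleR_complex = scaleR_conv_of_real[where 'a = complex]

lemma of_real_inner_self: "complex_of_real (z \<bullet> z) = (\<Sum>l\<in>UNIV. z $ l * cnj (z $ l))"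
  by (simp only: inner_vec_def dot_square_norm of_real_sum complex_norm_square)

lemma bounded_bilinear_matrix_mul: "bounded_bilinear ((**) :: complex^'k^'m \<Rightarrow> complex^'n^'k \<Rightarrow> _)"
proof -
  have "bilinear ((**) :: complex^'k^'m \<Rightarrow> complex^'n^'k \<Rightarrow> _)"
    unfolding bilinear_def
    by (auto intro!: linearI simp: matrix_mul_add_left matrix_add_ldistrib
        scaleR_eq_cscale cscale_mult_left cscale_mult_right)
  then show ?thesis by (simp add: bilinear_conv_bounded_bilinear)
qed

lemma bounded_linear_cscale: "bounded_linear ((*\<^sub>M) c :: complex^'n^'m \<Rightarrow> _)"
  unfolding linear_conv_bounded_linear[symmetric]
  by (auto intro!: linearI simp: cscale_add scaleR_eq_cscale cscale_cscale mult.commute)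

lemma bounded_linear_adj: "bounded_linear (adj :: complex^'n^'n \<Rightarrow> _)"
  unfolding linear_conv_bounded_linear[symmetric]
  by (auto intro!: linearI simp: adj_simps scaleR_eq_cscale)

lemmas smooth_on_matrix_product = smooth_on_bilinear[OF bounded_bilinear_matrix_mul]
lemmas smooth_on_cscale = smooth_on_bounded_linear[OF bounded_linear_cscale]
lemmas smooth_on_fs = smooth_on_bilinear[OF bounded_bilinear_fs]

lemma smooth_on_Jc: "smooth_on S A \<Longrightarrow> smooth_on S Y \<Longrightarrow> smooth_on S (\<lambda>x. Jc (A x) (Y x))"
  unfolding Jc_def
  by (intro smooth_on_cscale smooth_on_matrix_product smooth_on_diff smooth_on_const
      smooth_on_bounded_linear[OF bounded_linear_scaleR_right] smooth_on_open) auto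

definition outer :: "complex^'n \<Rightarrow> complex^'n \<Rightarrow> complex^'n^'n" where
  "outer z w = (\<chi> i j. z $ i * cnj (w $ j))"

lemma bounded_bilinear_outer: "bounded_bilinear (outer :: complex^'n \<Rightarrow> _)"
proof -
  have "bilinear (outer :: complex^'n \<Rightarrow> _)"
    unfolding bilinear_def
    by (auto intro!: linearI simp: outer_def vec_eq_iff algebra_simps scaleR_complex)
  then show ?thesis by (simp add: bilinear_conv_bounded_bilinear)
qed

lemmas smooth_on_outer = smooth_on_bilinear[OF bounded_bilinear_outer]

definition proj_of :: "complex^'n \<Rightarrow> complex^'n^'n" where
  "proj_of z = inverse (z \<bullet> z) *\<^sub>R outer z z"

text \<open>The derivative of \<open>proj_of\<close> at \<open>z\<close> in direction \<open>w\<close>.\<close>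

definition dproj :: "complex^'n \<Rightarrow> complex^'n \<Rightarrow> complex^'n^'n" where
  "dproj z w = inverse (z \<bullet> z) *\<^sub>R (outer w z + outer z w)
     - (2 * (z \<bullet> w) * (inverse (z \<bullet> z) * inverse (z \<bullet> z))) *\<^sub>R outer z z"

lemma smooth_on_proj_of:
  assumes "smooth_on S z" "\<And>x. x \<in> S \<Longrightarrow> z x \<noteq> 0"
  shows "smooth_on S (\<lambda>x. proj_of (z x))"
  unfolding proj_of_def
  by (intro smooth_on_scaleR smooth_on_outer smooth_on_inverse smooth_on_bilinear[OF bounded_bilinear_inner] assms)
    (use assms(2) in auto)

lemma smooth_on_dproj:
  assumes "smooth_on S z" "\<And>x. x \<in> S \<Longrightarrow> z x \<noteq> 0" "smooth_on S w"
  shows "smooth_on S (\<lambda>x. dproj (z x) (w x))"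
  unfolding dproj_def
  by (intro smooth_on_scaleR smooth_on_outer smooth_on_inverse smooth_on_diff smooth_on_add smooth_on_mult
      smooth_on_bilinear[OF bounded_bilinear_inner] smooth_on_const smooth_on_open[OF assms(1)] assms)
    (use assms(2) in auto)

lemma has_vector_derivative_proj_of:
  assumes "z \<noteq> 0"
  shows "((\<lambda>t. proj_of (z + t *\<^sub>R w)) has_vector_derivative dproj z w) (at 0)"
proof -
  have l: "((\<lambda>t. z + t *\<^sub>R w) has_derivative (\<lambda>t. t *\<^sub>R w)) (at (0::real))"
    by (auto intro!: derivative_eq_intros)
  have i: "((\<lambda>t. (z + t *\<^sub>R w) \<bullet> (z + t *\<^sub>R w)) has_derivative (\<lambda>t. 2 * t * (z \<bullet> w))) (at (0::real))"
    by (rule has_derivative_eq_rhs[OF has_derivative_inner[OF l l]]) (auto simp: inner_commute)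
  have o: "((\<lambda>t. outer (z + t *\<^sub>R w) (z + t *\<^sub>R w)) has_derivative
      (\<lambda>t. outer z (t *\<^sub>R w) + outer (t *\<^sub>R w) z)) (at (0::real))"
    using bounded_bilinear.FDERIV[OF bounded_bilinear_outer l l] by simp
  have v: "((\<lambda>t. inverse ((z + t *\<^sub>R w) \<bullet> (z + t *\<^sub>R w))) has_derivative
      (\<lambda>t. - (inverse (z \<bullet> z) * (2 * t * (z \<bullet> w)) * inverse (z \<bullet> z)))) (at (0::real))"
    using Deriv.has_derivative_inverse[OF _ i] assms by simp
  have e: "outer z (t *\<^sub>R w) = t *\<^sub>R outer z w" "outer (t *\<^sub>R w) z = t *\<^sub>R outer w z" for t
    by (simp_all add: bounded_bilinear.scaleR_right[OF bounded_bilinear_outer]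
        bounded_bilinear.scaleR_left[OF bounded_bilinear_outer])
  show ?thesis
    unfolding has_vector_derivative_def proj_of_def
    by (rule has_derivative_eq_rhs[OF has_derivative_scaleR[OF v o]])
      (simp add: fun_eq_iff e dproj_def algebra_simps)
qed

lemma outer_mult: "outer z z ** outer z z = (z \<bullet> z) *\<^sub>R outer z z"
proof -
  have "(\<Sum>l\<in>UNIV. z $ i * cnj (z $ l) * (z $ l * cnj (z $ j))) = of_real (z \<bullet> z) * (z $ i * cnj (z $ j))" for i j
  proof -
    show ?thesis
      unfolding of_real_inner_self sum_distrib_right by (rule sum.cong[OF refl]) (simp only: mult_ac)
  qed
  then show ?thesis
    by (simp add: vec_eq_iff matrix_matrix_mult_def outer_def scaleR_complex)
qed

lemma proj_of_CP:
  fixes z :: "complex^('n::finite option)"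
  assumes "z \<noteq> 0"
  shows "proj_of z \<in> CP"
proof -
  have "trace (outer z z) = of_real (z \<bullet> z)"
    by (simp only: of_real_inner_self trace_def outer_def vec_lambda_beta)
  moreover have "hermitian (outer z z)"
    by (simp add: hermitian_adj adj_def outer_def vec_eq_iff mult.commute)
  ultimately have tr: "trace (outer z z) = of_real (z \<bullet> z)" and h: "adj (outer z z) = outer z z"
    by (simp_all add: hermitian_adj)
  have n: "z \<bullet> z \<noteq> 0" using assms by simp
  have "adj (proj_of z) = proj_of z"
    by (simp only: proj_of_def scaleR_eq_cscale adj_simps h complex_cnj_complex_of_real)
  moreover have "trace (proj_of z) = 1"
    unfolding proj_of_def scaleR_eq_cscale trace_cscale tr of_real_mult[symmetric] using n by simp
  moreover have "proj_of z ** proj_of z = proj_of z"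
    unfolding proj_of_def scaleR_eq_cscale cscale_mult_left cscale_mult_right cscale_cscale outer_mult
      of_real_mult[symmetric]
    using n by simp
  ultimately show ?thesis by (simp add: CP_def hermitian_adj)
qed

lemma tangent_space_tang:
  assumes A: "A \<in> CP" and v: "v \<in> tangent_space CP A"
  shows "v \<in> tang A"
proof -
  obtain \<gamma> \<epsilon> where e: "\<epsilon> > 0" and \<gamma>: "\<gamma> ` {-\<epsilon><..<\<epsilon>} \<subseteq> CP" "\<gamma> 0 = A"
    "(\<gamma> has_vector_derivative v) (at (0::real))"
    using v unfolding tangent_space_def by blast
  have d: "(\<gamma> has_derivative (\<lambda>t. t *\<^sub>R v)) (at 0)"
    using \<gamma>(3) by (simp add: has_vector_derivative_def)
  have o: "open {-\<epsilon><..<\<epsilon>}" "0 \<in> {-\<epsilon><..<\<epsilon>}" using e by auto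
  have CP: "adj (\<gamma> t) = \<gamma> t" "\<gamma> t ** \<gamma> t = \<gamma> t" if "t \<in> {-\<epsilon><..<\<epsilon>}" for t
    using \<gamma>(1) that CP_adj[of "\<gamma> t"] CP_idem[of "\<gamma> t"] by blast+
  have "((\<lambda>t. adj (\<gamma> t)) has_derivative (\<lambda>t. adj (t *\<^sub>R v))) (at 0)"
    by (rule bounded_linear.has_derivative[OF bounded_linear_adj d])
  then have "(\<gamma> has_derivative (\<lambda>t. adj (t *\<^sub>R v))) (at 0)"
    by (rule has_derivative_transform_within_open[OF _ o]) (rule CP(1))
  from fun_cong[OF has_derivative_unique[OF d this], of 1] have 1: "adj v = v" by simp
  have "((\<lambda>t. \<gamma> t ** \<gamma> t) has_derivative (\<lambda>t. A ** (t *\<^sub>R v) + (t *\<^sub>R v) ** A)) (at 0)"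
    using bounded_bilinear.FDERIV[OF bounded_bilinear_matrix_mul d d] \<gamma>(2) by simp
  then have "(\<gamma> has_derivative (\<lambda>t. A ** (t *\<^sub>R v) + (t *\<^sub>R v) ** A)) (at 0)"
    by (rule has_derivative_transform_within_open[OF _ o]) (rule CP(2))
  from fun_cong[OF has_derivative_unique[OF d this], of 1] have "A ** v + v ** A = v" by simp
  with 1 show ?thesis by (simp add: tang_def hermitian_adj)
qed

text \<open>The conditions on the \<open>k\<close>-th entries keep the line through \<open>z\<close>
  in direction \<open>w\<close> inside the affine chart, away from 0.\<close>

lemma dproj_tangent:
  fixes z w :: "complex^('n::finite option)"
  assumes "z $ k = 1" "w $ k = 0"
  shows "dproj z w \<in> tangent_space CP (proj_of z)"
proof -
  have nz: "z + t *\<^sub>R w \<noteq> 0" for t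
    using assms by (metis add.right_neutral scaleR_zero_right vector_add_component vector_scaleR_component
        zero_index zero_neq_one)
  have "smooth_on {-1<..<1::real} (\<lambda>t. proj_of (z + t *\<^sub>R w))"
    by (intro smooth_on_proj_of smooth_on_add smooth_on_const smooth_on_ident nz
        smooth_on_bounded_linear[OF bounded_linear_scaleR_left]) auto
  moreover have "((\<lambda>t. proj_of (z + t *\<^sub>R w)) has_vector_derivative dproj z w) (at 0)"
    using has_vector_derivative_proj_of[of z w] nz[of 0] by simp
  ultimately show ?thesis
    unfolding tangent_space_def
    by (intro CollectI exI[of _ "\<lambda>t. proj_of (z + t *\<^sub>R w)"] exI[of _ 1]) (auto simp: proj_of_CP[OF nz])
qed

text \<open>\<open>hcoord k A\<close> are the affine coordinates of the line onto which \<open>A\<close> projects, and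
  \<open>dhcoord k A Y\<close> their derivative in direction \<open>Y\<close>.\<close>

definition hcoord :: "'n \<Rightarrow> complex^'n^'n \<Rightarrow> complex^'n" where
  "hcoord k A = (\<chi> i. A $ i $ k / A $ k $ k)"

definition dhcoord :: "'n \<Rightarrow> complex^'n^'n \<Rightarrow> complex^'n^'n \<Rightarrow> complex^'n" where
  "dhcoord k A Y = (\<chi> i. (Y $ i $ k * A $ k $ k - A $ i $ k * Y $ k $ k) / (A $ k $ k)\<^sup>2)"

lemma proj_of_kk:
  assumes "z $ k = 1"
  shows "proj_of z $ k $ k \<noteq> 0"
proof -
  have "z \<noteq> 0" using assms by auto
  then show ?thesis using assms by (simp add: proj_of_def outer_def)
qed

lemma hcoord_proj_of:
  assumes "z $ k = 1"
  shows "hcoord k (proj_of z) = z"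
proof -
  have "z \<noteq> 0" using assms by auto
  then show ?thesis using assms by (simp add: hcoord_def proj_of_def outer_def vec_eq_iff scaleR_complex)
qed

lemma dhcoord_dproj:
  assumes "z $ k = 1" "w $ k = 0"
  shows "dhcoord k (proj_of z) (dproj z w) = w"
proof -
  have "z \<noteq> 0" using assms by auto
  then have n: "complex_of_real (z \<bullet> z) \<noteq> 0" by simp
  show ?thesis
    unfolding vec_eq_iff
  proof
    fix i
    let ?r = "complex_of_real (z \<bullet> z)" and ?c = "complex_of_real (2 * (z \<bullet> w) * (inverse (z \<bullet> z) * inverse (z \<bullet> z)))"
    have "((inverse ?r * w $ i - ?c * z $ i) * inverse ?r - inverse ?r * z $ i * (- ?c)) / (inverse ?r)\<^sup>2 = w $ i"
      using n by (simp add: field_simps power2_eq_square)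
    then show "dhcoord k (proj_of z) (dproj z w) $ i = w $ i"
      by (simp add: dhcoord_def proj_of_def dproj_def outer_def assms scaleR_complex)
  qed
qed

text \<open>Rank one makes the outer product of the affine coordinates a multiple of
  \<open>A\<close>; trace one identifies the factor with the squared norm.\<close>

lemma CP_proj_of_hcoord:
  assumes A: "A \<in> CP" and k: "A $ k $ k \<noteq> 0"
  shows "proj_of (hcoord k A) = A" "hcoord k A $ k = 1"
proof -
  let ?z = "hcoord k A"
  have h: "cnj (A $ j $ k) = A $ k $ j" for j using hermitianD[OF CP_hermitian[OF A], of k j] by simp
  have o: "outer ?z ?z = inverse (A $ k $ k) *\<^sub>M A"
    using k by (simp add: vec_eq_iff outer_def hcoord_def h CP_rank_one[OF A, symmetric] field_simps)
  have "of_real (?z \<bullet> ?z) = trace (outer ?z ?z)"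
    by (simp only: of_real_inner_self trace_def outer_def vec_lambda_beta)
  also have "\<dots> = inverse (A $ k $ k)" by (simp add: o trace_cscale CP_trace[OF A])
  finally have "complex_of_real (inverse (?z \<bullet> ?z)) = A $ k $ k" by simp
  then show "proj_of ?z = A"
    using k by (simp add: proj_of_def o scaleR_eq_cscale cscale_cscale del: of_real_inverse) (simp add: vec_eq_iff)
  show "?z $ k = 1" using k by (simp add: hcoord_def)
qed

lemma dhcoord_linear: "linear (dhcoord k A)"
  by (rule linearI) (auto simp: dhcoord_def vec_eq_iff scaleR_complex algebra_simps add_divide_distrib diff_divide_distrib)

text \<open>In the kernel, the \<open>k\<close>-th column of \<open>Y\<close> is a multiple of that
  of \<open>A\<close>, hence fixed by \<open>A\<close>, so \<open>Y ** A\<close> has zero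
  \<open>k\<close>-th column. By rank one all columns of \<open>Y ** A\<close> vanish, and the
  adjoint gives \<open>A ** Y = 0\<close>.\<close>

lemma dhcoord_inj:
  assumes A: "A \<in> CP" and k: "A $ k $ k \<noteq> 0" and Y: "Y \<in> tang A" and 0: "dhcoord k A Y = 0"
  shows "Y = 0"
proof -
  define c where "c = Y $ k $ k / A $ k $ k"
  have col: "Y $ i $ k = c * A $ i $ k" for i
    using 0 k by (simp add: dhcoord_def vec_eq_iff c_def field_simps)
  have AA: "(\<Sum>l\<in>UNIV. A $ i $ l * A $ l $ j) = A $ i $ j" for i j
    using arg_cong[OF CP_idem(1)[OF A], of "\<lambda>B. B $ i $ j"] by (simp add: matrix_matrix_mult_def)
  have AY: "(A ** Y) $ i $ k = Y $ i $ k" for i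
  proof -
    have "(A ** Y) $ i $ k = (\<Sum>l\<in>UNIV. c * (A $ i $ l * A $ l $ k))"
      by (simp add: matrix_matrix_mult_def col mult_ac)
    also have "\<dots> = c * A $ i $ k" by (simp only: sum_distrib_left[symmetric] AA)
    finally show ?thesis by (simp add: col)
  qed
  have YAk: "(Y ** A) $ i $ k = 0" for i
    using arg_cong[OF tang_commute(1)[OF A Y], of "\<lambda>B. B $ i $ k"] AY[of i] by simp
  have "(Y ** A) $ i $ j = 0" for i j
  proof -
    have "A $ k $ k * (Y ** A) $ i $ j = (\<Sum>l\<in>UNIV. Y $ i $ l * (A $ l $ j * A $ k $ k))"
      by (simp add: matrix_matrix_mult_def sum_distrib_left mult_ac)
    also have "\<dots> = (Y ** A) $ i $ k * A $ k $ j"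
      unfolding matrix_matrix_mult_def vec_lambda_beta sum_distrib_right
      by (rule sum.cong[OF refl]) (simp only: mult.assoc CP_rank_one[OF A, of _ j k])
    finally show ?thesis using YAk k by simp
  qed
  then have YA: "Y ** A = 0" by (simp add: vec_eq_iff)
  then have "adj (Y ** A) = 0" by (simp add: adj_simps)
  then have "A ** Y = 0"
    using tang_hermitian[OF Y] CP_adj[OF A] by (simp add: adj_mult hermitian_adj)
  with YA Y show ?thesis by (simp add: tang_def)
qed

lemma CP_diag_nonzero:
  assumes "A \<in> CP"
  obtains k where "A $ k $ k \<noteq> 0"
proof (rule ccontr)
  assume "\<not> thesis"
  with that have "A $ k $ k = 0" for k by blast
  then have "trace A = 0" by (simp add: trace_def)
  then show False by (simp add: CP_trace[OF assms])
qed

lemma tang_eq_dproj: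
  assumes A: "A \<in> CP" and k: "A $ k $ k \<noteq> 0" and Y: "Y \<in> tang A"
  shows "Y = dproj (hcoord k A) (dhcoord k A Y)"
proof -
  let ?Z = "dproj (hcoord k A) (dhcoord k A Y)"
  note z = CP_proj_of_hcoord[OF A k]
  have w: "dhcoord k A Y $ k = 0" by (simp add: dhcoord_def mult.commute)
  have "?Z \<in> tang A"
    using dproj_tangent[OF z(2) w] tangent_space_tang[OF A] by (simp add: z(1))
  then have "Y - ?Z \<in> tang A" using Y subspace_diff[OF subspace_tang] by blast
  moreover have "dhcoord k A (Y - ?Z) = 0"
    using dhcoord_dproj[OF z(2) w] by (simp add: z(1) linear_diff[OF dhcoord_linear])
  ultimately have "Y - ?Z = 0" using dhcoord_inj[OF A k] by blast
  then show ?thesis by simp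
qed

lemma tangent_space_CP:
  assumes A: "A \<in> CP"
  shows "tangent_space CP A = tang A"
proof
  show "tangent_space CP A \<subseteq> tang A" using tangent_space_tang[OF A] by blast
  show "tang A \<subseteq> tangent_space CP A"
  proof
    fix Y assume Y: "Y \<in> tang A"
    obtain k where k: "A $ k $ k \<noteq> 0" using CP_diag_nonzero[OF A] .
    have "dhcoord k A Y $ k = 0" by (simp add: dhcoord_def mult.commute)
    then show "Y \<in> tangent_space CP A"
      using dproj_tangent[OF CP_proj_of_hcoord(2)[OF A k], of "dhcoord k A Y"]
        CP_proj_of_hcoord(1)[OF A k] tang_eq_dproj[OF A k Y] by simp
  qed
qed

lemma TCP_eq: "TCP = {(A, X). A \<in> CP \<and> X \<in> tang A}"
  using tangent_space_CP by (auto simp: TCP_def)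

section \<open>The tangent bundle as a submanifold\<close>

lemma local_param_image:
  assumes "local_param M W \<psi>"
  shows "\<psi> ` W \<subseteq> M"
proof -
  have "openin (top_of_set M) (\<psi> ` W)" using assms by (simp add: local_param_def)
  then show ?thesis by (rule openin_imp_subset)
qed

lemma local_param_tangent:
  assumes p: "local_param M W \<psi>" and x: "x \<in> W"
  shows "frechet_derivative \<psi> (at x) v \<in> tangent_space M (\<psi> x)"
proof -
  have s: "smooth_on W \<psi>" using p by (simp add: local_param_def)
  note M = local_param_image[OF p]
  obtain r where r: "r > 0" "ball x r \<subseteq> W" using smooth_on_open[OF s] x openE by blast
  define e where "e = r / (norm v + 1)"
  have e: "e > 0" using r(1) by (simp add: e_def add_nonneg_pos)
  have in_W: "x + t *\<^sub>R v \<in> W" if "t \<in> {-e<..<e}" for t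
  proof -
    have "\<bar>t\<bar> * norm v \<le> \<bar>t\<bar> * (norm v + 1)" by (simp add: mult_left_mono)
    also have "\<dots> < r"
    proof -
      have "\<bar>t\<bar> < r / (norm v + 1)" using that by (simp add: e_def abs_less_iff)
      then show ?thesis by (simp add: pos_less_divide_eq add_nonneg_pos)
    qed
    finally show ?thesis using r(2) by (auto simp: dist_norm subset_iff)
  qed
  have "smooth_on {-e<..<e} (\<lambda>t. \<psi> (x + t *\<^sub>R v))"
    by (rule smooth_on_compose[OF s]) (auto intro!: smooth_on_add smooth_on_const smooth_on_ident
        smooth_on_bounded_linear[OF bounded_linear_scaleR_left] in_W)
  moreover have "((\<lambda>t. \<psi> (x + t *\<^sub>R v)) has_vector_derivative frechet_derivative \<psi> (at x) v) (at 0)"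
  proof -
    have d: "(\<psi> has_derivative frechet_derivative \<psi> (at x)) (at (x + 0 *\<^sub>R v))"
      using smooth_on_has_derivative[OF s x] by simp
    have l: "((\<lambda>t. x + t *\<^sub>R v) has_derivative (\<lambda>t. t *\<^sub>R v)) (at (0::real))"
      by (auto intro!: derivative_eq_intros)
    show ?thesis
      unfolding has_vector_derivative_def
      by (rule has_derivative_eq_rhs[OF has_derivative_compose[OF l d]])
        (simp add: linear_cmul[OF has_derivative_linear[OF d]])
  qed
  ultimately show ?thesis
    unfolding tangent_space_def
    using e M in_W by (intro CollectI exI[of _ "\<lambda>t. \<psi> (x + t *\<^sub>R v)"] exI[of _ e]) auto
qed

text \<open>The assumptions are the linearized equations of \<open>TCP\<close>. They force the even
  part of the fibre component to be that of the horizontal lift, so the difference is odd.\<close>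

lemma tbundleI:
  assumes A: "A \<in> CP" and X: "X \<in> tang A" and 1: "fst \<xi> \<in> tang A" and h: "hermitian (snd \<xi>)"
    and e: "fst \<xi> ** X + A ** snd \<xi> + (X ** fst \<xi> + snd \<xi> ** A) = snd \<xi>"
  shows "\<xi> \<in> tbundle (A, X)"
proof -
  define h2 N where "h2 = snd \<xi>" and "N = snd (hlift (A, X) (fst \<xi>))"
  define W where "W = X ** fst \<xi> + fst \<xi> ** X"
  have AW: "W ** A = A ** W"
    by (simp add: W_def mat_expand tang_commute[OF A X] tang_commute[OF A 1])
  have N: "N = W - 2 *\<^sub>R (A ** W)"
    by (simp add: N_def W_def hlift_snd[OF A X 1] scaleR_eq_cscale cscale_mult_left)
  have aW: "adj W = W"
    using tang_hermitian[OF X] tang_hermitian[OF 1]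
    by (simp add: W_def adj_simps adj_mult hermitian_adj add.commute)
  have "adj (h2 - N) = h2 - N"
    using h by (simp add: h2_def N scaleR_eq_cscale adj_simps adj_mult aW CP_adj[OF A] AW hermitian_adj)
  moreover have "A ** (h2 - N) + (h2 - N) ** A = h2 - N"
  proof -
    have "A ** h2 + h2 ** A = h2 - W" using e by (simp add: h2_def W_def algebra_simps)
    moreover have "A ** N = - (A ** W)"
      by (simp add: N mat_expand CP_idem[OF A]) (simp add: vec_eq_iff)
    moreover have "N ** A = - (A ** W)"
      by (simp add: N scaleR_eq_cscale matrix_mul_diff_left cscale_mult_left matrix_mul_assoc[symmetric] AW CP_idem[OF A])
        (simp add: vec_eq_iff)
    ultimately show ?thesis
      unfolding matrix_mul_diff_left matrix_mul_diff_right
      by (simp add: N algebra_simps scaleR_2)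
  qed
  ultimately have "h2 - N \<in> tang A" by (simp add: tang_def hermitian_adj)
  then show ?thesis using 1 by (simp add: tbundle_def vpart_def h2_def N_def)
qed

lemma tangent_space_TCP:
  assumes p: "p \<in> TCP" and \<xi>: "\<xi> \<in> tangent_space TCP p"
  shows "\<xi> \<in> tbundle p"
proof -
  obtain A X where pe: "p = (A, X)" and A: "A \<in> CP" and X: "X \<in> tang A" using p by (auto simp: TCP_eq)
  obtain \<gamma> \<epsilon> where e: "\<epsilon> > 0" and s: "smooth_on {-\<epsilon><..<\<epsilon>} \<gamma>" and \<gamma>: "\<gamma> ` {-\<epsilon><..<\<epsilon>} \<subseteq> TCP" "\<gamma> 0 = p"
    "(\<gamma> has_vector_derivative \<xi>) (at (0::real))"
    using \<xi> unfolding tangent_space_def by blast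
  have o: "open {-\<epsilon><..<\<epsilon>}" "0 \<in> {-\<epsilon><..<\<epsilon>}" using e by auto
  have d: "(\<gamma> has_derivative (\<lambda>t. t *\<^sub>R \<xi>)) (at 0)"
    using \<gamma>(3) by (simp add: has_vector_derivative_def)
  have d1: "((\<lambda>t. fst (\<gamma> t)) has_derivative (\<lambda>t. t *\<^sub>R fst \<xi>)) (at 0)"
    and d2: "((\<lambda>t. snd (\<gamma> t)) has_derivative (\<lambda>t. t *\<^sub>R snd \<xi>)) (at 0)"
    using has_derivative_fst[OF d] has_derivative_snd[OF d] by simp_all
  have T: "fst (\<gamma> t) \<in> CP" "snd (\<gamma> t) \<in> tang (fst (\<gamma> t))" if "t \<in> {-\<epsilon><..<\<epsilon>}" for t
    using \<gamma>(1) that by (auto simp: TCP_eq image_subset_iff case_prod_beta')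
  have "fst \<xi> \<in> tangent_space CP A"
    unfolding tangent_space_def using e smooth_on_fst[OF s] T d1 \<gamma>(2)
    by (intro CollectI exI[of _ "\<lambda>t. fst (\<gamma> t)"] exI[of _ \<epsilon>]) (auto simp: has_vector_derivative_def pe)
  then have 1: "fst \<xi> \<in> tang A" using tangent_space_CP[OF A] by simp
  have "((\<lambda>t. adj (snd (\<gamma> t))) has_derivative (\<lambda>t. adj (t *\<^sub>R snd \<xi>))) (at 0)"
    by (rule bounded_linear.has_derivative[OF bounded_linear_adj d2])
  then have "((\<lambda>t. snd (\<gamma> t)) has_derivative (\<lambda>t. adj (t *\<^sub>R snd \<xi>))) (at 0)"
    by (rule has_derivative_transform_within_open[OF _ o])
      (use T(2) tang_hermitian hermitian_adj in blast)
  from fun_cong[OF has_derivative_unique[OF d2 this], of 1] have h: "hermitian (snd \<xi>)"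
    by (simp add: hermitian_adj)
  have "((\<lambda>t. fst (\<gamma> t) ** snd (\<gamma> t) + snd (\<gamma> t) ** fst (\<gamma> t)) has_derivative
      (\<lambda>t. (A ** (t *\<^sub>R snd \<xi>) + (t *\<^sub>R fst \<xi>) ** X) + (X ** (t *\<^sub>R fst \<xi>) + (t *\<^sub>R snd \<xi>) ** A))) (at 0)"
    using has_derivative_add[OF bounded_bilinear.FDERIV[OF bounded_bilinear_matrix_mul d1 d2]
        bounded_bilinear.FDERIV[OF bounded_bilinear_matrix_mul d2 d1]] \<gamma>(2) by (simp add: pe)
  then have "((\<lambda>t. snd (\<gamma> t)) has_derivative
      (\<lambda>t. (A ** (t *\<^sub>R snd \<xi>) + (t *\<^sub>R fst \<xi>) ** X) + (X ** (t *\<^sub>R fst \<xi>) + (t *\<^sub>R snd \<xi>) ** A))) (at 0)"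
    by (rule has_derivative_transform_within_open[OF _ o]) (use T(2) in \<open>simp add: tang_def\<close>)
  from fun_cong[OF has_derivative_unique[OF d2 this], of 1]
  have "fst \<xi> ** X + A ** snd \<xi> + (X ** fst \<xi> + snd \<xi> ** A) = snd \<xi>"
    by (simp add: add.commute)
  then show ?thesis unfolding pe by (rule tbundleI[OF A X 1 h])
qed

text \<open>\<open>b\<close> enumerates the homogeneous indices other than the one normalized to 1;
  the index in \<open>4\<close> selects real or imaginary part of the base coordinate
  \<open>z\<close> or the fibre coordinate \<open>w\<close>.\<close>

definition coords :: "('n \<Rightarrow> 'n option) \<Rightarrow> complex^('n option) \<Rightarrow> complex^('n option) \<Rightarrow> real^('n::finite \<times> 4)" where
  "coords b z w = (\<chi> p. let i = b (fst p) in
     if snd p = 1 then Re (z $ i) else if snd p = 2 then Im (z $ i)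
     else if snd p = 3 then Re (w $ i) else Im (w $ i))"

text \<open>The slots \<open>s\<close> and \<open>t\<close> are 1, 2 for the base and 3, 4 for the
  fibre. The entry outside \<open>range b\<close> is 0; \<open>param\<close> adds the normalization
  through \<open>axis k 1\<close>.\<close>

definition uncoords :: "('n \<Rightarrow> 'n option) \<Rightarrow> 4 \<Rightarrow> 4 \<Rightarrow> real^('n::finite \<times> 4) \<Rightarrow> complex^('n option)" where
  "uncoords b s t x = (\<chi> i. if i \<in> range b then Complex (x $ (inv b i, s)) (x $ (inv b i, t)) else 0)"

lemma four_distinct: "(1::4) \<noteq> 2" "(1::4) \<noteq> 3" "(1::4) \<noteq> 4" "(2::4) \<noteq> 3" "(2::4) \<noteq> 4" "(3::4) \<noteq> 4"
  by auto

lemma smooth_on_uncoords: "open S \<Longrightarrow> smooth_on S f \<Longrightarrow> smooth_on S (\<lambda>x. uncoords b s t (f x))"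
proof (rule smooth_on_vec)
  fix i assume S: "open S" and f: "smooth_on S f"
  show "smooth_on S (\<lambda>x. uncoords b s t (f x) $ i)"
  proof (cases "i \<in> range b")
    case True
    have "smooth_on S (\<lambda>x. (f x $ (inv b i, s)) *\<^sub>R 1 + (f x $ (inv b i, t)) *\<^sub>R \<i>)"
      by (intro smooth_on_add smooth_on_scaleR smooth_on_nth f smooth_on_const S)
    then show ?thesis
      by (rule smooth_on_cong) (use True in \<open>simp add: uncoords_def complex_eq_iff\<close>)
  next
    case False
    then show ?thesis using smooth_on_const[OF S] by (simp add: uncoords_def)
  qed
qed

context
  fixes k :: "'n::finite option" and b :: "'n \<Rightarrow> 'n option"
  assumes b: "inj b" "range b = UNIV - {k}"
begin

lemma b_neq [simp]: "b j \<noteq> k" using b(2) by blast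

lemma coords_uncoords: "coords b (axis k 1 + uncoords b 1 2 x) (uncoords b 3 4 x) = x"
proof -
  have "coords b (axis k 1 + uncoords b 1 2 x) (uncoords b 3 4 x) $ (j, s) = x $ (j, s)" for j s
    using exhaust_4[of s] four_distinct b(1)
    by (auto simp: coords_def uncoords_def axis_def)
  then show ?thesis by (simp add: vec_eq_iff split_paired_all)
qed

lemma uncoords_coords:
  assumes "w $ k = 0"
  shows "uncoords b 1 2 (coords b w w') = w" "uncoords b 3 4 (coords b w' w) = w"
proof -
  have "b (inv b i) = i" if "i \<noteq> k" for i using b that by (simp add: f_inv_into_f)
  then show "uncoords b 1 2 (coords b w w') = w" "uncoords b 3 4 (coords b w' w) = w"
    using assms four_distinct by (auto simp: vec_eq_iff uncoords_def coords_def b(2) Let_def complex_eq_iff)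
qed

lemma uncoords_k: "uncoords b s t x $ k = 0"
  by (simp add: uncoords_def b(2))

definition param :: "real^('n \<times> 4) \<Rightarrow> 'n cmat \<times> 'n cmat" where
  "param x = (let z = axis k 1 + uncoords b 1 2 x in (proj_of z, dproj z (uncoords b 3 4 x)))"

definition unparam :: "'n cmat \<times> 'n cmat \<Rightarrow> real^('n \<times> 4)" where
  "unparam p = coords b (hcoord k (fst p)) (dhcoord k (fst p) (snd p))"

lemma base_k: "(axis k 1 + uncoords b s t x) $ k = 1"
  by (simp add: uncoords_k axis_def)

lemma base_nz: "axis k 1 + uncoords b s t x \<noteq> 0"
  using base_k[of s t x] by (metis zero_index zero_neq_one)

lemma unparam_param: "unparam (param x) = x"
  by (simp add: unparam_def param_def Let_def hcoord_proj_of[OF base_k] dhcoord_dproj[OF base_k uncoords_k]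
      coords_uncoords)

lemma param_TCP: "param x \<in> TCP" and param_kk: "fst (param x) $ k $ k \<noteq> 0"
  using dproj_tangent[OF base_k uncoords_k] proj_of_CP[OF base_nz] proj_of_kk[OF base_k]
  by (simp_all add: TCP_def param_def Let_def)

lemma param_unparam:
  assumes p: "p \<in> TCP" and k: "fst p $ k $ k \<noteq> 0"
  shows "param (unparam p) = p"
proof -
  obtain A X where pe: "p = (A, X)" and A: "A \<in> CP" and X: "X \<in> tang A" using p by (auto simp: TCP_eq)
  have k: "A $ k $ k \<noteq> 0" using k pe by simp
  have 0: "(hcoord k A - axis k 1) $ k = 0" "dhcoord k A X $ k = 0"
    using k by (simp_all add: hcoord_def axis_def dhcoord_def mult.commute)
  have "coords b (hcoord k A) w = coords b (hcoord k A - axis k 1) w" for w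
    by (auto simp: coords_def vec_eq_iff axis_def Let_def)
  then have "axis k 1 + uncoords b 1 2 (unparam p) = hcoord k A" "uncoords b 3 4 (unparam p) = dhcoord k A X"
    using uncoords_coords[OF 0(1)] uncoords_coords[OF 0(2)] by (simp_all add: unparam_def pe)
  then show ?thesis
    using CP_proj_of_hcoord(1)[OF A k] tang_eq_dproj[OF A k X] by (simp add: param_def pe)
qed

lemma smooth_on_param: "smooth_on UNIV param"
  unfolding param_def Let_def
  by (intro smooth_on_Pair smooth_on_proj_of smooth_on_dproj smooth_on_add smooth_on_const smooth_on_uncoords
      smooth_on_ident base_nz) auto

lemma param_image: "range param = TCP \<inter> {p. fst p $ k $ k \<noteq> 0}"
  using param_TCP param_kk param_unparam by (auto simp: image_iff) (metis fst_conv)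

text \<open>\<open>unparam\<close> is given by rational expressions in ambient matrix entries, so it
  is differentiable in the ambient space and not only along \<open>TCP\<close>.\<close>

lemma unparam_differentiable:
  assumes "fst p $ k $ k \<noteq> 0"
  shows "(\<lambda>p. unparam p $ q) differentiable (at p)"
proof -
  have n: "(\<lambda>p. fst p $ i $ j) differentiable (at p)" "(\<lambda>p. snd p $ i $ j) differentiable (at p)"
    for i j and p :: "'n cmat \<times> 'n cmat"
    by (auto intro!: bounded_linear_imp_differentiable bounded_linear_intros
        bounded_linear_compose[OF bounded_linear_vec_nth])
  have h: "(\<lambda>p. hcoord k (fst p) $ i) differentiable (at p)"
    "(\<lambda>p. dhcoord k (fst p) (snd p) $ i) differentiable (at p)" for i
    using assms unfolding hcoord_def dhcoord_def
    by (auto intro!: differentiable_divide differentiable_diff differentiable_mult differentiable_power n)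
  have c: "(\<lambda>p. Re (f p)) differentiable (at p)" "(\<lambda>p. Im (f p)) differentiable (at p)"
    if "f differentiable (at p)" for f :: "'n cmat \<times> 'n cmat \<Rightarrow> complex"
    using that bounded_linear.has_derivative[OF bounded_linear_Re] bounded_linear.has_derivative[OF bounded_linear_Im]
    unfolding differentiable_def by blast+
  show ?thesis
    unfolding unparam_def coords_def Let_def vec_lambda_beta
    by (cases "snd q = 1"; cases "snd q = 2"; cases "snd q = 3") (auto intro!: c h)
qed

text \<open>The derivative is injective because \<open>unparam\<close> is a differentiable left
  inverse; the image is open because it is cut out of \<open>TCP\<close> by a nonvanishing diagonal
  entry.\<close>

lemma local_param_param: "local_param TCP UNIV param"
proof -
  have "inj (frechet_derivative param (at x))" for x
  proof -
    note D = smooth_on_has_derivative[OF smooth_on_param UNIV_I[of x]]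
    have "v = 0" if v: "frechet_derivative param (at x) v = 0" for v
    proof -
      have "v $ q = 0" for q
      proof -
        obtain h where h: "((\<lambda>p. unparam p $ q) has_derivative h) (at (param x))"
          using unparam_differentiable[OF param_kk] unfolding differentiable_def by blast
        have "((\<lambda>x. unparam (param x) $ q) has_derivative (\<lambda>v. h (frechet_derivative param (at x) v))) (at x)"
          by (rule has_derivative_compose[OF D h])
        moreover have "((\<lambda>x. unparam (param x) $ q) has_derivative (\<lambda>v. v $ q)) (at x)"
          unfolding unparam_param by (rule bounded_linear_imp_has_derivative[OF bounded_linear_vec_nth])
        ultimately have "(\<lambda>v. h (frechet_derivative param (at x) v)) = (\<lambda>v. v $ q)"
          by (rule has_derivative_unique)
        from fun_cong[OF this, of v] show ?thesis
          using linear_0[OF has_derivative_linear[OF h]] v by simp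
      qed
      then show ?thesis by (simp add: vec_eq_iff)
    qed
    then show ?thesis using linear_injective_0[OF has_derivative_linear[OF D]] by blast
  qed
  moreover have "openin (top_of_set TCP) (range param)"
  proof -
    have "open {p :: 'n cmat \<times> 'n cmat. fst p $ k $ k \<noteq> 0}"
      by (intro open_Collect_neq continuous_intros)
    then show ?thesis unfolding param_image by (rule openin_open_Int)
  qed
  moreover have "homeomorphism UNIV (range param) param unparam"
  proof -
    have "continuous_on UNIV param"
      using smooth_on_Ck[OF smooth_on_param, of 0] by simp
    moreover have "continuous_on (range param) unparam"
    proof -
      have "continuous (at p) (\<lambda>p. unparam p $ q)" if "p \<in> range param" for p q
        using that param_kk differentiable_imp_continuous_within[OF unparam_differentiable] by blast
      then have "continuous_on (range param) (\<lambda>p. \<chi> q. unparam p $ q)"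
        by (intro continuous_on_vec_lambda continuous_at_imp_continuous_on) blast
      then show ?thesis by simp
    qed
    ultimately show ?thesis by (auto simp: homeomorphism_def unparam_param image_image)
  qed
  ultimately show ?thesis using smooth_on_param by (auto simp: local_param_def)
qed

lemma dim_tbundle_le:
  assumes A: "A \<in> CP" and k: "A $ k $ k \<noteq> 0" and X: "X \<in> tang A"
  shows "dim (tbundle (A, X)) \<le> CARD('n \<times> 4)"
proof -
  define L where "L \<xi> = coords b (dhcoord k A (fst \<xi>)) (dhcoord k A (vpart (A, X) \<xi>))" for \<xi>
  have v: "linear (vpart (A, X))"
    by (rule linearI) (simp_all add: vpart_def hlift_linear[OF A] algebra_simps)
  have "linear L"
    by (rule linearI) (auto simp: L_def coords_def Let_def vec_eq_iff linear_add[OF dhcoord_linear]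
        linear_cmul[OF dhcoord_linear] linear_add[OF v] linear_cmul[OF v])
  moreover have sub: "subspace (tbundle (A, X))"
    unfolding tbundle_def using subspace_tang[of A]
    by (auto simp: subspace_def linear_add[OF v] linear_cmul[OF v] linear_0[OF v])
  moreover have "inj_on L (tbundle (A, X))"
  proof -
    have "\<xi> = 0" if \<xi>: "\<xi> \<in> tbundle (A, X)" and 0: "L \<xi> = 0" for \<xi>
    proof -
      have e: "coords b 0 0 = 0" by (simp add: coords_def vec_eq_iff Let_def)
      have u: "uncoords b s t 0 = 0" for s t by (simp add: uncoords_def vec_eq_iff complex_eq_iff)
      have d: "dhcoord k A Y $ k = 0" for Y by (simp add: dhcoord_def mult.commute)
      have "dhcoord k A (fst \<xi>) = 0" "dhcoord k A (vpart (A, X) \<xi>) = 0"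
        using uncoords_coords(1)[OF d[of "fst \<xi>"], of "dhcoord k A (vpart (A, X) \<xi>)"]
          uncoords_coords(2)[OF d[of "vpart (A, X) \<xi>"], of "dhcoord k A (fst \<xi>)"] 0
        by (simp_all add: L_def u)
      then have "fst \<xi> = 0" "vpart (A, X) \<xi> = 0"
        using dhcoord_inj[OF A k] \<xi> by (auto simp: tbundle_def)
      then show ?thesis using linear_0[OF v] by (intro tbundle_eqI[OF A X, where p = "(A, X)"]) auto
    qed
    then show ?thesis using \<open>linear L\<close> sub linear_injective_on_subspace_0 by blast
  qed
  ultimately have "dim (L ` tbundle (A, X)) = dim (tbundle (A, X))"
    by (intro dim_image_eq) (simp_all add: span_eq_iff[THEN iffD2])
  moreover have "dim (L ` tbundle (A, X)) \<le> DIM(real^('n \<times> 4))" by (rule dim_subset_UNIV)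
  ultimately show ?thesis by simp
qed

end

lemma option_index_bij:
  obtains b :: "'n::finite \<Rightarrow> 'n option" where "inj b" "range b = UNIV - {k}"
proof -
  have "card (UNIV :: 'n set) = card (UNIV - {k :: 'n option})" by (simp add: card_UNIV_option)
  then obtain b where "bij_betw b (UNIV :: 'n set) (UNIV - {k :: 'n option})"
    using finite_same_card_bij by (metis finite finite_code)
  then show thesis using that by (auto simp: bij_betw_def)
qed

lemma submanifold_TCP: "submanifold TYPE('n \<times> 4) (TCP :: (('n::finite) cmat \<times> 'n cmat) set)"
  unfolding submanifold_def
proof
  fix p :: "'n cmat \<times> 'n cmat" assume p: "p \<in> TCP"
  then have "fst p \<in> CP" by (auto simp: TCP_def)
  then obtain k where k: "fst p $ k $ k \<noteq> 0" using CP_diag_nonzero by blast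
  obtain b :: "'n \<Rightarrow> 'n option" where b: "inj b" "range b = UNIV - {k}" using option_index_bij .
  have "p \<in> range (param k b)" using p k by (simp add: param_image[OF b])
  then show "\<exists>W \<psi>. local_param TCP W (\<psi> :: real^('n \<times> 4) \<Rightarrow> _) \<and> p \<in> \<psi> ` W"
    using local_param_param[OF b] by blast
qed

text \<open>An injective derivative has image of full dimension, contained in
  \<open>tbundle\<close>, whose dimension is no larger by \<open>dim_tbundle_le\<close>. Thus the
  complex structures can be expanded in any coordinate frame.\<close>

lemma range_local_param:
  fixes \<psi> :: "real^('n::finite \<times> 4) \<Rightarrow> 'n cmat \<times> 'n cmat"
  assumes p: "local_param TCP W \<psi>" and x: "x \<in> W"
  shows "range (frechet_derivative \<psi> (at x)) = tbundle (\<psi> x)"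
proof -
  let ?D = "frechet_derivative \<psi> (at x)"
  have T: "\<psi> x \<in> TCP" using local_param_image[OF p] x by blast
  obtain A X where e: "\<psi> x = (A, X)" and A: "A \<in> CP" and X: "X \<in> tang A" using T by (auto simp: TCP_eq)
  have lin: "linear ?D"
    using p x by (intro has_derivative_linear[OF smooth_on_has_derivative]) (auto simp: local_param_def)
  obtain k where k: "A $ k $ k \<noteq> 0" using CP_diag_nonzero[OF A] .
  obtain b :: "'n \<Rightarrow> 'n option" where b: "inj b" "range b = UNIV - {k}" using option_index_bij .
  have v: "linear (vpart (A, X))"
    by (rule linearI) (simp_all add: vpart_def hlift_linear[OF A] algebra_simps)
  have sub: "subspace (tbundle (\<psi> x))"
    unfolding tbundle_def e using subspace_tang[of A]
    by (auto simp: subspace_def linear_add[OF v] linear_cmul[OF v] linear_0[OF v])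
  have "dim (range ?D) = dim (UNIV :: (real^('n \<times> 4)) set)"
    by (rule dim_image_eq[OF lin]) (use p x in \<open>auto simp: local_param_def\<close>)
  then have "dim (tbundle (\<psi> x)) \<le> dim (range ?D)"
    using dim_tbundle_le[OF b A k X] by (simp add: e)
  moreover have "range ?D \<subseteq> tbundle (\<psi> x)"
    using tangent_space_TCP[OF T local_param_tangent[OF p x]] by blast
  ultimately show ?thesis
    using subspace_dim_equal[OF linear_subspace_image[OF lin subspace_UNIV] sub] by blast
qed

section \<open>The moment map in local coordinates\<close>

lemma local_param_id:
  assumes "open (U :: (real^'k) set)"
  shows "local_param UNIV U id"
  using assms smooth_on_ident[OF assms]
  by (auto simp: local_param_def id_def homeomorphism_def inj_def intro!: exI[of _ "\<lambda>x. x"])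

lemma riemannian_manifold_euclidean:
  "riemannian_manifold TYPE('k::finite) (UNIV :: (real^'k) set) (\<lambda>_. inner)"
  unfolding riemannian_manifold_def
proof (intro conjI allI impI ballI)
  show "submanifold TYPE('k) (UNIV :: (real^'k) set)"
    using local_param_id[OF open_UNIV] by (force simp: submanifold_def)
next
  fix W and \<psi> :: "real^'k \<Rightarrow> real^'k" and i j
  assume "local_param UNIV W \<psi>"
  then have "smooth_on W \<psi>" by (simp add: local_param_def)
  then show "smooth_on W (\<lambda>x. gram (\<lambda>_. inner) \<psi> x $ i $ j)"
    by (simp add: gram_def smooth_on_bilinear[OF bounded_bilinear_inner] smooth_on_pd)
qed (rule inner_commute | simp add: inner_add_left)+

lemma smooth_on_acoef:
  assumes "smooth_on S X" "\<And>x. x \<in> S \<Longrightarrow> hermitian (X x)"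
  shows "smooth_on S (\<lambda>x. acoef (X x))"
  unfolding acoef_def
  by (intro smooth_on_sqrt smooth_on_add smooth_on_mult smooth_on_const smooth_on_open[OF assms(1)] smooth_on_fs assms)
    (use fs_ge_0[OF assms(2)] in \<open>auto intro: add_pos_nonneg\<close>)

lemma smooth_on_divide:
  fixes f g :: "'a::euclidean_space \<Rightarrow> real"
  assumes "smooth_on S f" "smooth_on S g" "\<And>x. x \<in> S \<Longrightarrow> g x > 0"
  shows "smooth_on S (\<lambda>x. f x / g x)"
  unfolding divide_inverse by (intro smooth_on_mult smooth_on_inverse assms)

lemma pd_commute_euclidean:
  fixes f :: "real^'m \<Rightarrow> 'b::euclidean_space"
  assumes f: "smooth_on W f" and x: "x \<in> W"
  shows "pd i (pd j f) x = pd j (pd i f) x"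
proof (rule euclidean_eqI)
  fix b :: 'b
  have s: "smooth_on W (\<lambda>y. f y \<bullet> b)" by (rule smooth_on_bounded_linear[OF bounded_linear_inner_left f])
  have "pd i (pd j f) x \<bullet> b = pd i (pd j (\<lambda>y. f y \<bullet> b)) x" for i j
  proof -
    have "pd i (pd j (\<lambda>y. f y \<bullet> b)) x = pd i (\<lambda>y. pd j f y \<bullet> b) x"
      by (rule pd_cong[OF smooth_on_open[OF f] x]) (rule pd_bounded_linear[OF bounded_linear_inner_left f])
    also have "\<dots> = pd i (pd j f) x \<bullet> b"
      by (rule pd_bounded_linear[OF bounded_linear_inner_left smooth_on_pd[OF f] x])
    finally show ?thesis by simp
  qed
  then show "pd i (pd j f) x \<bullet> b = pd j (pd i f) x \<bullet> b" by (simp add: pd_commute[OF s x])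
qed

section \<open>Linearity, symmetry and positivity\<close>

context
  fixes A X :: "('n::finite) cmat"
  assumes A: "A \<in> CP" and X: "X \<in> tang A"
begin

lemma linear_vpart: "linear (vpart (A, X))"
  by (rule linearI) (simp_all add: vpart_def hlift_linear[OF A] algebra_simps)

lemma linear_Pop: "linear (Pop A X)" and linear_Qop: "linear (Qop A X)"
  by (auto intro!: linearI simp: Pop_def Qop_def linep_scale[OF A X] algebra_simps)

lemma linear_cstr: "linear (cstr1 (A, X))" "linear (cstr2 (A, X))"
proof -
  note l = linear_add[OF linear_vpart] linear_cmul[OF linear_vpart] linear_add[OF linear_Pop]
    linear_cmul[OF linear_Pop] linear_add[OF linear_Qop] linear_cmul[OF linear_Qop]
  show "linear (cstr1 (A, X))" "linear (cstr2 (A, X))"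
    by (intro linearI tbundle_eqI[OF A X, where p = "(A, X)"];
        simp add: l cstr_parts[OF A X] Jc_linear[OF A])+
qed

lemma calabi_linear: "calabi (A, X) (c *\<^sub>R u + v) w = c * calabi (A, X) u w + calabi (A, X) v w"
  by (simp add: calabi_eq[OF A X] linear_add[OF linear_vpart] linear_cmul[OF linear_vpart]
      linear_add[OF linear_Pop] linear_cmul[OF linear_Pop] linear_add[OF linear_Qop]
      linear_cmul[OF linear_Qop] fs_simps algebra_simps)

lemma calabi_commute: "calabi (A, X) u v = calabi (A, X) v u"
proof -
  have "fs (Qop A X Y) Z = fs (Qop A X Z) Y" for Y Z
    by (simp add: Qop_def fs_simps fs_linep[OF A X] fs_commute[of Y Z] mult.commute)
  moreover have "fs (Pop A X Y) Z = fs (Pop A X Z) Y" for Y Z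
    by (subst fs_Pop[OF A X]) (rule fs_commute)
  ultimately show ?thesis by (simp add: calabi_eq[OF A X])
qed

lemma calabi_pos:
  assumes "u \<in> tbundle (A, X)" "u \<noteq> 0"
  shows "calabi (A, X) u u > 0"
proof -
  have t: "fst u \<in> tang A" "vpart (A, X) u \<in> tang A" using tbundle_parts[OF A X assms(1)] by auto
  have "fst u \<noteq> 0 \<or> vpart (A, X) u \<noteq> 0"
    using tbundle_eqI[OF A X, of u 0 "(A, X)"] assms(2) by (auto simp: linear_0[OF linear_vpart])
  moreover have "fs (Pop A X Y) Y \<ge> 0 \<and> fs (Qop A X Y) Y \<ge> 0" if "Y \<in> tang A" for Y
    using fs_Pop_gt_0[OF A X that] fs_Qop_gt_0[OF A X that] by (cases "Y = 0") (auto simp: less_imp_le)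
  ultimately show ?thesis
    using fs_Pop_gt_0[OF A X t(1)] fs_Qop_gt_0[OF A X t(2)] t
    by (auto simp: calabi_eq[OF A X] intro: add_pos_nonneg add_nonneg_pos)
qed

end

section \<open>Coordinate frames, fundamental forms and differentials\<close>

context
  fixes W :: "(real^('n::finite \<times> 4)) set" and \<psi> :: "real^('n \<times> 4) \<Rightarrow> 'n cmat \<times> 'n cmat"
  assumes \<psi>: "local_param TCP W \<psi>"
begin

lemma local_param_smooth: "smooth_on W \<psi>" and local_param_open: "open W"
  using \<psi> smooth_on_open by (auto simp: local_param_def)

lemma local_param_TCP_parts:
  assumes "x \<in> W"
  shows "fst (\<psi> x) \<in> CP" "snd (\<psi> x) \<in> tang (fst (\<psi> x))" "hermitian (snd (\<psi> x))"
  using local_param_image[OF \<psi>] assms tang_hermitian by (auto simp: TCP_eq image_subset_iff case_prod_beta')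

lemmas smooth_on_base = smooth_on_fst[OF local_param_smooth] and smooth_on_fibre = smooth_on_snd[OF local_param_smooth]

lemma smooth_on_acoef_fibre: "smooth_on W (\<lambda>x. acoef (snd (\<psi> x)))"
  by (rule smooth_on_acoef[OF smooth_on_fibre local_param_TCP_parts(3)])

lemma acoef_fibre_pos: "x \<in> W \<Longrightarrow> acoef (snd (\<psi> x)) > 0" "x \<in> W \<Longrightarrow> acoef (snd (\<psi> x)) + 1 > 0"
  using acoef_pos[OF local_param_TCP_parts(1,2)] by (auto intro: add_pos_pos)

lemma smooth_on_gram_calabi: "smooth_on W (\<lambda>x. gram calabi \<psi> x $ i $ j)"
proof -
  have d: "smooth_on W (pd i \<psi>)" for i by (rule smooth_on_pd[OF local_param_smooth])
  have v: "smooth_on W (\<lambda>x. vpart (\<psi> x) (pd i \<psi> x))" for i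
    unfolding vpart_def hlift_def case_prod_beta' snd_conv fst_conv
    by (intro smooth_on_diff smooth_on_snd smooth_on_fst d smooth_on_cscale smooth_on_matrix_product smooth_on_Jc
        smooth_on_base smooth_on_fibre)
  have l: "smooth_on W (\<lambda>x. linep (fst (\<psi> x)) (snd (\<psi> x)) (Y x))" if "smooth_on W Y" for Y
    unfolding linep_def
    by (intro smooth_on_add smooth_on_scaleR smooth_on_fs smooth_on_Jc smooth_on_base smooth_on_fibre that)
  have P: "smooth_on W (\<lambda>x. Pop (fst (\<psi> x)) (snd (\<psi> x)) (Y x))"
    and Q: "smooth_on W (\<lambda>x. Qop (fst (\<psi> x)) (snd (\<psi> x)) (Y x))" if "smooth_on W Y" for Y
    unfolding Pop_def Qop_def power2_eq_square
    by (intro smooth_on_add smooth_on_diff smooth_on_scaleR smooth_on_divide smooth_on_mult smooth_on_const smooth_on_acoef_fibre local_param_open l that;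
        simp add: acoef_fibre_pos)+
  have "smooth_on W (\<lambda>x. fs (Pop (fst (\<psi> x)) (snd (\<psi> x)) (fst (pd i \<psi> x))) (fst (pd j \<psi> x)) +
      fs (Qop (fst (\<psi> x)) (snd (\<psi> x)) (vpart (\<psi> x) (pd i \<psi> x))) (vpart (\<psi> x) (pd j \<psi> x)))"
    by (intro smooth_on_add smooth_on_fs P Q v smooth_on_fst d)
  then show ?thesis
    by (rule smooth_on_cong) (simp add: gram_def calabi_eq[OF local_param_TCP_parts(1,2), simplified])
qed

lemma pd_tbundle: "x \<in> W \<Longrightarrow> pd i \<psi> x \<in> tbundle (\<psi> x)"
  using range_local_param[OF \<psi>] by (auto simp: pd_def)

lemma frechet_eq_sum:
  assumes "x \<in> W"
  shows "frechet_derivative \<psi> (at x) c = (\<Sum>k\<in>UNIV. c $ k *\<^sub>R pd k \<psi> x)"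
proof -
  note lin = has_derivative_linear[OF smooth_on_has_derivative[OF local_param_smooth assms]]
  have "c = (\<Sum>k\<in>UNIV. c $ k *\<^sub>R axis k 1)"
    by (simp add: vec_eq_iff axis_def if_distrib cong: if_cong)
  then have "frechet_derivative \<psi> (at x) c = frechet_derivative \<psi> (at x) (\<Sum>k\<in>UNIV. c $ k *\<^sub>R axis k 1)"
    by simp
  then show ?thesis by (simp add: linear_sum[OF lin] linear_cmul[OF lin] pd_def)
qed

lemma gram_symmetric: "x \<in> W \<Longrightarrow> transpose (gram calabi \<psi> x) = gram calabi \<psi> x"
  using calabi_commute[OF local_param_TCP_parts(1,2), simplified] by (simp add: gram_def transpose_def vec_eq_iff)

lemma calabi_sum:
  assumes "x \<in> W"
  shows "calabi (\<psi> x) (\<Sum>k\<in>UNIV. c $ k *\<^sub>R \<xi> k) \<eta> = (\<Sum>k\<in>UNIV. c $ k * calabi (\<psi> x) (\<xi> k) \<eta>)"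
proof -
  note l = calabi_linear[OF local_param_TCP_parts(1,2)[OF assms], simplified]
  have lin: "linear (\<lambda>\<xi>. calabi (\<psi> x) \<xi> \<eta>)"
  proof (rule linearI)
    have 0: "calabi (\<psi> x) 0 \<eta> = 0" using l[of 1 0 0 \<eta>] by simp
    show "calabi (\<psi> x) (\<xi> + \<zeta>) \<eta> = calabi (\<psi> x) \<xi> \<eta> + calabi (\<psi> x) \<zeta> \<eta>" for \<xi> \<zeta>
      using l[of 1 \<xi> \<zeta> \<eta>] by simp
    show "calabi (\<psi> x) (r *\<^sub>R \<xi>) \<eta> = r *\<^sub>R calabi (\<psi> x) \<xi> \<eta>" for r \<xi>
      using l[of r \<xi> 0 \<eta>] 0 by simp
  qed
  show ?thesis by (subst linear_sum[OF lin]) (simp add: linear_cmul[OF lin])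
qed

lemma gram_invertible:
  assumes x: "x \<in> W"
  shows "invertible (gram calabi \<psi> x)"
proof -
  let ?g = "gram calabi \<psi> x" and ?D = "frechet_derivative \<psi> (at x)"
  have "c = 0" if "?g *v c = 0" for c
  proof -
    have "calabi (\<psi> x) (?D c) (?D c) = c \<bullet> (?g *v c)"
    proof -
      have "calabi (\<psi> x) (?D c) (pd j \<psi> x) = (?g *v c) $ j" for j
        by (simp add: frechet_eq_sum[OF x] calabi_sum[OF x] gram_def matrix_vector_mult_def mult.commute
            calabi_commute[OF local_param_TCP_parts(1,2)[OF x], simplified, of "pd j \<psi> x"])
      then show ?thesis
        by (subst (2) frechet_eq_sum[OF x], subst calabi_commute[OF local_param_TCP_parts(1,2)[OF x], simplified])
          (simp add: calabi_sum[OF x] calabi_commute[OF local_param_TCP_parts(1,2)[OF x], simplified, of "pd _ \<psi> x"]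
            inner_vec_def)
    qed
    then have "\<not> calabi (\<psi> x) (?D c) (?D c) > 0" using that by simp
    moreover have "?D c \<in> tbundle (\<psi> x)" using range_local_param[OF \<psi> x] by blast
    ultimately have "?D c = 0" using calabi_pos[OF local_param_TCP_parts(1,2)[OF x], simplified] by blast
    moreover have "inj ?D" using \<psi> x by (simp add: local_param_def)
    ultimately show ?thesis
      using linear_injective_0[OF has_derivative_linear[OF smooth_on_has_derivative[OF local_param_smooth x]]] by blast
  qed
  then show ?thesis by (metis invertible_left_inverse matrix_left_invertible_ker)
qed

text \<open>The matrix of an endomorphism of the tangent spaces, given on ambient vectors, in the
  coordinate frame; its rows are the images of the frame vectors.\<close>

definition frame_matrix :: "('n cmat \<times> 'n cmat \<Rightarrow> 'n cmat \<times> 'n cmat \<Rightarrow> 'n cmat \<times> 'n cmat)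
    \<Rightarrow> real^('n \<times> 4) \<Rightarrow> real^('n \<times> 4)^('n \<times> 4)" where
  "frame_matrix J x = (\<chi> i. SOME c. frechet_derivative \<psi> (at x) c = J (\<psi> x) (pd i \<psi> x))"

context
  fixes x assumes x: "x \<in> W"
begin

lemma frame_matrix:
  assumes "\<And>\<xi>. \<xi> \<in> tbundle (\<psi> x) \<Longrightarrow> J (\<psi> x) \<xi> \<in> tbundle (\<psi> x)"
  shows "J (\<psi> x) (pd i \<psi> x) = (\<Sum>k\<in>UNIV. frame_matrix J x $ i $ k *\<^sub>R pd k \<psi> x)"
proof -
  have "\<exists>c. frechet_derivative \<psi> (at x) c = J (\<psi> x) (pd i \<psi> x)"
    using assms[OF pd_tbundle[OF x, of i]] range_local_param[OF \<psi> x] by (metis imageE)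
  from someI_ex[OF this] show ?thesis
    by (simp add: frame_matrix_def frechet_eq_sum[OF x])
qed

text \<open>Rows are images of frame vectors, so matrix multiplication reverses the order of
  composition.\<close>

lemma frame_matrix_mult:
  assumes J: "\<And>\<xi>. \<xi> \<in> tbundle (\<psi> x) \<Longrightarrow> J (\<psi> x) \<xi> \<in> tbundle (\<psi> x)"
    and K: "\<And>\<xi>. \<xi> \<in> tbundle (\<psi> x) \<Longrightarrow> K (\<psi> x) \<xi> \<in> tbundle (\<psi> x)" "linear (K (\<psi> x))"
  shows "(\<Sum>k\<in>UNIV. (frame_matrix J x ** frame_matrix K x) $ i $ k *\<^sub>R pd k \<psi> x) = K (\<psi> x) (J (\<psi> x) (pd i \<psi> x))"
proof -
  have "K (\<psi> x) (J (\<psi> x) (pd i \<psi> x)) =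
      (\<Sum>l\<in>UNIV. frame_matrix J x $ i $ l *\<^sub>R (\<Sum>k\<in>UNIV. frame_matrix K x $ l $ k *\<^sub>R pd k \<psi> x))"
    by (simp only: frame_matrix[where J = J, OF J] frame_matrix[where J = K, OF K(1)] linear_sum[OF K(2)] linear_cmul[OF K(2)])
  also have "\<dots> = (\<Sum>k\<in>UNIV. \<Sum>l\<in>UNIV. (frame_matrix J x $ i $ l * frame_matrix K x $ l $ k) *\<^sub>R pd k \<psi> x)"
    by (simp only: scaleR_sum_right scaleR_scaleR) (rule sum.swap)
  finally show ?thesis by (simp add: matrix_matrix_mult_def scaleR_sum_left)
qed

lemma frame_eqI:
  assumes "\<And>i. (\<Sum>k\<in>UNIV. M $ i $ k *\<^sub>R pd k \<psi> x) = (\<Sum>k\<in>UNIV. N $ i $ k *\<^sub>R pd k \<psi> x)"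
  shows "M = N"
proof -
  have "inj (frechet_derivative \<psi> (at x))" using \<psi> x by (simp add: local_param_def)
  then have "M $ i = N $ i" for i
    using assms[of i] by (auto simp: frechet_eq_sum[OF x, symmetric] dest: injD)
  then show ?thesis by (simp add: vec_eq_iff)
qed

lemma cstr_maps: "\<xi> \<in> tbundle (\<psi> x) \<Longrightarrow> cstr1 (\<psi> x) \<xi> \<in> tbundle (\<psi> x)"
  "\<xi> \<in> tbundle (\<psi> x) \<Longrightarrow> cstr2 (\<psi> x) \<xi> \<in> tbundle (\<psi> x)"
  using cstr_tbundle[OF local_param_TCP_parts(1,2)[OF x], simplified] by auto

lemmas linear_cstr_x = linear_cstr[OF local_param_TCP_parts(1,2)[OF x], simplified]

lemma mat_frame: "(\<Sum>k\<in>UNIV. (- mat 1 :: real^('n \<times> 4)^('n \<times> 4)) $ i $ k *\<^sub>R pd k \<psi> x) = - pd i \<psi> x"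
  by (simp add: mat_def if_distrib[of "\<lambda>a. a *\<^sub>R _"] sum_negf cong: if_cong)

lemma frame_cstr_sq:
  "frame_matrix cstr1 x ** frame_matrix cstr1 x = - mat 1"
  "frame_matrix cstr2 x ** frame_matrix cstr2 x = - mat 1"
  by (rule frame_eqI; simp only: frame_matrix_mult cstr_maps linear_cstr_x mat_frame
      cstr_sq[OF local_param_TCP_parts(1,2)[OF x], simplified] pd_tbundle[OF x])+

lemma frame_cstr_anti:
  "frame_matrix cstr1 x ** frame_matrix cstr2 x = - (frame_matrix cstr2 x ** frame_matrix cstr1 x)"
proof (rule frame_eqI)
  fix i
  have "cstr2 (\<psi> x) (cstr1 (\<psi> x) (pd i \<psi> x)) = - cstr1 (\<psi> x) (cstr2 (\<psi> x) (pd i \<psi> x))"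
    using cstr_anti[OF local_param_TCP_parts(1,2)[OF x], simplified, OF pd_tbundle[OF x, of i]] by simp
  then show "(\<Sum>k\<in>UNIV. (frame_matrix cstr1 x ** frame_matrix cstr2 x) $ i $ k *\<^sub>R pd k \<psi> x) =
    (\<Sum>k\<in>UNIV. (- (frame_matrix cstr2 x ** frame_matrix cstr1 x)) $ i $ k *\<^sub>R pd k \<psi> x)"
    by (simp add: frame_matrix_mult cstr_maps linear_cstr_x sum_negf)
qed

lemma frame_matrix_gram:
  assumes "\<And>\<xi>. \<xi> \<in> tbundle (\<psi> x) \<Longrightarrow> J (\<psi> x) \<xi> \<in> tbundle (\<psi> x)"
  shows "frame_matrix J x ** gram calabi \<psi> x = (\<chi> i j. calabi (\<psi> x) (J (\<psi> x) (pd i \<psi> x)) (pd j \<psi> x))"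
  by (simp add: vec_eq_iff matrix_matrix_mult_def gram_def frame_matrix[where J = J, OF assms] calabi_sum[OF x])

lemma pd_A: "pd i (\<lambda>y. fst (\<psi> y)) x = fst (pd i \<psi> x)" and pd_X: "pd i (\<lambda>y. snd (\<psi> y)) x = snd (pd i \<psi> x)"
  by (rule pd_bounded_linear[OF _ local_param_smooth x]; intro bounded_linear_fst bounded_linear_snd)+

lemma pd_JX: "pd i (\<lambda>y. Jc (fst (\<psi> y)) (snd (\<psi> y))) x = dJ (\<psi> x) (pd i \<psi> x)"
proof -
  have s: "smooth_on W (\<lambda>y. fst (\<psi> y) ** snd (\<psi> y))"
    by (rule smooth_on_matrix_product[OF smooth_on_base smooth_on_fibre])
  have "pd i (\<lambda>y. Jc (fst (\<psi> y)) (snd (\<psi> y))) x =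
      pd i (\<lambda>y. \<i> *\<^sub>M snd (\<psi> y) - (2 * \<i>) *\<^sub>M (fst (\<psi> y) ** snd (\<psi> y))) x"
    by (rule pd_cong[OF local_param_open x]) (rule Jc_expand[OF local_param_TCP_parts(1)])
  also have "\<dots> = \<i> *\<^sub>M snd (pd i \<psi> x) -
      (2 * \<i>) *\<^sub>M (fst (pd i \<psi> x) ** snd (\<psi> x) + fst (\<psi> x) ** snd (pd i \<psi> x))"
    by (simp only: pd_diff[OF smooth_on_cscale[OF smooth_on_fibre] smooth_on_cscale[OF s] x]
        pd_bounded_linear[OF bounded_linear_cscale smooth_on_fibre x] pd_bounded_linear[OF bounded_linear_cscale s x]
        pd_bilinear[OF bounded_bilinear_matrix_mul smooth_on_base smooth_on_fibre x] pd_A pd_X)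
  finally show ?thesis by (simp add: dJ_def Jc_expand[OF local_param_TCP_parts(1)[OF x]] cscale_add)
qed

text \<open>The derivatives of \<open>a\<close> and \<open>q = 2 / (a + 1)\<close> are found
  implicitly, from the square of \<open>a\<close> and from \<open>q * (a + 1) = 2\<close>.\<close>

lemma pd_moment2:
  "pd i (\<lambda>y. acoef (snd (\<psi> y)) * fs (fst (\<psi> y)) H
      - 2 / (acoef (snd (\<psi> y)) + 1) * fs (snd (\<psi> y) ** snd (\<psi> y)) H) x = dmoment H (\<psi> x) (pd i \<psi> x)"
proof -
  define a q where "a y = acoef (snd (\<psi> y))" and "q y = 2 / (a y + 1)" for y
  have as: "smooth_on W a" unfolding a_def[abs_def] by (rule smooth_on_acoef_fibre)
  have a: "a y > 0" "a y + 1 > 0" if "y \<in> W" for y using acoef_fibre_pos[OF that] by (simp_all add: a_def)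
  have qs: "smooth_on W q" unfolding q_def[abs_def]
    by (intro smooth_on_divide smooth_on_add smooth_on_const as local_param_open a)
  have c: "smooth_on W (\<lambda>y. c)" for c :: real by (rule smooth_on_const[OF local_param_open])
  have XX: "smooth_on W (\<lambda>y. fs (snd (\<psi> y)) (snd (\<psi> y)))" by (rule smooth_on_fs[OF smooth_on_fibre smooth_on_fibre])
  have da: "pd i a x = 4 * fs (snd (\<psi> x)) (snd (pd i \<psi> x)) / a x"
  proof -
    have "pd i (\<lambda>y. a y * a y) x = pd i (\<lambda>y. 1 + 4 * fs (snd (\<psi> y)) (snd (\<psi> y))) x"
      by (rule pd_cong[OF local_param_open x]) (use fs_ge_0[OF local_param_TCP_parts(3)] in \<open>simp add: a_def acoef_def\<close>)
    then have "2 * a x * pd i a x = 8 * fs (snd (\<psi> x)) (snd (pd i \<psi> x))"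
      by (simp add: pd_mult[OF as as x] pd_add[OF c smooth_on_mult[OF c XX] x] pd_mult[OF c XX x]
          pd_bilinear[OF bounded_bilinear_fs smooth_on_fibre smooth_on_fibre x] pd_X fs_commute[of "snd (pd i \<psi> x)"])
    then show ?thesis using a[OF x] by (simp add: field_simps)
  qed
  have dq: "pd i q x = - 2 * pd i a x / (a x + 1)\<^sup>2"
  proof -
    have "pd i (\<lambda>y. q y * (a y + 1)) x = pd i (\<lambda>y. 2) x"
    proof (rule pd_cong[OF local_param_open x])
      fix y assume "y \<in> W"
      then have "a y + 1 \<noteq> 0" using a(2)[of y] by linarith
      then have "2 = q y * (a y + 1)"
        by (rule iffD1[OF nonzero_divide_eq_eq]) (simp add: q_def)
      then show "q y * (a y + 1) = 2" by simp
    qed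
    then have "pd i q x * (a x + 1) + q x * pd i a x = 0"
      by (simp add: pd_mult[OF qs smooth_on_add[OF as c] x] pd_add[OF as c x])
    then show ?thesis using a[OF x] by (simp add: q_def divide_simps power2_eq_square)
  qed
  have cH: "smooth_on W (\<lambda>y. H)" by (rule smooth_on_const[OF local_param_open])
  have s1: "smooth_on W (\<lambda>y. fs (fst (\<psi> y)) H)" by (rule smooth_on_fs[OF smooth_on_base cH])
  have s2: "smooth_on W (\<lambda>y. snd (\<psi> y) ** snd (\<psi> y))" by (rule smooth_on_matrix_product[OF smooth_on_fibre smooth_on_fibre])
  have s3: "smooth_on W (\<lambda>y. fs (snd (\<psi> y) ** snd (\<psi> y)) H)" by (rule smooth_on_fs[OF s2 cH])
  have "pd i (\<lambda>y. a y * fs (fst (\<psi> y)) H - q y * fs (snd (\<psi> y) ** snd (\<psi> y)) H) x =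
      (pd i a x * fs (fst (\<psi> x)) H + a x * fs (fst (pd i \<psi> x)) H) -
      (pd i q x * fs (snd (\<psi> x) ** snd (\<psi> x)) H +
       q x * fs (snd (pd i \<psi> x) ** snd (\<psi> x) + snd (\<psi> x) ** snd (pd i \<psi> x)) H)"
    by (simp add: pd_diff[OF smooth_on_mult[OF as s1] smooth_on_mult[OF qs s3] x] pd_mult[OF as s1 x]
        pd_mult[OF qs s3 x] pd_bilinear[OF bounded_bilinear_fs smooth_on_base cH x]
        pd_bilinear[OF bounded_bilinear_fs s2 cH x] pd_bilinear[OF bounded_bilinear_matrix_mul smooth_on_fibre smooth_on_fibre x]
        pd_A pd_X)
  also have "\<dots> = dmoment H (\<psi> x) (pd i \<psi> x)"
    unfolding dmoment_def Let_def a_def[symmetric] da[symmetric] dq by (simp add: q_def add.commute)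
  finally show ?thesis by (simp add: a_def q_def)
qed

text \<open>The second derivatives of the base point are symmetric and cancel.\<close>

lemma exterior_derivative:
  assumes Y: "smooth_on W Y"
  shows "pd i (\<lambda>y. - fs (Y y) (fst (pd j \<psi> y))) x - pd j (\<lambda>y. - fs (Y y) (fst (pd i \<psi> y))) x =
    fs (pd j Y x) (fst (pd i \<psi> x)) - fs (pd i Y x) (fst (pd j \<psi> x))"
proof -
  have d: "smooth_on W (\<lambda>y. fst (pd j \<psi> y))" for j by (rule smooth_on_fst[OF smooth_on_pd[OF local_param_smooth]])
  have "pd i (\<lambda>y. - fs (Y y) (fst (pd j \<psi> y))) x =
      - (fs (pd i Y x) (fst (pd j \<psi> x)) + fs (Y x) (fst (pd i (pd j \<psi>) x)))" for i j
    by (simp add: pd_uminus[OF smooth_on_fs[OF Y d] x] pd_bilinear[OF bounded_bilinear_fs Y d x]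
        pd_bounded_linear[OF bounded_linear_fst smooth_on_pd[OF local_param_smooth] x])
  then show ?thesis by (simp add: pd_commute_euclidean[OF local_param_smooth x, of i j])
qed

end

end

lemma riemannian_manifold_TCP:
  "riemannian_manifold TYPE('n::finite \<times> 4) (TCP :: ('n cmat \<times> 'n cmat) set) calabi"
  unfolding riemannian_manifold_def
proof (intro conjI allI impI ballI)
  show "submanifold TYPE('n \<times> 4) (TCP :: ('n cmat \<times> 'n cmat) set)" by (rule submanifold_TCP)
next
  fix p u v w :: "'n cmat \<times> 'n cmat" and c assume p: "p \<in> TCP"
  then have P: "fst p \<in> CP" "snd p \<in> tang (fst p)" by (auto simp: TCP_eq)
  show "calabi p (c *\<^sub>R u + v) w = c * calabi p u w + calabi p v w"
    using calabi_linear[OF P] by simp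
  show "calabi p u v = calabi p v u" using calabi_commute[OF P] by simp
  assume "u \<in> tangent_space TCP p" "u \<noteq> 0"
  then show "calabi p u u > 0" using calabi_pos[OF P] tangent_space_TCP[OF p] by simp
next
  fix W and \<psi> :: "real^('n \<times> 4) \<Rightarrow> 'n cmat \<times> 'n cmat" and i j
  assume "local_param TCP W \<psi>"
  then show "smooth_on W (\<lambda>x. gram calabi \<psi> x $ i $ j)" by (rule smooth_on_gram_calabi)
qed

theorem theorem5p1:
  fixes u :: "('n::finite) cmat"
  assumes "u \<in> su"
  shows "harmonic_morphism TYPE('n \<times> 4) (TCP :: ('n cmat \<times> 'n cmat) set) calabi
           TYPE(3) (UNIV :: (real^3) set) (\<lambda>_. inner)
           (\<lambda>(A, X). vector
              [fs (\<i> *\<^sub>M u) (Jc A X),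
               acoef X * fs A (\<i> *\<^sub>M u) - 2 / (acoef X + 1) * fs (X ** X) (\<i> *\<^sub>M u),
               fs (\<i> *\<^sub>M u) X])"
proof -
  define H where "H = \<i> *\<^sub>M u"
  define \<Phi> :: "'n cmat \<times> 'n cmat \<Rightarrow> real^3" where
    "\<Phi> = (\<lambda>(A, X). vector [fs H (Jc A X), acoef X * fs A H - 2 / (acoef X + 1) * fs (X ** X) H, fs H X])"
  have \<Phi>: "\<Phi> p $ 1 = fs H (Jc (fst p) (snd p))"
    "\<Phi> p $ 2 = acoef (snd p) * fs (fst p) H - 2 / (acoef (snd p) + 1) * fs (snd p ** snd p) H"
    "\<Phi> p $ 3 = fs H (snd p)" for p
    by (simp_all add: \<Phi>_def case_prod_beta' vector_3)
  have smooth: "smooth_on W (\<Phi> \<circ> \<psi>)" if \<psi>: "local_param TCP W \<psi>"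
    for W and \<psi> :: "real^('n \<times> 4) \<Rightarrow> 'n cmat \<times> 'n cmat"
  proof (rule smooth_on_vec[OF local_param_open[OF \<psi>]])
    fix i :: 3
    note s = smooth_on_fs smooth_on_const[OF local_param_open[OF \<psi>]] smooth_on_base[OF \<psi>] smooth_on_fibre[OF \<psi>] smooth_on_acoef_fibre[OF \<psi>]
    have "smooth_on W (\<lambda>x. \<Phi> (\<psi> x) $ 1)"
      unfolding \<Phi> by (intro s smooth_on_Jc)
    moreover have "smooth_on W (\<lambda>x. \<Phi> (\<psi> x) $ 2)"
      unfolding \<Phi> by (intro smooth_on_diff smooth_on_mult smooth_on_divide smooth_on_add smooth_on_matrix_product s)
        (rule acoef_fibre_pos[OF \<psi>])
    moreover have "smooth_on W (\<lambda>x. \<Phi> (\<psi> x) $ 3)"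
      unfolding \<Phi> by (intro s)
    ultimately show "smooth_on W (\<lambda>x. (\<Phi> \<circ> \<psi>) x $ i)"
      using exhaust_3[of i] by auto
  qed
  have "harmonic_on TYPE('n \<times> 4) TCP calabi (TCP \<inter> \<Phi> -` U) (f \<circ> \<Phi>)"
    if U: "openin (top_of_set UNIV) U" and f: "harmonic_on TYPE(3) (UNIV :: (real^3) set) (\<lambda>_. inner) U f" for U f
  proof -
    have "open U" using U by simp
    \<comment> \<open>The identity chart of \<open>U\<close> turns harmonicity on the manifold into
      smoothness and the classical Laplace equation.\<close>
    note id = local_param_id[OF this]
    have fs: "smooth_on U f"
      using f id unfolding harmonic_on_def smooth_on_manifold_def by force
    have f0: "(\<Sum>i\<in>UNIV. pd i (pd i f) y) = 0" if "y \<in> U" for y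
      using f id that unfolding harmonic_on_def laplacian_inner_id[symmetric] by force
    show ?thesis
      unfolding harmonic_on_def smooth_on_manifold_def
    proof (intro conjI allI impI ballI; elim conjE)
      fix W and \<psi> :: "real^('n \<times> 4) \<Rightarrow> 'n cmat \<times> 'n cmat"
      assume \<psi>: "local_param TCP W \<psi>" and sub: "\<psi> ` W \<subseteq> TCP \<inter> \<Phi> -` U"
      then have PU: "(\<Phi> \<circ> \<psi>) ` W \<subseteq> U" by auto
      show "smooth_on W ((f \<circ> \<Phi>) \<circ> \<psi>)"
        using smooth_on_compose[OF fs smooth[OF \<psi>] PU] by (simp add: comp_def)
      note X = smooth_on_fibre[OF \<psi>] and A = smooth_on_base[OF \<psi>] and W = local_param_open[OF \<psi>]
      note J = smooth_on_Jc[OF A X]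
      fix x assume x: "x \<in> W"
      show "laplacian calabi \<psi> (f \<circ> \<Phi>) x = 0"
      proof (rule hyperkaehler_laplacian_compose_eq_0[where W = W and
            ?M1.0 = "frame_matrix \<psi> cstr1" and ?M2.0 = "frame_matrix \<psi> cstr2" and
            ?\<alpha>1.0 = "\<lambda>j y. - fs (snd (\<psi> y)) (fst (pd j \<psi> y))" and
            ?\<alpha>2.0 = "\<lambda>j y. - fs (Jc (fst (\<psi> y)) (snd (\<psi> y))) (fst (pd j \<psi> y))" and U = U])
        show "smooth_on W (\<lambda>y. - fs (snd (\<psi> y)) (fst (pd j \<psi> y)))" for j
          by (intro smooth_on_minus smooth_on_fs X smooth_on_fst smooth_on_pd local_param_smooth[OF \<psi>])
        show "smooth_on W (\<lambda>y. - fs (Jc (fst (\<psi> y)) (snd (\<psi> y))) (fst (pd j \<psi> y)))" for j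
          by (intro smooth_on_minus smooth_on_fs J smooth_on_fst smooth_on_pd local_param_smooth[OF \<psi>])
        fix y assume y: "y \<in> W"
        note P = local_param_TCP_parts(1,2)[OF \<psi> y]
        note T = pd_tbundle[OF \<psi> y]
        show "frame_matrix \<psi> cstr1 y ** gram calabi \<psi> y =
          (\<chi> i j. pd i (\<lambda>y. - fs (snd (\<psi> y)) (fst (pd j \<psi> y))) y - pd j (\<lambda>y. - fs (snd (\<psi> y)) (fst (pd i \<psi> y))) y)"
          by (simp add: frame_matrix_gram[OF \<psi> y] cstr_maps[OF \<psi> y] exterior_derivative[OF \<psi> y X] pd_X[OF \<psi> y]
              calabi_cstr1[OF P, simplified, OF T T])
        show "frame_matrix \<psi> cstr2 y ** gram calabi \<psi> y =
          (\<chi> i j. pd i (\<lambda>y. - fs (Jc (fst (\<psi> y)) (snd (\<psi> y))) (fst (pd j \<psi> y))) y -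
             pd j (\<lambda>y. - fs (Jc (fst (\<psi> y)) (snd (\<psi> y))) (fst (pd i \<psi> y))) y)"
          by (simp add: frame_matrix_gram[OF \<psi> y] cstr_maps[OF \<psi> y] exterior_derivative[OF \<psi> y J] pd_JX[OF \<psi> y]
              calabi_cstr2[OF P, simplified, OF T T])
        have c: "smooth_on W (\<lambda>y. H)" by (rule smooth_on_const[OF W])
        have p1: "pd i ((\<lambda>p. \<Phi> p $ 1) \<circ> \<psi>) y = fs H (dJ (\<psi> y) (pd i \<psi> y))" for i
          by (simp add: \<Phi> comp_def pd_bilinear[OF bounded_bilinear_fs c J y] pd_JX[OF \<psi> y])
        have p2: "pd i ((\<lambda>p. \<Phi> p $ 2) \<circ> \<psi>) y = dmoment H (\<psi> y) (pd i \<psi> y)" for i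
          using pd_moment2[OF \<psi> y, of i H] by (simp add: \<Phi> comp_def)
        have p3: "pd i ((\<lambda>p. \<Phi> p $ 3) \<circ> \<psi>) y = fs H (snd (pd i \<psi> y))" for i
          by (simp add: \<Phi> comp_def pd_bilinear[OF bounded_bilinear_fs c X y] pd_X[OF \<psi> y])
        have lin: "linear (\<lambda>\<xi>. fs H (snd \<xi>))" "linear (\<lambda>\<xi>. fs H (dJ (\<psi> y) \<xi>))"
          by (auto intro!: linearI simp: fs_simps dJ_def Jc_linear[OF P(1)] matrix_mul_add_left cscale_add
              bounded_bilinear.scaleR_left[OF bounded_bilinear_matrix_mul]
              linear_cmul[OF bounded_linear.linear[OF bounded_linear_cscale]] algebra_simps)
        fix i
        have e1: "cstr1 (\<psi> y) (pd i \<psi> y) = (\<Sum>k\<in>UNIV. frame_matrix \<psi> cstr1 y $ i $ k *\<^sub>R pd k \<psi> y)"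
          by (rule frame_matrix[OF \<psi> y]) (rule cstr_maps(1)[OF \<psi> y])
        have e2: "cstr2 (\<psi> y) (pd i \<psi> y) = (\<Sum>k\<in>UNIV. frame_matrix \<psi> cstr2 y $ i $ k *\<^sub>R pd k \<psi> y)"
          by (rule frame_matrix[OF \<psi> y]) (rule cstr_maps(2)[OF \<psi> y])
        show "pd i ((\<lambda>p. \<Phi> p $ 2) \<circ> \<psi>) y =
            (\<Sum>k\<in>UNIV. frame_matrix \<psi> cstr1 y $ i $ k * pd k ((\<lambda>p. \<Phi> p $ 3) \<circ> \<psi>) y)"
          unfolding p2 p3 dmoment_cstr1[OF P, simplified, OF T]
          by (subst e1, subst linear_sum[OF lin(1)]) (simp add: fs_simps)
        show "pd i ((\<lambda>p. \<Phi> p $ 2) \<circ> \<psi>) y =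
            (\<Sum>k\<in>UNIV. frame_matrix \<psi> cstr2 y $ i $ k * pd k ((\<lambda>p. \<Phi> p $ 1) \<circ> \<psi>) y)"
          unfolding p2 p1 dmoment_cstr2[OF P, simplified, OF T]
          by (subst e2, subst linear_sum[OF lin(2)]) (simp add: linear_cmul[OF lin(2)])
      qed (use W smooth_on_gram_calabi[OF \<psi>] gram_symmetric[OF \<psi>] gram_invertible[OF \<psi>] frame_cstr_sq[OF \<psi>]
          frame_cstr_anti[OF \<psi>] smooth[OF \<psi>] fs PU f0 x in auto)
    qed
  qed
  then have "harmonic_morphism TYPE('n \<times> 4) (TCP :: ('n cmat \<times> 'n cmat) set) calabi
      TYPE(3) (UNIV :: (real^3) set) (\<lambda>_. inner) \<Phi>"
    unfolding harmonic_morphism_def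
    using riemannian_manifold_TCP riemannian_manifold_euclidean smooth
    by (auto simp: smooth_on_manifold_def)
  then show ?thesis by (simp add: \<Phi>_def H_def)
qed

end
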